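(* Let $B$ be a unital $C^*$-algebra and let $\mu_1,\mu_2,\mu_3$ be bounded $B$-valued distributions with $\mu_1\boxtimes\mu_2=\mu_3$, $\mu_1\ge0$ and $\mu_1(\mathcal{X})>0$. Set $$K:=\frac{2}{\alpha_1^*}\max\left(\frac{2}{\alpha_1^*}(\sigma_3+\alpha_3)\Big(R_1+2\frac{\sigma_1^2}{\alpha_1^*}\Big),\;R_3+\sigma_3\right),$$ and, for $b\in B$ invertible with $\Vert b\Vert\le K^{-1}$, set $\Delta_b=b\,D(0,\frac{2}{\alpha_1^*})=\{bw':w'\in B,\ \Vert w'\Vert<2/\alpha_1^*\}$ and define $T_b:\Delta_b\to B$ by $$T_b(w)=bH_{\mu_1}\big(b^{-1}wH_{\mu_3}(w)w\big)^{-1}.$$ Then, for any invertible $b\in B$ such that $\Vert b^{-1}\Vert\le K^{-1}$, $T_{b^{-1}}$ is well-defined, and for any $w\in\Delta_{b^{-1}}$ the sequence $T_{b^{-1}}^{\circ n}(w)$ converges to an element $w_3(b)\in B$ independent of the initial choice of $w$. Moreover, $$F_{\mu_2}(b)=b\,w_3(b)\,F_{\mu_3}(w_3(b)^{-1}).$$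
   Context: $B\langle\mathcal{X}\rangle$ is the $*$-algebra of non-commutative polynomials in a self-adjoint variable $\mathcal{X}$ with coefficients in $B$. A $B$-valued distribution is a unital $B$-(bi)module map $\mu:B\langle\mathcal{X}\rangle\to B$ such that $[\mu(f_i^*f_j)]_{1\le i,j\le n}\ge0$ in $M_n(B)$ for all $f_1,\dots,f_n\in B\langle\mathcal{X}\rangle$. It is bounded by $M>0$ if $\Vert\mu(\mathcal{X}b_1\mathcal{X}\cdots\mathcal{X}b_n\mathcal{X})\Vert\le M^{n+1}\Vert b_1\Vert\cdots\Vert b_n\Vert$ for all $b_1,\dots,b_n\in B$. Every bounded distribution is of the form $\mu(P)=E(P(a))$ for some unital inclusion $B\subset A$ of $C^*$-algebras, conditional expectation $E:A\to B$ and self-adjoint $a\in A$; $\mu\ge0$ means it is the distribution of a positive element. Notation: $R_i$ is the bound of $\mu_i$ (so $\mu_i$ is bounded by $R_i$); $\alpha_i=\Vert\mu_i(\mathcal{X})\Vert$; $\alpha_i^*=\inf\mathrm{Spec}\,\mu_i(\mathcal{X})$; $\sigma_i^2=\Vert\mu_i(\mathcal{X}^2)-\mu_i(\mathcal{X})^2\Vert$. For self-adjoint $x\in B$, $x>0$ means positive and invertible, so $\mu_1(\mathcal{X})>0$ gives $\alpha_1^*>0$. $D(0,r)$ is the open ball of $B$ of radius $r$ about $0$. $G_\mu(b)=\mu[(b-\mathcal{X})^{-1}]$ (that is, $E[(b-a)^{-1}]$), $F_\mu(b)=G_\mu(b)^{-1}$, $h_\mu(b)=b-F_\mu(b)$,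 $H_\mu(b)=h_\mu(b^{-1})=b^{-1}-F_\mu(b^{-1})$. These are first defined on elements with positive (or negative) imaginary part; if $\mu$ is bounded by $M$, $H_\mu$ extends analytically to the open ball $\{\Vert b\Vert<M^{-1}\}$ and $H_\mu$ denotes this extension; correspondingly $F_\mu(b)=b-H_\mu(b^{-1})$ for $b$ invertible with $b^{-1}$ in the domain of $H_\mu$. $\mu_1\boxtimes\mu_2$ is the $B$-valued distribution of $a_1a_2$, where $a_1,a_2$ are self-adjoint with distributions $\mu_1,\mu_2$ and free with amalgamation over $B$; $\mu_1\boxtimes\mu_2=\mu_3$ means $\mu_3(\mathcal{X}b_1\mathcal{X}\cdots b_n\mathcal{X})=E(a_1a_2b_1a_1a_2\cdots b_na_1a_2)$ for all $n$ and $b_i\in B$. *)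

theory Defs
  imports "HOL-Analysis.Analysis"
begin

section \<open>Unital C*-algebras\<close>

class has_star =
  fixes star :: "'a \<Rightarrow> 'a"

text \<open>The superclass \<^class>\<open>real_normed_algebra_1\<close> contains \<open>norm 1 = 1\<close>, so the zero algebra is
  excluded.\<close>

class cstar_algebra = real_normed_algebra_1 + banach + has_star +
  fixes scaleC :: "complex \<Rightarrow> 'a \<Rightarrow> 'a" (infixr \<open>*\<^sub>C\<close> 75)
  assumes scaleC_add_right: "c *\<^sub>C (x + y) = c *\<^sub>C x + c *\<^sub>C y"
    and scaleC_add_left: "(c + d) *\<^sub>C x = c *\<^sub>C x + d *\<^sub>C x"
    and scaleC_scaleC: "c *\<^sub>C (d *\<^sub>C x) = (c * d) *\<^sub>C x"
    and scaleC_of_real: "complex_of_real r *\<^sub>C x = r *\<^sub>R x"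
    and scaleC_mult_left: "(c *\<^sub>C x) * y = c *\<^sub>C (x * y)"
    and scaleC_mult_right: "x * (c *\<^sub>C y) = c *\<^sub>C (x * y)"
    and norm_scaleC: "norm (c *\<^sub>C x) = cmod c * norm x"
    and star_star: "star (star x) = x"
    and star_add: "star (x + y) = star x + star y"
    and star_scaleC: "star (c *\<^sub>C x) = cnj c *\<^sub>C star x"
    and star_mult: "star (x * y) = star y * star x"
    and cstar_identity: "norm (star x * x) = (norm x)\<^sup>2"

instantiation complex :: cstar_algebra
begin
definition star_complex :: "complex \<Rightarrow> complex" where "star_complex = cnj"
definition scaleC_complex :: "complex \<Rightarrow> complex \<Rightarrow> complex" where "scaleC_complex = (*)"
instance
  by standard
    (simp_all add: star_complex_def scaleC_complex_def algebra_simps scaleR_conv_of_real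
      norm_mult power2_eq_square)
end

definition invertible_elem :: "'a::monoid_mult \<Rightarrow> bool" where
  "invertible_elem x \<longleftrightarrow> (\<exists>y. x * y = 1 \<and> y * x = 1)"

definition inv_elem :: "'a::monoid_mult \<Rightarrow> 'a" where
  "inv_elem x = (THE y. x * y = 1 \<and> y * x = 1)"

lemma inv_elem_eqI:
  assumes "x * y = 1" "y * x = 1"
  shows "inv_elem x = (y::'a::monoid_mult)"
  unfolding inv_elem_def
  by (rule the_equality) (use assms in \<open>auto, metis mult.assoc mult_1_left mult_1_right\<close>)

definition spectrum :: "'a::cstar_algebra \<Rightarrow> complex set" where
  "spectrum x = {z. \<not> invertible_elem (z *\<^sub>C 1 - x)}"

text \<open>Only used for self-adjoint elements, whose spectrum is real.\<close>

definition inf_spec :: "'a::cstar_algebra \<Rightarrow> real" where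
  "inf_spec x = Inf {t. complex_of_real t \<in> spectrum x}"

definition cstar_positive :: "'a::cstar_algebra \<Rightarrow> bool" where
  "cstar_positive x \<longleftrightarrow> (\<exists>y. x = star y * y)"

definition strictly_positive :: "'a::cstar_algebra \<Rightarrow> bool" where
  "strictly_positive x \<longleftrightarrow> cstar_positive x \<and> invertible_elem x"

text \<open>Positivity in the C*-algebra \<open>M\<^sub>n(B)\<close>: the matrix is \<open>C\<^sup>* C\<close> for some \<open>C\<close> in \<open>M\<^sub>n(B)\<close>.
  Only the entries with indices below \<open>n\<close> matter.\<close>

definition positive_matrix :: "nat \<Rightarrow> (nat \<Rightarrow> nat \<Rightarrow> 'a::cstar_algebra) \<Rightarrow> bool" where
  "positive_matrix n A \<longleftrightarrow>
     (\<exists>C. \<forall>i<n. \<forall>j<n. A i j = (\<Sum>k<n. star (C k i) * C k j))"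

definition Im_part :: "'a::cstar_algebra \<Rightarrow> 'a" where
  "Im_part b = (1 / (2 * \<i>)) *\<^sub>C (b - star b)"

definition half_planes :: "'a::cstar_algebra set" where
  "half_planes = {b. strictly_positive (Im_part b) \<or> strictly_positive (- Im_part b)}"

text \<open>Analyticity of a map between complex Banach spaces on an open set: Frechet
  differentiability with complex-linear derivative.\<close>

definition analytic_map_on :: "('a::cstar_algebra \<Rightarrow> 'b::cstar_algebra) \<Rightarrow> 'a set \<Rightarrow> bool" where
  "analytic_map_on f S \<longleftrightarrow>
     (\<forall>x\<in>S. \<exists>f'. (f has_derivative f') (at x) \<and> (\<forall>c v. f' (c *\<^sub>C v) = c *\<^sub>C f' v))"


section \<open>The *-algebra of non-commutative polynomials\<close>

text \<open>\<open>B\<langle>X\<rangle>\<close> is the complex algebra freely generated by the algebra \<open>B\<close> and one further element \<open>X\<close>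
  (only scalars commute with \<open>X\<close>): terms modulo the least congruence that yields a ring containing
  a unital homomorphic image of \<open>B\<close> and in which the scalars \<open>c 1\<^sub>B\<close> are central. Scalar
  multiplication by \<open>c\<close> is multiplication by the constant \<open>c 1\<^sub>B\<close>.\<close>

datatype 'b nc_term =
    TConst 'b
  | TVar
  | TPlus "'b nc_term" "'b nc_term"
  | TTimes "'b nc_term" "'b nc_term"

inductive nc_eq :: "'b::cstar_algebra nc_term \<Rightarrow> 'b nc_term \<Rightarrow> bool" where
  refl: "nc_eq p p"
| sym: "nc_eq p q \<Longrightarrow> nc_eq q p"
| trans: "nc_eq p q \<Longrightarrow> nc_eq q r \<Longrightarrow> nc_eq p r"
| plus_cong: "nc_eq p p' \<Longrightarrow> nc_eq q q' \<Longrightarrow> nc_eq (TPlus p q) (TPlus p' q')"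
| times_cong: "nc_eq p p' \<Longrightarrow> nc_eq q q' \<Longrightarrow> nc_eq (TTimes p q) (TTimes p' q')"
| plus_assoc: "nc_eq (TPlus (TPlus p q) r) (TPlus p (TPlus q r))"
| plus_comm: "nc_eq (TPlus p q) (TPlus q p)"
| plus_zero: "nc_eq (TPlus (TConst 0) p) p"
| plus_neg: "nc_eq (TPlus (TTimes (TConst (- 1)) p) p) (TConst 0)"
| times_assoc: "nc_eq (TTimes (TTimes p q) r) (TTimes p (TTimes q r))"
| times_one_left: "nc_eq (TTimes (TConst 1) p) p"
| times_one_right: "nc_eq (TTimes p (TConst 1)) p"
| distrib_right: "nc_eq (TTimes (TPlus p q) r) (TPlus (TTimes p r) (TTimes q r))"
| distrib_left: "nc_eq (TTimes p (TPlus q r)) (TPlus (TTimes p q) (TTimes p r))"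
| const_plus: "nc_eq (TConst (x + y)) (TPlus (TConst x) (TConst y))"
| const_times: "nc_eq (TConst (x * y)) (TTimes (TConst x) (TConst y))"
| scalar_central: "nc_eq (TTimes (TConst (c *\<^sub>C 1)) TVar) (TTimes TVar (TConst (c *\<^sub>C 1)))"

quotient_type (overloaded) 'b nc_poly = "'b::cstar_algebra nc_term" / nc_eq
  by (rule equivpI)
    (auto simp: reflp_def symp_def transp_def intro: nc_eq.refl nc_eq.sym nc_eq.trans)

lemma star_one: "star (1::'a::cstar_algebra) = 1"
  by (metis mult_1_left mult_1_right star_mult star_star)

lemma scaleC_zero_left: "0 *\<^sub>C (x::'a::cstar_algebra) = 0"
  using scaleC_of_real[of 0 x] by simp

lemma scaleC_minus_one: "(- 1) *\<^sub>C (x::'a::cstar_algebra) = - x"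
  using scaleC_of_real[of "- 1" x] by simp

lemma star_zero: "star (0::'a::cstar_algebra) = 0"
  using star_add[of "0::'a" 0] by simp

lemma star_minus: "star (- (x::'a::cstar_algebra)) = - star x"
  using star_add[of x "- x"] by (simp add: star_zero eq_neg_iff_add_eq_0 add.commute)

lift_definition nc_const :: "'b::cstar_algebra \<Rightarrow> 'b nc_poly" is TConst .

lift_definition nc_X :: "'b::cstar_algebra nc_poly" is TVar .

instantiation nc_poly :: (cstar_algebra) ring
begin
lift_definition zero_nc_poly :: "'a nc_poly" is "TConst 0" .
lift_definition plus_nc_poly :: "'a nc_poly \<Rightarrow> 'a nc_poly \<Rightarrow> 'a nc_poly" is TPlus
  by (rule nc_eq.plus_cong)
lift_definition times_nc_poly :: "'a nc_poly \<Rightarrow> 'a nc_poly \<Rightarrow> 'a nc_poly" is TTimes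
  by (rule nc_eq.times_cong)
lift_definition uminus_nc_poly :: "'a nc_poly \<Rightarrow> 'a nc_poly" is "TTimes (TConst (- 1))"
  by (rule nc_eq.times_cong[OF nc_eq.refl])
definition minus_nc_poly :: "'a nc_poly \<Rightarrow> 'a nc_poly \<Rightarrow> 'a nc_poly" where
  "minus_nc_poly p q = p + (- q)"
instance
proof
  fix a b c :: "'a nc_poly"
  show "a + b + c = a + (b + c)" by transfer (rule nc_eq.plus_assoc)
  show "a + b = b + a" by transfer (rule nc_eq.plus_comm)
  show "0 + a = a" by transfer (rule nc_eq.plus_zero)
  show "- a + a = 0" by transfer (rule nc_eq.plus_neg)
  show "a - b = a + - b" by (rule minus_nc_poly_def)
  show "a * b * c = a * (b * c)" by transfer (rule nc_eq.times_assoc)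
  show "(a + b) * c = a * c + b * c" by transfer (rule nc_eq.distrib_right)
  show "a * (b + c) = a * b + a * c" by transfer (rule nc_eq.distrib_left)
qed
end

fun nc_term_eval :: "('b \<Rightarrow> 'a) \<Rightarrow> 'a \<Rightarrow> 'b nc_term \<Rightarrow> 'a::cstar_algebra" where
  "nc_term_eval \<iota> a (TConst b) = \<iota> b"
| "nc_term_eval \<iota> a TVar = a"
| "nc_term_eval \<iota> a (TPlus p q) = nc_term_eval \<iota> a p + nc_term_eval \<iota> a q"
| "nc_term_eval \<iota> a (TTimes p q) = nc_term_eval \<iota> a p * nc_term_eval \<iota> a q"

definition unital_inclusion :: "('b::cstar_algebra \<Rightarrow> 'a::cstar_algebra) \<Rightarrow> bool" where
  "unital_inclusion \<iota> \<longleftrightarrow> inj \<iota> \<and> \<iota> 1 = 1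
     \<and> (\<forall>x y. \<iota> (x + y) = \<iota> x + \<iota> y) \<and> (\<forall>c x. \<iota> (c *\<^sub>C x) = c *\<^sub>C \<iota> x)
     \<and> (\<forall>x y. \<iota> (x * y) = \<iota> x * \<iota> y) \<and> (\<forall>x. \<iota> (star x) = star (\<iota> x))"

lemma nc_term_eval_cong:
  assumes i: "unital_inclusion \<iota>" and "nc_eq p q"
  shows "nc_term_eval \<iota> a p = nc_term_eval \<iota> a q"
proof -
  have z: "\<iota> 0 = 0" using i unfolding unital_inclusion_def by (metis add_cancel_right_left)
  have m: "\<iota> (- 1) = - 1"
    using i z unfolding unital_inclusion_def by (metis add.right_inverse add_eq_0_iff)
  show ?thesis using \<open>nc_eq p q\<close>
    by (induction rule: nc_eq.induct)
      (use i z m in \<open>auto simp: unital_inclusion_def algebra_simps scaleC_mult_left scaleC_mult_right\<close>)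
qed

lemma nc_const_inj: "nc_const x = nc_const y \<Longrightarrow> x = y"
proof -
  assume "nc_const x = nc_const y"
  then have "nc_eq (TConst x) (TConst y)" by transfer
  from nc_term_eval_cong[OF _ this, of "\<lambda>x. x" 0] show "x = y"
    by (simp add: unital_inclusion_def)
qed

instantiation nc_poly :: (cstar_algebra) ring_1
begin
lift_definition one_nc_poly :: "'a nc_poly" is "TConst 1" .
instance
proof
  fix a :: "'a nc_poly"
  show "1 * a = a" by transfer (rule nc_eq.times_one_left)
  show "a * 1 = a" by transfer (rule nc_eq.times_one_right)
  have "(0::'a nc_poly) = nc_const 0" "(1::'a nc_poly) = nc_const 1"
    by (transfer, rule nc_eq.refl)+
  then show "(0::'a nc_poly) \<noteq> 1" using nc_const_inj[of 0 "1::'a"] by auto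
qed
end

fun nc_term_star :: "'b::cstar_algebra nc_term \<Rightarrow> 'b nc_term" where
  "nc_term_star (TConst b) = TConst (star b)"
| "nc_term_star TVar = TVar"
| "nc_term_star (TPlus p q) = TPlus (nc_term_star p) (nc_term_star q)"
| "nc_term_star (TTimes p q) = TTimes (nc_term_star q) (nc_term_star p)"

lemma nc_const_neg_one: "nc_const (- 1) = (- 1 :: 'b::cstar_algebra nc_poly)"
proof -
  have "nc_const (- 1) * (1 :: 'b nc_poly) = - 1" by transfer (rule nc_eq.refl)
  then show ?thesis by simp
qed

lemma neg_one_central: "nc_eq (TTimes (TConst (- 1)) p) (TTimes p (TConst (- 1 :: 'b::cstar_algebra)))"
proof -
  have "nc_const (- 1) * P = P * nc_const (- 1)" for P :: "'b nc_poly"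
    by (simp add: nc_const_neg_one)
  from this[of "abs_nc_poly p"] show ?thesis
    by (simp add: nc_const.abs_eq times_nc_poly.abs_eq nc_poly.abs_eq_iff)
qed

lemma nc_term_star_cong: "nc_eq p q \<Longrightarrow> nc_eq (nc_term_star p) (nc_term_star q)"
proof (induction rule: nc_eq.induct)
  case (plus_neg p)
  show ?case
    by (simp add: star_minus star_one star_zero)
      (meson neg_one_central nc_eq.plus_cong nc_eq.plus_neg nc_eq.refl nc_eq.sym nc_eq.trans)
next
  case (scalar_central c)
  show ?case
    by (simp add: star_scaleC star_one) (rule nc_eq.sym[OF nc_eq.scalar_central])
qed (auto simp: star_add star_mult star_one star_zero intro: nc_eq.intros)

instantiation nc_poly :: (cstar_algebra) has_star
begin
lift_definition star_nc_poly :: "'a nc_poly \<Rightarrow> 'a nc_poly" is nc_term_star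
  by (rule nc_term_star_cong)
instance ..
end

text \<open>The value \<open>P(a)\<close>. By \<open>nc_term_eval_cong\<close> it does not depend on the representative of \<open>P\<close>
  when \<open>\<iota>\<close> is a unital inclusion.\<close>

definition nc_eval :: "('b::cstar_algebra \<Rightarrow> 'a::cstar_algebra) \<Rightarrow> 'a \<Rightarrow> 'b nc_poly \<Rightarrow> 'a" where
  "nc_eval \<iota> a P = nc_term_eval \<iota> a (rep_nc_poly P)"

lemma nc_eval_simps:
  assumes "unital_inclusion \<iota>"
  shows "nc_eval \<iota> a (nc_const b) = \<iota> b"
    and "nc_eval \<iota> a nc_X = a"
    and "nc_eval \<iota> a 1 = 1"
    and "nc_eval \<iota> a (P + Q) = nc_eval \<iota> a P + nc_eval \<iota> a Q"
    and "nc_eval \<iota> a (P * Q) = nc_eval \<iota> a P * nc_eval \<iota> a Q"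
proof -
  have r: "nc_eval \<iota> a (abs_nc_poly p) = nc_term_eval \<iota> a p" for p
    unfolding nc_eval_def
    by (rule nc_term_eval_cong[OF assms])
      (metis Quotient_nc_poly Quotient_rep_abs nc_eq.refl)
  show "nc_eval \<iota> a (nc_const b) = \<iota> b" by (simp add: nc_const.abs_eq r)
  show "nc_eval \<iota> a nc_X = a" by (simp add: nc_X.abs_eq r)
  show "nc_eval \<iota> a 1 = 1"
    using assms by (simp add: one_nc_poly.abs_eq r unital_inclusion_def)
  obtain p q where "P = abs_nc_poly p" "Q = abs_nc_poly q"
    by (metis Quotient_nc_poly Quotient_abs_rep)
  then show "nc_eval \<iota> a (P + Q) = nc_eval \<iota> a P + nc_eval \<iota> a Q"
    and "nc_eval \<iota> a (P * Q) = nc_eval \<iota> a P * nc_eval \<iota> a Q"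
    by (simp_all add: plus_nc_poly.abs_eq times_nc_poly.abs_eq r)
qed

text \<open>\<open>alt_word \<iota> y [b\<^sub>1, \<dots>, b\<^sub>n]\<close> is \<open>y \<iota>(b\<^sub>1) y \<dots> y \<iota>(b\<^sub>n) y\<close>.\<close>

fun alt_word :: "('b \<Rightarrow> 'a::monoid_mult) \<Rightarrow> 'a \<Rightarrow> 'b list \<Rightarrow> 'a" where
  "alt_word \<iota> y [] = y"
| "alt_word \<iota> y (b # bs) = y * \<iota> b * alt_word \<iota> y bs"


section \<open>Operator-valued distributions\<close>

definition distribution :: "('b::cstar_algebra nc_poly \<Rightarrow> 'b) \<Rightarrow> bool" where
  "distribution \<mu> \<longleftrightarrow> \<mu> 1 = 1
     \<and> (\<forall>P Q. \<mu> (P + Q) = \<mu> P + \<mu> Q)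
     \<and> (\<forall>b b' P. \<mu> (nc_const b * P * nc_const b') = b * \<mu> P * b')
     \<and> (\<forall>n f. positive_matrix n (\<lambda>i j. \<mu> (star (f i) * f j)))"

definition bounded_by :: "real \<Rightarrow> ('b::cstar_algebra nc_poly \<Rightarrow> 'b) \<Rightarrow> bool" where
  "bounded_by M \<mu> \<longleftrightarrow> M > 0
     \<and> (\<forall>bs. norm (\<mu> (alt_word nc_const nc_X bs)) \<le> M ^ (length bs + 1) * prod_list (map norm bs))"

definition conditional_expectation ::
    "('b::cstar_algebra \<Rightarrow> 'a::cstar_algebra) \<Rightarrow> ('a \<Rightarrow> 'b) \<Rightarrow> bool" where
  "conditional_expectation \<iota> E \<longleftrightarrow>
     (\<forall>x y. E (x + y) = E x + E y) \<and> (\<forall>c x. E (c *\<^sub>C x) = c *\<^sub>C E x)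
     \<and> (\<forall>b. E (\<iota> b) = b) \<and> (\<forall>b b' x. E (\<iota> b * x * \<iota> b') = b * E x * b')
     \<and> (\<forall>x. cstar_positive x \<longrightarrow> cstar_positive (E x)) \<and> (\<forall>x. norm (E x) \<le> norm x)"

text \<open>\<open>\<mu>\<close> is the distribution of the self-adjoint element \<open>a\<close> with respect to the unital inclusion
  \<open>\<iota> : B \<rightarrow> A\<close> of C*-algebras and the conditional expectation \<open>E : A \<rightarrow> B\<close>.\<close>

definition distribution_of ::
    "('b::cstar_algebra \<Rightarrow> 'a::cstar_algebra) \<Rightarrow> ('a \<Rightarrow> 'b) \<Rightarrow> 'a \<Rightarrow> ('b nc_poly \<Rightarrow> 'b) \<Rightarrow> bool" where
  "distribution_of \<iota> E a \<mu> \<longleftrightarrow> unital_inclusion \<iota> \<and> conditional_expectation \<iota> E \<and> star a = a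
     \<and> (\<forall>P. \<mu> P = E (nc_eval \<iota> a P))"

text \<open>Freeness with amalgamation over \<open>B\<close> of the algebras generated by \<open>B\<close> and \<open>a\<^sub>1\<close>, and by \<open>B\<close>
  and \<open>a\<^sub>2\<close>. A word is a list whose entries carry a flag saying which of the two algebras they are
  taken from.\<close>

definition free_over ::
    "('b::cstar_algebra \<Rightarrow> 'a::cstar_algebra) \<Rightarrow> ('a \<Rightarrow> 'b) \<Rightarrow> 'a \<Rightarrow> 'a \<Rightarrow> bool" where
  "free_over \<iota> E a1 a2 \<longleftrightarrow>
     (\<forall>xs :: (bool \<times> 'a) list. xs \<noteq> [] \<longrightarrow>
        (\<forall>(i, x) \<in> set xs. x \<in> range (nc_eval \<iota> (if i then a1 else a2)) \<and> E x = 0) \<longrightarrow>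
        successively (\<noteq>) (map fst xs) \<longrightarrow>
        E (prod_list (map snd xs)) = 0)"

text \<open>\<open>\<mu>\<^sub>3\<close> is the multiplicative convolution of \<open>\<mu>\<^sub>1\<close> and \<open>\<mu>\<^sub>2\<close>, as witnessed by the free pair
  \<open>a\<^sub>1, a\<^sub>2\<close>. As \<open>a\<^sub>1 a\<^sub>2\<close> is in general not self-adjoint, only moments are compared.\<close>

definition mult_convolution ::
    "('b::cstar_algebra \<Rightarrow> 'a::cstar_algebra) \<Rightarrow> ('a \<Rightarrow> 'b) \<Rightarrow> 'a \<Rightarrow> 'a \<Rightarrow>
     ('b nc_poly \<Rightarrow> 'b) \<Rightarrow> ('b nc_poly \<Rightarrow> 'b) \<Rightarrow> ('b nc_poly \<Rightarrow> 'b) \<Rightarrow> bool" where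
  "mult_convolution \<iota> E a1 a2 \<mu>1 \<mu>2 \<mu>3 \<longleftrightarrow>
     distribution_of \<iota> E a1 \<mu>1 \<and> distribution_of \<iota> E a2 \<mu>2 \<and> free_over \<iota> E a1 a2
     \<and> (\<forall>bs. \<mu>3 (alt_word nc_const nc_X bs) = E (alt_word \<iota> (a1 * a2) bs))"

definition mean_norm :: "('b::cstar_algebra nc_poly \<Rightarrow> 'b) \<Rightarrow> real" where
  "mean_norm \<mu> = norm (\<mu> nc_X)"

definition mean_inf :: "('b::cstar_algebra nc_poly \<Rightarrow> 'b) \<Rightarrow> real" where
  "mean_inf \<mu> = inf_spec (\<mu> nc_X)"

definition std_dev :: "('b::cstar_algebra nc_poly \<Rightarrow> 'b) \<Rightarrow> real" where
  "std_dev \<mu> = sqrt (norm (\<mu> (nc_X\<^sup>2) - (\<mu> nc_X)\<^sup>2))"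


section \<open>Analytic transforms\<close>

text \<open>The transforms depend only on the distribution of \<open>a\<close>; they are written in terms of a
  realization \<open>(\<iota>, E, a)\<close> because \<open>(b - X)\<^sup>-\<^sup>1\<close> is not a polynomial. The functions with suffix
  \<open>0\<close> are meant on \<^const>\<open>half_planes\<close> only.\<close>

definition G_transform0 ::
    "('b::cstar_algebra \<Rightarrow> 'a::cstar_algebra) \<Rightarrow> ('a \<Rightarrow> 'b) \<Rightarrow> 'a \<Rightarrow> 'b \<Rightarrow> 'b" where
  "G_transform0 \<iota> E a b = E (inv_elem (\<iota> b - a))"

definition F_transform0 ::
    "('b::cstar_algebra \<Rightarrow> 'a::cstar_algebra) \<Rightarrow> ('a \<Rightarrow> 'b) \<Rightarrow> 'a \<Rightarrow> 'b \<Rightarrow> 'b" where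
  "F_transform0 \<iota> E a b = inv_elem (G_transform0 \<iota> E a b)"

definition h_transform0 ::
    "('b::cstar_algebra \<Rightarrow> 'a::cstar_algebra) \<Rightarrow> ('a \<Rightarrow> 'b) \<Rightarrow> 'a \<Rightarrow> 'b \<Rightarrow> 'b" where
  "h_transform0 \<iota> E a b = b - F_transform0 \<iota> E a b"

definition H_transform0 ::
    "('b::cstar_algebra \<Rightarrow> 'a::cstar_algebra) \<Rightarrow> ('a \<Rightarrow> 'b) \<Rightarrow> 'a \<Rightarrow> 'b \<Rightarrow> 'b" where
  "H_transform0 \<iota> E a b = h_transform0 \<iota> E a (inv_elem b)"

definition H_extension ::
    "('b::cstar_algebra \<Rightarrow> 'a::cstar_algebra) \<Rightarrow> ('a \<Rightarrow> 'b) \<Rightarrow> 'a \<Rightarrow> real \<Rightarrow> ('b \<Rightarrow> 'b) \<Rightarrow> bool" where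
  "H_extension \<iota> E a r h \<longleftrightarrow> analytic_map_on h (ball 0 r)
     \<and> (\<forall>b \<in> ball 0 r \<inter> half_planes. h b = H_transform0 \<iota> E a b)"

text \<open>The open ball about \<open>0\<close>, of largest radius, to which \<open>H\<close> extends analytically. It contains
  the ball of radius \<open>1 / M\<close> whenever the distribution of \<open>a\<close> is bounded by \<open>M\<close>.\<close>

definition H_domain ::
    "('b::cstar_algebra \<Rightarrow> 'a::cstar_algebra) \<Rightarrow> ('a \<Rightarrow> 'b) \<Rightarrow> 'a \<Rightarrow> 'b set" where
  "H_domain \<iota> E a = {b. \<exists>r h. norm b < r \<and> H_extension \<iota> E a r h}"

text \<open>On \<^const>\<open>H_domain\<close> the value of the analytic extension, which is unique by the identity
  theorem.\<close>

definition H_transform ::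
    "('b::cstar_algebra \<Rightarrow> 'a::cstar_algebra) \<Rightarrow> ('a \<Rightarrow> 'b) \<Rightarrow> 'a \<Rightarrow> 'b \<Rightarrow> 'b" where
  "H_transform \<iota> E a b =
     (if b \<in> H_domain \<iota> E a
      then (THE v. \<exists>r h. norm b < r \<and> H_extension \<iota> E a r h \<and> v = h b)
      else H_transform0 \<iota> E a b)"

definition F_transform ::
    "('b::cstar_algebra \<Rightarrow> 'a::cstar_algebra) \<Rightarrow> ('a \<Rightarrow> 'b) \<Rightarrow> 'a \<Rightarrow> 'b \<Rightarrow> 'b" where
  "F_transform \<iota> E a b = b - H_transform \<iota> E a (inv_elem b)"


section \<open>The iteration\<close>

definition K_const :: "real \<Rightarrow> real \<Rightarrow> ('b::cstar_algebra nc_poly \<Rightarrow> 'b) \<Rightarrow> ('b nc_poly \<Rightarrow> 'b) \<Rightarrow> real" where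
  "K_const R1 R3 \<mu>1 \<mu>3 =
     2 / mean_inf \<mu>1 *
       max (2 / mean_inf \<mu>1 * (std_dev \<mu>3 + mean_norm \<mu>3) * (R1 + 2 * ((std_dev \<mu>1)\<^sup>2 / mean_inf \<mu>1)))
           (R3 + std_dev \<mu>3)"

definition Delta :: "('b::cstar_algebra nc_poly \<Rightarrow> 'b) \<Rightarrow> 'b \<Rightarrow> 'b set" where
  "Delta \<mu>1 b = {b * w' |w'. norm w' < 2 / mean_inf \<mu>1}"

definition T_arg :: "('b::cstar_algebra \<Rightarrow> 'b) \<Rightarrow> 'b \<Rightarrow> 'b \<Rightarrow> 'b" where
  "T_arg H3 b w = inv_elem b * w * H3 w * w"

definition T_map :: "('b::cstar_algebra \<Rightarrow> 'b) \<Rightarrow> ('b \<Rightarrow> 'b) \<Rightarrow> 'b \<Rightarrow> 'b \<Rightarrow> 'b" where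
  "T_map H1 H3 b w = b * inv_elem (H1 (T_arg H3 b w))"

end

theory Submission
  imports Defs "HOL-Complex_Analysis.Conformal_Mappings"
begin

text \<open>Write \<open>H\<^sub>\<mu>(c) = E a + \<Sum>\<^sub>n E (a c V\<^sub>n(c))\<close> with \<open>V\<^sub>0 = a - E a\<close> and \<open>V\<^sub>n\<^sub>+\<^sub>1 = (1 - E)(a c V\<^sub>n)\<close> (Boolean cumulants).
  The Cauchy--Schwarz inequality for \<open>E\<close> and the moment bound \<open>R\<close> give \<open>\<parallel>H\<^sub>\<mu>(c) - E a\<parallel> \<le> \<sigma>\<^sup>2 \<parallel>c\<parallel> / (1 - R \<parallel>c\<parallel>)\<close> and
  the Lipschitz constant \<open>\<sigma>\<^sup>2 / (1 - R r)\<^sup>2\<close> on the ball of radius \<open>r\<close>. In the variable \<open>w'\<close> with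
  \<open>w = c w'\<close>, \<open>c = b\<^sup>-\<^sup>1\<close>, the map is \<open>\<Psi>(w') = H\<^sub>1(w' H\<^sub>3(c w') c w')\<^sup>-\<^sup>1\<close>. With \<open>\<rho> = 2 / \<alpha>\<^sub>1\<^sup>*\<close>, the argument of \<open>H\<^sub>1\<close> being
  quadratic in \<open>w'\<close>, it sends the ball of radius \<open>s \<rho>\<close> into the one of radius \<open>\<rho> / (2 - s\<^sup>2)\<close>; hence all
  orbits enter the ball of radius \<open>2\<rho>/3\<close>, on which \<open>\<Psi>\<close> is a contraction in norm, even for
  \<open>\<parallel>c\<parallel> \<le> 21 / (20 K)\<close>. The fixed point \<open>w'(c)\<close> is therefore analytic on a ball of radius larger than \<open>1 / K\<close>,
  and so is \<open>w'(c) H\<^sub>3(c w'(c))\<close>. For small \<open>c\<close> freeness identifies it with \<open>H\<^sub>2(c)\<close>, and the identity theorem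
  (reduced to complex-valued functions by Hahn--Banach) extends this to the whole ball.\<close>

section \<open>C*-algebra basics\<close>

text \<open>The numbers \<open>R1\<close> and \<open>R3\<close> bound only moments, while the
  realizing elements may have larger norm; this forces the detour through the seminorm attached to
  \<open>E\<close>, where operator norms would be simpler. A second obstacle:
  \<open>norm (inv_elem b) = 1 / K\<close> is allowed, whereas \<open>H_domain\<close> is made of
  open balls. Analyticity is therefore needed beyond \<open>1 / K\<close>, where the estimates no
  longer map the ball of radius \<rho> into itself. The radius \<open>2 / 3 * \<rho>\<close> lies
  above the attracting point (sqrt 5 - 1) / 2 of the scalar iteration, so orbits reach it, and it
  leaves room for the factor 21/20, since 2/3 * 21/20 = 7/10. Finally, an extension of the transform
  of \<mu>2 to the whole ball cannot be presupposed. For small c the moments define p by M = p + M c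
  p; a second contraction, with p in place of w' H3(c w'), produces w'; freeness returns p = w' H3(c
  w'), and uniqueness identifies w' with the fixed point.\<close>

lemma invertible_elemI: "x * y = 1 \<Longrightarrow> y * x = 1 \<Longrightarrow> invertible_elem x"
  unfolding invertible_elem_def by blast

lemma inv_elem_right: "invertible_elem x \<Longrightarrow> x * inv_elem x = 1"
  and inv_elem_left: "invertible_elem x \<Longrightarrow> inv_elem x * x = 1"
  unfolding invertible_elem_def by (metis inv_elem_eqI)+

lemma invertible_inv_elem: "invertible_elem x \<Longrightarrow> invertible_elem (inv_elem x)"
  by (rule invertible_elemI[where y = x]) (simp_all add: inv_elem_right inv_elem_left)

lemma inv_elem_inv_elem: "invertible_elem x \<Longrightarrow> inv_elem (inv_elem x) = x"
  by (rule inv_elem_eqI) (simp_all add: inv_elem_right inv_elem_left)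

lemma invertible_elem_mult:
  assumes "invertible_elem x" "invertible_elem y"
  shows "invertible_elem (x * y)"
proof (rule invertible_elemI[where y = "inv_elem y * inv_elem x"])
  have "x * y * (inv_elem y * inv_elem x) = x * (y * inv_elem y) * inv_elem x"
    by (simp only: mult.assoc)
  then show "x * y * (inv_elem y * inv_elem x) = 1"
    using assms by (simp add: inv_elem_right)
  have "inv_elem y * inv_elem x * (x * y) = inv_elem y * (inv_elem x * x) * y"
    by (simp only: mult.assoc)
  then show "inv_elem y * inv_elem x * (x * y) = 1"
    using assms by (simp add: inv_elem_left)
qed

lemma neumann:
  fixes x :: "'a::{real_normed_algebra_1,banach}"
  assumes "norm x < 1"
  obtains y where "(1 - x) * y = 1" "y * (1 - x) = 1" "norm y \<le> 1 / (1 - norm x)" "(\<lambda>n. x ^ n) sums y"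
proof -
  have sm: "summable (\<lambda>n. x ^ n)" by (rule complete_algebra_summable_geometric[OF assms])
  define y where "y = (\<Sum>n. x ^ n)"
  have shift: "y = 1 + (\<Sum>n. x ^ Suc n)"
    unfolding y_def using suminf_split_head[OF sm] by (simp add: algebra_simps)
  have "x * y = (\<Sum>n. x ^ Suc n)"
    unfolding y_def using suminf_mult[OF sm, of x] by simp
  then have 1: "(1 - x) * y = 1" using shift by (simp add: algebra_simps)
  have "y * x = (\<Sum>n. x ^ Suc n)"
    unfolding y_def using suminf_mult2[OF sm, of x] by (simp only: power_Suc2)
  then have 2: "y * (1 - x) = 1" using shift by (simp add: algebra_simps)
  have "norm y \<le> (\<Sum>n. norm x ^ n)"
    unfolding y_def
    by (rule norm_suminf_le)
      (use assms in \<open>auto intro!: summable_geometric norm_power_ineq\<close>)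
  also have "\<dots> = 1 / (1 - norm x)" by (rule suminf_geometric) (use assms in simp)
  finally show ?thesis using that 1 2 summable_sums[OF sm] y_def by blast
qed

lemma invertible_one_minus:
  fixes x :: "'a::{real_normed_algebra_1,banach}"
  assumes "norm x < 1"
  shows "invertible_elem (1 - x)"
  using neumann[OF assms] invertible_elemI by metis

lemma norm_inv_one_minus:
  fixes x :: "'a::{real_normed_algebra_1,banach}"
  assumes "norm x < 1"
  shows "norm (inv_elem (1 - x)) \<le> 1 / (1 - norm x)"
  using neumann[OF assms] inv_elem_eqI by metis

lemma geometric_sums_inverse:
  fixes x :: "'a::{real_normed_algebra_1,banach}"
  assumes "norm x < 1"
  shows "(\<lambda>n. x ^ n) sums inv_elem (1 - x)"
  using neumann[OF assms] inv_elem_eqI by metis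

text \<open>Factor \<open>x = m * (1 - z)\<close> with \<open>norm z \<le> N * d\<close> and invert
  the second factor by a Neumann series. This is how invertibility passes from the mean to values of
  the transform.\<close>

lemma inv_near:
  fixes m x :: "'a::{real_normed_algebra_1,banach}"
  assumes m: "invertible_elem m" "norm (inv_elem m) \<le> N" and x: "norm (x - m) \<le> d" "N * d < 1"
  shows "invertible_elem x" "norm (inv_elem x) \<le> N / (1 - N * d)"
proof -
  define z where "z = inv_elem m * (m - x)"
  have N0: "0 \<le> N" using m(2) norm_ge_zero order_trans by blast
  have "norm z \<le> norm (inv_elem m) * norm (m - x)" unfolding z_def by (rule norm_mult_ineq)
  also have "\<dots> \<le> N * d" using m(2) x(1) N0 by (intro mult_mono) (auto simp: norm_minus_commute)
  finally have nz: "norm z \<le> N * d" .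
  obtain y where y: "(1 - z) * y = 1" "y * (1 - z) = 1" "norm y \<le> 1 / (1 - norm z)"
    using neumann[of z] nz x(2) by auto
  have mi: "m * inv_elem m = 1" "inv_elem m * m = 1" using m inv_elem_right inv_elem_left by auto
  have "m * (1 - z) = m - m * inv_elem m * (m - x)" by (simp add: z_def algebra_simps)
  then have xe: "x = m * (1 - z)" by (simp add: mi)
  have a: "x * (y * inv_elem m) = 1"
    unfolding xe by (metis mi(1) mult.assoc mult_1_left y(1))
  have b: "(y * inv_elem m) * x = 1"
    unfolding xe by (metis mi(2) mult.assoc mult_1_left y(2))
  show "invertible_elem x" using a b by (rule invertible_elemI)
  have "norm (inv_elem x) = norm (y * inv_elem m)" using inv_elem_eqI[OF a b] by simp
  also have "\<dots> \<le> norm y * norm (inv_elem m)" by (rule norm_mult_ineq)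
  also have "\<dots> \<le> 1 / (1 - N * d) * N"
  proof (intro mult_mono)
    have "1 / (1 - norm z) \<le> 1 / (1 - N * d)" using nz x(2) by (intro frac_le) auto
    then show "norm y \<le> 1 / (1 - N * d)" using y(3) by linarith
  qed (use m N0 x in auto)
  finally show "norm (inv_elem x) \<le> N / (1 - N * d)" by simp
qed

section \<open>Star, complex scalars and the norm\<close>

lemma of_real_commute: "of_real t * (x::'a::real_algebra_1) = x * of_real t"
  by (simp add: of_real_def)

lemma star_diff: "star (x - y) = star x - star (y::'a::cstar_algebra)"
  using star_add[of x "- y"] by (simp add: star_minus)

lemma star_scaleR: "star (r *\<^sub>R x) = r *\<^sub>R star (x::'a::cstar_algebra)"
  using star_scaleC[of "complex_of_real r" x] by (simp add: scaleC_of_real)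

lemma star_of_real: "star (of_real r) = (of_real r :: 'a::cstar_algebra)"
  by (simp add: of_real_def star_scaleR star_one)

lemma norm_star: "norm (star x) = norm (x::'a::cstar_algebra)"
proof -
  have *: "norm y \<le> norm (star y)" for y :: 'a
  proof (cases "norm y = 0")
    case False
    have "norm y * norm y \<le> norm (star y) * norm y"
      using norm_mult_ineq[of "star y" y] cstar_identity[of y] by (simp add: power2_eq_square)
    then show ?thesis using False by (simp add: mult_le_cancel_right)
  qed simp
  from *[of x] *[of "star x"] show ?thesis by (simp add: star_star)
qed

lemma norm_selfadjoint_square: "star x = x \<Longrightarrow> norm (x * x) = (norm (x::'a::cstar_algebra))\<^sup>2"
  using cstar_identity[of x] by simp

lemma scaleC_diff_right: "c *\<^sub>C (x - y) = c *\<^sub>C x - c *\<^sub>C (y::'a::cstar_algebra)"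
  by (metis add_diff_cancel diff_add_cancel scaleC_add_right)

lemma scaleC_one: "1 *\<^sub>C (x::'a::cstar_algebra) = x"
  using scaleC_of_real[of 1 x] by simp

lemma scaleC_minus_left: "(- c) *\<^sub>C (x::'a::cstar_algebra) = - (c *\<^sub>C x)"
  by (metis mult_minus1 scaleC_minus_one scaleC_scaleC)

lemma bounded_linear_star: "bounded_linear (star :: 'a::cstar_algebra \<Rightarrow> 'a)"
  by (rule bounded_linear_intro[where K = 1]) (simp_all add: star_add star_scaleR norm_star)

lemma bounded_linear_scaleC: "bounded_linear (\<lambda>x::'a::cstar_algebra. c *\<^sub>C x)"
  by (rule bounded_linear_intro[where K = "cmod c"])
    (simp_all add: scaleC_add_right norm_scaleC mult.commute scaleC_scaleC flip: scaleC_of_real)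

lemma bounded_linear_scaleC_left: "bounded_linear (\<lambda>c. c *\<^sub>C (x::'a::cstar_algebra))"
  by (rule bounded_linear_intro[where K = "norm x"])
    (simp_all add: scaleC_add_left norm_scaleC scaleC_scaleC scaleR_conv_of_real[where 'a = complex]
      flip: scaleC_of_real)

text \<open>The iteration \<open>y \<mapsto> (x + y\<^sup>2) / 2\<close> converges to \<open>1 - sqrt (1 - x)\<close>; its increments are dominated by
  those of the scalar iteration for \<open>x = 1\<close>.\<close>

primrec sqrt_iter :: "'a::real_normed_algebra_1 \<Rightarrow> nat \<Rightarrow> 'a" where
  "sqrt_iter x 0 = 0"
| "sqrt_iter x (Suc n) = (1/2) *\<^sub>R (x + sqrt_iter x n * sqrt_iter x n)"

lemma sqrt_iter_real_bounds: "0 \<le> sqrt_iter (1::real) n" "sqrt_iter (1::real) n \<le> 1"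
proof -
  have "0 \<le> sqrt_iter (1::real) n \<and> sqrt_iter (1::real) n \<le> 1"
  proof (induction n)
    case (Suc n)
    then have "sqrt_iter (1::real) n * sqrt_iter (1::real) n \<le> 1 * 1" by (intro mult_mono) auto
    then show ?case using Suc by auto
  qed simp
  then show "0 \<le> sqrt_iter (1::real) n" "sqrt_iter (1::real) n \<le> 1" by auto
qed

lemma sqrt_iter_norm:
  assumes "norm x \<le> 1"
  shows "norm (sqrt_iter x n) \<le> sqrt_iter (1::real) n"
proof (induction n)
  case (Suc n)
  have "norm (x + sqrt_iter x n * sqrt_iter x n) \<le> norm x + norm (sqrt_iter x n) * norm (sqrt_iter x n)"
    by (rule order_trans[OF norm_triangle_ineq]) (simp add: norm_mult_ineq)
  also have "\<dots> \<le> 1 + sqrt_iter (1::real) n * sqrt_iter (1::real) n"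
    using Suc assms by (intro add_mono mult_mono) (auto intro: sqrt_iter_real_bounds)
  finally show ?case by simp
qed simp

declare sqrt_iter.simps(2) [simp del]

lemma sqrt_iter_diff:
  assumes "norm x \<le> 1"
  shows "norm (sqrt_iter x (Suc n) - sqrt_iter x n) \<le> sqrt_iter (1::real) (Suc n) - sqrt_iter 1 n"
proof (induction n)
  case 0
  show ?case using assms by (simp add: sqrt_iter.simps(2))
next
  case (Suc n)
  let ?y = "sqrt_iter x" and ?t = "sqrt_iter (1::real)"
  have "?y (Suc (Suc n)) - ?y (Suc n)
      = (1/2) *\<^sub>R ((x + ?y (Suc n) * ?y (Suc n)) - (x + ?y n * ?y n))"
    by (simp only: sqrt_iter.simps(2) scaleR_diff_right)
  \<comment> \<open>This grouping of the difference of two squares keeps the order of factors, so no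
    commutativity is used.\<close>
  also have "\<dots> = (1/2) *\<^sub>R ((?y (Suc n) - ?y n) * ?y (Suc n) + ?y n * (?y (Suc n) - ?y n))"
    by (simp only: algebra_simps)
  finally have e: "norm (?y (Suc (Suc n)) - ?y (Suc n))
      = (1/2) * norm ((?y (Suc n) - ?y n) * ?y (Suc n) + ?y n * (?y (Suc n) - ?y n))"
    by simp
  have "norm ((?y (Suc n) - ?y n) * ?y (Suc n) + ?y n * (?y (Suc n) - ?y n))
      \<le> norm (?y (Suc n) - ?y n) * norm (?y (Suc n)) + norm (?y n) * norm (?y (Suc n) - ?y n)"
    by (rule order_trans[OF norm_triangle_ineq]) (intro add_mono norm_mult_ineq)
  also have "\<dots> \<le> (?t (Suc n) - ?t n) * ?t (Suc n) + ?t n * (?t (Suc n) - ?t n)"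
    by (intro add_mono mult_mono sqrt_iter_norm[OF assms] Suc)
      (use Suc norm_ge_zero order_trans sqrt_iter_real_bounds in blast)+
  also have "\<dots> = 2 * (?t (Suc (Suc n)) - ?t (Suc n))"
    by (simp add: sqrt_iter.simps(2)[of _ "Suc n"] sqrt_iter.simps(2)[of _ n] algebra_simps)
  finally have f: "norm ((?y (Suc n) - ?y n) * ?y (Suc n) + ?y n * (?y (Suc n) - ?y n))
      \<le> 2 * (?t (Suc (Suc n)) - ?t (Suc n))" .
  have "a = (1/2) * b \<Longrightarrow> b \<le> 2 * d \<Longrightarrow> a \<le> d" for a b d :: real by simp
  from this[OF e f] show ?case .
qed

text \<open>Every iterate is a real polynomial in \<open>x\<close>, so self-adjointness and
  commutation pass to the limit. The commutation clause serves as the substitute for functional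
  calculus below.\<close>

lemma sqrt_one_minus:
  fixes x :: "'a::cstar_algebra"
  assumes "norm x \<le> 1"
  obtains y where "norm y \<le> 1" "(1 - y) * (1 - y) = 1 - x" "star x = x \<Longrightarrow> star y = y"
    "\<And>u. u * x = x * u \<Longrightarrow> u * y = y * u"
proof -
  let ?y = "sqrt_iter x" and ?t = "sqrt_iter (1::real)"
  have inc: "?t n \<le> ?t (Suc n)" for n
    using sqrt_iter_diff[of "1::real" n] norm_ge_zero[of "?t (Suc n) - ?t n"] by simp
  have "summable (\<lambda>n. ?t (Suc n) - ?t n)"
  proof (rule summableI_nonneg_bounded[where x = 1])
    show "0 \<le> ?t (Suc n) - ?t n" for n using inc[of n] by simp
    have "(\<Sum>i<n. ?t (Suc i) - ?t i) = ?t n" for n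
      using sum_lessThan_telescope[of ?t n] by simp
    then show "(\<Sum>i<n. ?t (Suc i) - ?t i) \<le> 1" for n using sqrt_iter_real_bounds by simp
  qed
  then have "summable (\<lambda>n. ?y (Suc n) - ?y n)"
    by (rule summable_comparison_test'[where N = 0]) (rule sqrt_iter_diff[OF assms])
  then have "convergent (\<lambda>n. \<Sum>i<n. ?y (Suc i) - ?y i)" by (simp add: summable_iff_convergent)
  then have "convergent ?y" by (simp add: sum_lessThan_telescope)
  then obtain y where y: "?y \<longlonglongrightarrow> y" unfolding convergent_def by blast
  have nb: "norm (?y n) \<le> 1" for n
    using sqrt_iter_norm[OF assms] sqrt_iter_real_bounds order_trans by blast
  have "norm y \<le> 1" by (rule LIMSEQ_le_const2[OF tendsto_norm[OF y]]) (use nb in blast)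
  moreover have "(\<lambda>n. ?y (Suc n)) \<longlonglongrightarrow> (1/2) *\<^sub>R (x + y * y)"
    unfolding sqrt_iter.simps by (intro tendsto_intros y)
  then have "y = (1/2) *\<^sub>R (x + y * y)" using y LIMSEQ_Suc LIMSEQ_unique by blast
  then have "y + y = x + y * y" by (metis scaleR_half_double scaleR_add_right)
  then have "(1 - y) * (1 - y) = 1 - x" by (simp add: algebra_simps)
  moreover have "star y = y" if "star x = x"
  proof -
    have "star (?y n) = ?y n" for n
      by (induction n) (simp_all add: sqrt_iter.simps(2) star_zero star_scaleR star_add star_mult that)
    then show ?thesis
      using bounded_linear.tendsto[OF bounded_linear_star y] y LIMSEQ_unique by simp
  qed
  moreover have "u * y = y * u" if u: "u * x = x * u" for u
  proof -
    have "u * ?y n = ?y n * u" for n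
    proof (induction n)
      case (Suc n)
      have "u * (?y n * ?y n) = (?y n * ?y n) * u" using Suc by (metis mult.assoc)
      then show ?case using u by (simp add: sqrt_iter.simps(2) algebra_simps)
    qed simp
    then have "(\<lambda>n. u * ?y n) \<longlonglongrightarrow> y * u" using tendsto_mult[OF y tendsto_const[of u]] by simp
    then show ?thesis using tendsto_mult[OF tendsto_const[of u] y] LIMSEQ_unique by blast
  qed
  ultimately show ?thesis using that by blast
qed

text \<open>A spectrum-free description of positivity, under which sums of positive elements are visibly
  positive.\<close>

definition norm_positive :: "'a::cstar_algebra \<Rightarrow> bool" where
  "norm_positive x \<longleftrightarrow> star x = x \<and> (\<exists>s\<ge>0. norm (of_real s - x) \<le> s)"

lemma norm_positive_star: "norm_positive x \<Longrightarrow> star x = x"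
  by (simp add: norm_positive_def)

lemma norm_positive_add:
  assumes "norm_positive x" "norm_positive y"
  shows "norm_positive (x + y)"
proof -
  obtain s t where s: "s \<ge> 0" "norm (of_real s - x) \<le> s" and t: "t \<ge> 0" "norm (of_real t - y) \<le> t"
    using assms unfolding norm_positive_def by blast
  have "of_real (s + t) - (x + y) = (of_real s - x) + (of_real t - y)" by simp
  then have "norm (of_real (s + t) - (x + y)) \<le> s + t"
    by (metis add_mono norm_triangle_ineq order_trans s(2) t(2))
  then show ?thesis
    using assms s t unfolding norm_positive_def by (auto simp: star_add intro!: exI[of _ "s + t"])
qed

lemma norm_positive_scaleR:
  assumes "norm_positive x" "0 \<le> r"
  shows "norm_positive (r *\<^sub>R x)"
proof -
  obtain s where s: "s \<ge> 0" "norm (of_real s - x) \<le> s"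
    using assms unfolding norm_positive_def by blast
  have "of_real (r * s) - r *\<^sub>R x = r *\<^sub>R (of_real s - x)"
    by (simp add: of_real_def scaleR_diff_right)
  then have "norm (of_real (r * s) - r *\<^sub>R x) \<le> r * s"
    using s assms by (simp add: mult_left_mono)
  then show ?thesis using assms s unfolding norm_positive_def
    by (auto simp: star_scaleR intro!: exI[of _ "r * s"])
qed

lemma norm_positive_of_real: "0 \<le> r \<Longrightarrow> norm_positive (of_real r)"
  unfolding norm_positive_def by (auto simp: star_of_real intro!: exI[of _ r])

lemma norm_positive_sqrt:
  assumes "norm_positive x"
  obtains z where "star z = z" "z * z = x" "\<And>u. u * x = x * u \<Longrightarrow> u * z = z * u" "norm_positive z"
proof -
  obtain s where s: "s \<ge> 0" "norm (of_real s - x) \<le> s" and st: "star x = x"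
    using assms unfolding norm_positive_def by blast
  show ?thesis
  proof (cases "s = 0")
    case True
    then have "x = 0" using s by simp
    then show ?thesis using that[of 0] by (simp add: star_zero norm_positive_def exI[of _ 0])
  next
    case False
    then have s0: "s > 0" using s by simp
    define v where "v = 1 - (1/s) *\<^sub>R x"
    have "v = (1/s) *\<^sub>R (of_real s - x)"
      using s0 by (simp add: v_def of_real_def scaleR_diff_right)
    then have "norm v \<le> 1" using s s0 by (simp add: divide_simps)
    then obtain y where y: "norm y \<le> 1" "(1 - y) * (1 - y) = 1 - v" "star v = v \<Longrightarrow> star y = y"
      "\<And>u. u * v = v * u \<Longrightarrow> u * y = y * u" using sqrt_one_minus by blast
    have sy: "star y = y" by (rule y(3)) (simp add: v_def star_diff star_one star_scaleR st)
    define z where "z = sqrt s *\<^sub>R (1 - y)"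
    have pz: "norm_positive (1 - y)" unfolding norm_positive_def
      using y(1) sy by (auto simp: star_diff star_one intro!: exI[of _ 1])
    show ?thesis
    proof (rule that)
      show "norm_positive z" unfolding z_def using pz s0 by (intro norm_positive_scaleR) auto
      show "star z = z" by (simp add: z_def star_scaleR star_diff star_one sy)
      have "z * z = s *\<^sub>R ((1 - y) * (1 - y))" using s0 by (simp add: z_def)
      also have "\<dots> = x" using s0 by (simp add: y(2) v_def)
      finally show "z * z = x" .
      fix u assume "u * x = x * u"
      then have "u * y = y * u" by (intro y(4)) (simp add: v_def algebra_simps)
      then show "u * z = z * u" by (simp add: z_def algebra_simps)
    qed
  qed
qed

text \<open>For \<open>u = x + \<i> *\<^sub>C y\<close> commutativity gives
  \<open>star u * u = x * x + y * y\<close>, so the C*-identity computes \<open>norm u\<close>, and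
  \<open>x\<close> is the real part of \<open>u\<close>.\<close>

lemma commuting_squares_norm:
  fixes x y :: "'a::cstar_algebra"
  assumes "star x = x" "star y = y" "x * y = y * x" "x * x + y * y = of_real t" "0 \<le> t"
  shows "(norm x)\<^sup>2 \<le> t"
proof -
  define u where "u = x + \<i> *\<^sub>C y"
  have su: "star u = x - \<i> *\<^sub>C y" by (simp add: u_def star_add star_scaleC assms scaleC_minus_left)
  have "star u * u = x * x + y * y"
    unfolding su by (simp add: u_def algebra_simps scaleC_add_right scaleC_diff_right scaleC_mult_left
        scaleC_mult_right scaleC_scaleC assms(3) scaleC_minus_one)
  then have "(norm u)\<^sup>2 = norm (of_real t :: 'a)" using assms(4) cstar_identity[of u] by simp
  then have nu: "(norm u)\<^sup>2 = \<bar>t\<bar>" by simp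
  have "2 *\<^sub>R x = u + star u" unfolding su by (simp add: u_def scaleR_2)
  then have "2 * norm x \<le> norm u + norm (star u)" by (metis norm_scaleR abs_numeral norm_triangle_ineq)
  then have nx: "norm x \<le> norm u" by (simp add: norm_star)
  have "(norm x)\<^sup>2 \<le> (norm u)\<^sup>2" using nx by (intro power_mono) auto
  then show ?thesis using nu assms(5) by simp
qed


lemma square_complement:
  fixes x :: "'a::cstar_algebra"
  assumes "star x = x" "norm x \<le> t"
  obtains y where "star y = y" "y * y = of_real (t\<^sup>2) - x * x" "\<And>u. u * (x * x) = (x * x) * u \<Longrightarrow> u * y = y * u"
proof (cases "t = 0")
  case True
  then have "x = 0" using assms by simp
  then show ?thesis using that[of 0] True by (simp add: star_zero)
next
  case False
  then have t: "t > 0" using assms(2) norm_ge_zero[of x] by linarith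
  define v where "v = (1 / t\<^sup>2) *\<^sub>R (x * x)"
  have "norm v = (norm x)\<^sup>2 / t\<^sup>2" by (simp add: v_def norm_selfadjoint_square assms)
  also have "\<dots> \<le> 1" using assms t by (simp add: divide_simps power_mono)
  finally obtain y where y: "(1 - y) * (1 - y) = 1 - v" "star v = v \<Longrightarrow> star y = y"
      "\<And>u. u * v = v * u \<Longrightarrow> u * y = y * u" using sqrt_one_minus by blast
  have sy: "star y = y" by (rule y(2)) (simp add: v_def star_scaleR star_mult assms)
  show ?thesis
  proof (rule that)
    show "star (t *\<^sub>R (1 - y)) = t *\<^sub>R (1 - y)" by (simp add: star_scaleR star_diff star_one sy)
    have "(t *\<^sub>R (1 - y)) * (t *\<^sub>R (1 - y)) = (t\<^sup>2) *\<^sub>R (1 - v)"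
      by (simp add: y(1) power2_eq_square)
    also have "\<dots> = of_real (t\<^sup>2) - x * x"
      using t by (simp add: v_def scaleR_diff_right of_real_def)
    finally show "(t *\<^sub>R (1 - y)) * (t *\<^sub>R (1 - y)) = of_real (t\<^sup>2) - x * x" .
    fix u assume "u * (x * x) = (x * x) * u"
    then have "u * y = y * u" by (intro y(3)) (simp add: v_def algebra_simps)
    then show "u * (t *\<^sub>R (1 - y)) = (t *\<^sub>R (1 - y)) * u" by (simp add: algebra_simps)
  qed
qed

text \<open>The witness is s = \<open>(norm x)\<^sup>2\<close>: the difference s - x x is the square
  of some y commuting with x, and x x + y y = s bounds the norm of y y by s.\<close>

lemma norm_positive_square:
  assumes "star x = x"
  shows "norm_positive (x * x)"
proof -
  obtain y where y: "star y = y" "y * y = of_real ((norm x)\<^sup>2) - x * x"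
    "\<And>u. u * (x * x) = (x * x) * u \<Longrightarrow> u * y = y * u" using square_complement[OF assms order_refl] by blast
  have "x * y = y * x" by (rule y(3)) (simp only: mult.assoc)
  then have "(norm y)\<^sup>2 \<le> (norm x)\<^sup>2"
    using y(1,2) assms by (intro commuting_squares_norm[of y x]) (simp_all del: of_real_power)
  then have "norm (of_real ((norm x)\<^sup>2) - x * x) \<le> (norm x)\<^sup>2"
    by (simp add: norm_selfadjoint_square[OF y(1)] flip: y(2) del: of_real_power)
  then show ?thesis unfolding norm_positive_def
    by (intro conjI exI[of _ "(norm x)\<^sup>2"]) (auto simp: star_mult assms)
qed

lemma norm_positive_norm_minus:
  assumes "norm_positive x"
  shows "norm_positive (of_real (norm x) - x)"
proof -
  obtain z where z: "star z = z" "z * z = x" using norm_positive_sqrt[OF assms] by blast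
  then have n: "norm x = (norm z)\<^sup>2" using norm_selfadjoint_square by metis
  obtain y where "star y = y" "y * y = of_real ((norm z)\<^sup>2) - z * z"
    using square_complement[OF z(1) order_refl] by blast
  then show ?thesis using norm_positive_square[of y] n z by simp
qed

text \<open>The square roots of \<open>x\<close> and of \<open>of_real t - x\<close> commute, and
  their squares add up to t.\<close>

lemma norm_positive_norm_le:
  assumes "norm_positive x" "norm_positive (of_real t - x)" "0 \<le> t"
  shows "norm x \<le> t"
proof -
  obtain z where z: "star z = z" "z * z = x" "\<And>u. u * x = x * u \<Longrightarrow> u * z = z * u"
    using norm_positive_sqrt[OF assms(1)] by blast
  obtain g where g: "star g = g" "g * g = of_real t - x"
    "\<And>u. u * (of_real t - x) = (of_real t - x) * u \<Longrightarrow> u * g = g * u"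
    using norm_positive_sqrt[OF assms(2)] by blast
  have "z * x = x * z" using z(2) by (metis mult.assoc)
  then have "z * (of_real t - x) = (of_real t - x) * z" by (simp add: algebra_simps of_real_commute)
  then have "(norm z)\<^sup>2 \<le> t"
    using z(1,2) g(1,2) assms(3)
    by (intro commuting_squares_norm[of z g] g(3)) simp_all
  then show ?thesis using norm_selfadjoint_square[OF z(1)] z(2) by simp
qed

lemma norm_positive_mono:
  assumes "norm_positive x" "norm_positive (y - x)"
  shows "norm x \<le> norm y"
proof (rule norm_positive_norm_le[OF assms(1)])
  have "norm_positive y" using norm_positive_add[OF assms] by simp
  from norm_positive_add[OF norm_positive_norm_minus[OF this] assms(2)]
  show "norm_positive (of_real (norm y) - x)" by simp
qed simp

text \<open>The sum is s + e times 1 - v, where v has norm at most s / (s + e) < 1.\<close>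

lemma invertible_norm_positive_add:
  assumes "norm_positive x" "0 < e"
  shows "invertible_elem (of_real e + x)"
proof -
  obtain s where s: "s \<ge> 0" "norm (of_real s - x) \<le> s" using assms unfolding norm_positive_def by blast
  let ?v = "(1 / (s + e)) *\<^sub>R (of_real s - x)"
  have "norm ?v < 1" using s assms by (simp add: divide_simps)
  then obtain y where y: "(1 - ?v) * y = 1" "y * (1 - ?v) = 1" using neumann by blast
  have eq: "of_real e + x = (s + e) *\<^sub>R (1 - ?v)"
    using s assms by (simp add: scaleR_diff_right of_real_def scaleR_add_left)
  show ?thesis
    by (rule invertible_elemI[where y = "(1 / (s + e)) *\<^sub>R y"]) (use y s assms in \<open>simp_all add: eq\<close>)
qed

text \<open>With y a root of x, the element k = y xi is a root of xi. If g is a root of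
  \<open>norm xi\<close> - xi, then (y g)(y g) = \<open>norm xi\<close> x - 1, which is the lower
  bound for x after rescaling.\<close>

lemma norm_positive_inverse:
  assumes x: "norm_positive x" "x * xi = 1" "xi * x = 1"
  shows "norm_positive xi" "norm_positive (x - of_real (1 / norm xi))" "0 < norm xi"
proof -
  obtain y where y: "star y = y" "y * y = x" "\<And>u. u * x = x * u \<Longrightarrow> u * y = y * u"
    using norm_positive_sqrt[OF x(1)] by blast
  have ixi: "u * xi = xi * u" if "u * x = x * u" for u
    by (metis that x(2,3) mult.assoc mult_1_left mult_1_right)
  have yx: "y * x = x * y" using y(2) by (metis mult.assoc)
  have sxi: "star xi = xi"
    by (metis x norm_positive_star star_mult star_one mult.assoc mult_1_left mult_1_right)
  define k where "k = y * xi"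
  have sk: "star k = k" using ixi[OF yx] by (simp add: k_def star_mult sxi y(1))
  have kk: "k * k = xi"
  proof -
    have "k * k = (xi * (y * y)) * xi" using ixi[OF yx] unfolding k_def by (simp only: mult.assoc)
    then show ?thesis by (simp add: x(3) y(2))
  qed
  show "norm_positive xi" using norm_positive_square[OF sk] kk by simp
  have "xi \<noteq> 0" using x(2) by auto
  then show n0: "0 < norm xi" by simp
  obtain g where g: "star g = g" "g * g = of_real ((norm k)\<^sup>2) - k * k"
    "\<And>u. u * (k * k) = (k * k) * u \<Longrightarrow> u * g = g * u" using square_complement[OF sk order_refl] by blast
  have nk: "(norm k)\<^sup>2 = norm xi" using norm_selfadjoint_square[OF sk] kk by simp
  have yg: "y * g = g * y" by (rule g(3)) (simp add: kk ixi[OF yx])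
  have "norm_positive ((y * g) * (y * g))"
    by (rule norm_positive_square) (simp add: star_mult y g(1) yg)
  also have "(y * g) * (y * g) = (y * y) * (g * g)" using yg by (metis mult.assoc)
  also have "\<dots> = norm xi *\<^sub>R x - 1"
    using x(2) by (simp add: y g nk kk right_diff_distrib of_real_def)
  finally have "norm_positive ((1 / norm xi) *\<^sub>R (norm xi *\<^sub>R x - 1))"
    by (rule norm_positive_scaleR) simp
  also have "(1 / norm xi) *\<^sub>R (norm xi *\<^sub>R x - 1) = x - of_real (1 / norm xi)"
    using n0 by (simp add: scaleR_diff_right of_real_def)
  finally show "norm_positive (x - of_real (1 / norm xi))" .
qed

text \<open>The norm of a positive element lies in its spectrum: an inverse v of 1 - q would give 1
  - q >= 1 / \<open>norm v\<close>, hence \<open>norm q\<close> < 1.\<close>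

lemma not_invertible_one_minus:
  assumes "norm_positive q" "norm q = 1"
  shows "\<not> invertible_elem (1 - q)"
proof
  assume "invertible_elem (1 - q)"
  then obtain v where v: "(1 - q) * v = 1" "v * (1 - q) = 1" unfolding invertible_elem_def by blast
  have p: "norm_positive (1 - q)" using norm_positive_norm_minus[OF assms(1)] assms(2) by simp
  have n0: "0 < norm v" and p2: "norm_positive (1 - q - of_real (1 / norm v))"
    using norm_positive_inverse[OF p v] by auto
  have "norm (1 - q) \<le> 1"
    by (rule norm_positive_norm_le[OF p]) (use assms in auto)
  then have "1 \<le> norm v"
    using norm_mult_ineq[of "1 - q" v] v(1) mult_right_mono[of "norm (1 - q)" 1 "norm v"] by simp
  then have "0 \<le> 1 - 1 / norm v" by (simp add: divide_simps)
  moreover have "of_real (1 - 1 / norm v) - q = 1 - q - of_real (1 / norm v)" by simp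
  ultimately have "norm q \<le> 1 - 1 / norm v"
    using norm_positive_norm_le[OF assms(1), of "1 - 1 / norm v"] p2 by metis
  then show False using n0 assms(2) by simp
qed

text \<open>The inverse 1 - b v a is suggested by the formal geometric series. Consequently a b and
  b a have the same nonzero spectrum.\<close>

lemma invertible_one_plus_swap:
  fixes a b :: "'a::ring_1"
  assumes "invertible_elem (1 + a * b)"
  shows "invertible_elem (1 + b * a)"
proof -
  obtain v where v: "(1 + a * b) * v = 1" "v * (1 + a * b) = 1"
    using assms unfolding invertible_elem_def by blast
  show ?thesis
  proof (rule invertible_elemI[where y = "1 - b * v * a"])
    have "(1 + b * a) * (1 - b * v * a) = 1 + b * a - b * ((1 + a * b) * v) * a"
      by (simp add: algebra_simps)
    then show "(1 + b * a) * (1 - b * v * a) = 1" by (simp add: v)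
    have "(1 - b * v * a) * (1 + b * a) = 1 + b * a - b * (v * (1 + a * b)) * a"
      by (simp add: algebra_simps)
    then show "(1 - b * v * a) * (1 + b * a) = 1" by (simp add: v)
  qed
qed

text \<open>Kaplansky's argument. With \<open>h = y\<^sup>* y\<close>, \<open>m = sqrt (h\<^sup>2)\<close> and \<open>z = y (m - h)\<close>, the element \<open>z\<^sup>* z\<close> is
  negative, hence \<open>z z\<^sup>*\<close> is positive; these two have the same nonzero spectrum, so \<open>z = 0\<close>.\<close>

lemma norm_positive_star_mult: "norm_positive (star y * y)"
proof -
  define h where "h = star y * y"
  have sh: "star h = h" by (simp add: h_def star_mult star_star)
  obtain m where m: "star m = m" "m * m = h * h" "\<And>u. u * (h * h) = (h * h) * u \<Longrightarrow> u * m = m * u"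
    "norm_positive m" using norm_positive_sqrt[OF norm_positive_square[OF sh]] by blast
  obtain k where k: "star k = k" "k * k = m" "\<And>u. u * m = m * u \<Longrightarrow> u * k = k * u"
    using norm_positive_sqrt[OF m(4)] by blast
  define g where "g = m - h"
  have hm: "h * m = m * h" by (rule m(3)) (simp only: mult.assoc)
  have sg: "star g = g" by (simp add: g_def star_diff sh m)
  have gm: "g * m = m * g" by (simp add: g_def algebra_simps hm)
  have gk: "g * k = k * g" by (rule k(3)) (rule gm)
  have gh: "g * h = - (m * g)" by (simp add: g_def algebra_simps m(2))
  define z where "z = y * g"
  define q where "q = (k * g) * (k * g)"
  have q: "norm_positive q" unfolding q_def
    by (rule norm_positive_square) (simp add: star_mult sg k gk)
  have "star z * z = g * h * g" by (simp add: z_def h_def star_mult sg mult.assoc)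
  also have "\<dots> = - (k * (k * g) * g)" by (simp add: gh flip: k(2) mult.assoc)
  also have "k * (k * g) * g = q" using gk unfolding q_def by (metis mult.assoc)
  finally have zz: "star z * z = - q" .
  \<comment> \<open>In terms of real and imaginary parts, \<open>star z * z + z * star z\<close> is
    2 (u u + v v). Since \<open>star z * z = - q\<close>, the other product is a sum of positive
    elements.\<close>
  define u where "u = (1/2) *\<^sub>R (z + star z)"
  define v where "v = (1 / (2 * \<i>)) *\<^sub>C (z - star z)"
  have su: "star u = u" by (simp add: u_def star_scaleR star_add star_star add.commute)
  have sv: "star v = v"
    by (simp add: v_def star_scaleC star_diff star_star scaleC_diff_right scaleC_minus_left)
  have "u * u = (1/4) *\<^sub>R ((z + star z) * (z + star z))" by (simp add: u_def)
  moreover have "v * v = (- 1/4) *\<^sub>R ((z - star z) * (z - star z))"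
    by (simp add: v_def scaleC_mult_left scaleC_mult_right scaleC_scaleC flip: scaleC_of_real)
  ultimately have "2 *\<^sub>R (u * u + v * v) = (1/2) *\<^sub>R ((z + star z) * (z + star z) - (z - star z) * (z - star z))"
    by (simp add: scaleR_diff_right scaleR_add_right)
  also have "(z + star z) * (z + star z) - (z - star z) * (z - star z) = 2 *\<^sub>R (star z * z + z * star z)"
    by (simp add: algebra_simps scaleR_2)
  finally have uv: "z * star z = 2 *\<^sub>R (u * u + v * v) + q" using zz by simp
  have p: "norm_positive (z * star z)" unfolding uv
    by (intro norm_positive_add norm_positive_scaleR norm_positive_square su sv q) simp
  \<comment> \<open>If q were nonzero, 1 - q / \<open>norm q\<close> would be singular, but after
    swapping the factors it becomes 1 plus a positive element.\<close>
  have "q = 0"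
  proof (rule ccontr)
    assume "q \<noteq> 0"
    then have n0: "norm q > 0" by simp
    have "norm_positive ((1 / norm q) *\<^sub>R q)" by (rule norm_positive_scaleR[OF q]) simp
    then have "\<not> invertible_elem (1 - (1 / norm q) *\<^sub>R q)"
      using n0 by (intro not_invertible_one_minus) auto
    then have "\<not> invertible_elem (1 + ((1 / norm q) *\<^sub>R star z) * z)" by (simp add: zz)
    then have "\<not> invertible_elem (1 + z * ((1 / norm q) *\<^sub>R star z))"
      using invertible_one_plus_swap by blast
    moreover have "invertible_elem (of_real 1 + (1 / norm q) *\<^sub>R (z * star z))"
      by (rule invertible_norm_positive_add[OF norm_positive_scaleR[OF p]]) auto
    ultimately show False by simp
  qed
  then have "z = 0" using zz cstar_identity[of z] by simp
  \<comment> \<open>From g h = 0 and g h = - m g also g m = m g = 0, so g g = 0 and h coincides with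
    its absolute value m.\<close>
  then have "h * g = 0" by (simp add: h_def z_def mult.assoc)
  then have "g * h = 0" using hm by (simp add: g_def algebra_simps)
  then have "g * g = 0" using gh gm by (simp add: g_def right_diff_distrib)
  then have "g = 0" using cstar_identity[of g] sg by simp
  then show ?thesis using m(4) by (simp add: g_def h_def)
qed

lemma cstar_positive_iff: "cstar_positive x \<longleftrightarrow> norm_positive x"
proof
  assume "norm_positive x"
  then obtain z where "star z = z" "z * z = x" using norm_positive_sqrt by blast
  then show "cstar_positive x" unfolding cstar_positive_def by metis
qed (auto simp: cstar_positive_def norm_positive_star_mult)

lemma norm_positive_conj:
  assumes "norm_positive x"
  shows "norm_positive (star t * x * t)"
proof -
  obtain z where "star z = z" "z * z = x" using norm_positive_sqrt[OF assms] by blast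
  then have "star t * x * t = star (z * t) * (z * t)" by (metis star_mult mult.assoc)
  then show ?thesis by (simp add: norm_positive_star_mult)
qed

text \<open>The infimum of the spectrum is e = 1 / \<open>norm (inv_elem x)\<close>. Below e the
  difference x - t is a positive element plus a positive scalar; at e, the element e
  \<open>inv_elem x\<close> is positive of norm 1, so 1 minus it is singular.\<close>

lemma strictly_positive_bound:
  assumes "strictly_positive x"
  shows "0 < inf_spec x" "norm (inv_elem x) \<le> 1 / inf_spec x"
proof -
  have px: "norm_positive x" and ix: "invertible_elem x"
    using assms by (auto simp: strictly_positive_def cstar_positive_iff)
  let ?xi = "inv_elem x"
  note xi = norm_positive_inverse[OF px inv_elem_right[OF ix] inv_elem_left[OF ix]]
  define e where "e = 1 / norm ?xi"
  have e0: "e > 0" using xi(3) by (simp add: e_def)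
  have low: "e \<le> t" if "complex_of_real t \<in> spectrum x" for t
  proof (rule ccontr)
    assume "\<not> e \<le> t"
    then have "invertible_elem (of_real (e - t) + (x - of_real e))"
      by (intro invertible_norm_positive_add) (use xi(2) in \<open>auto simp: e_def\<close>)
    moreover have "of_real (e - t) + (x - of_real e) = - (complex_of_real t *\<^sub>C 1 - x)"
      by (subst scaleC_of_real) (simp add: of_real_def scaleR_diff_left)
    ultimately obtain v where "- (complex_of_real t *\<^sub>C 1 - x) * v = 1" "v * - (complex_of_real t *\<^sub>C 1 - x) = 1"
      unfolding invertible_elem_def by metis
    then have "invertible_elem (complex_of_real t *\<^sub>C 1 - x)"
      by (intro invertible_elemI[where y = "- v"]) (simp_all add: algebra_simps)
    then show False using that by (simp add: spectrum_def)
  qed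
  have mem: "complex_of_real e \<in> spectrum x"
  proof -
    have "\<not> invertible_elem (1 - e *\<^sub>R ?xi)"
      by (rule not_invertible_one_minus)
        (use xi e0 in \<open>auto simp: norm_positive_scaleR e_def\<close>)
    moreover have "1 - e *\<^sub>R ?xi = ?xi * (- 1) * (complex_of_real e *\<^sub>C 1 - x)"
      by (simp add: scaleC_of_real algebra_simps inv_elem_left[OF ix])
    moreover have "invertible_elem (?xi * (- 1))"
      by (intro invertible_elem_mult invertible_inv_elem[OF ix] invertible_elemI[where y = "- 1"]) auto
    ultimately show ?thesis unfolding spectrum_def using invertible_elem_mult by fastforce
  qed
  have "inf_spec x = e" unfolding inf_spec_def
    by (rule cInf_eq_minimum) (use mem low in auto)
  then show "0 < inf_spec x" "norm (inv_elem x) \<le> 1 / inf_spec x"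
    using e0 by (simp_all add: e_def)
qed

text \<open>This form makes stability under sums and under small self-adjoint perturbations
  visible.\<close>

lemma strictly_positive_iff: "strictly_positive x \<longleftrightarrow> (\<exists>e>0. norm_positive (x - of_real e))"
proof
  assume "strictly_positive x"
  then have px: "norm_positive x" and ix: "invertible_elem x"
    by (auto simp: strictly_positive_def cstar_positive_iff)
  show "\<exists>e>0. norm_positive (x - of_real e)"
    using norm_positive_inverse[OF px inv_elem_right[OF ix] inv_elem_left[OF ix]]
    by (intro exI[of _ "1 / norm (inv_elem x)"]) auto
next
  assume "\<exists>e>0. norm_positive (x - of_real e)"
  then obtain e where e: "e > 0" "norm_positive (x - of_real e)" by blast
  then show "strictly_positive x"
    using invertible_norm_positive_add[OF e(2,1)] norm_positive_add[OF e(2) norm_positive_of_real[of e]]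
    by (simp add: strictly_positive_def cstar_positive_iff)
qed


section \<open>Hahn--Banach and the identity theorem\<close>

definition sublinear :: "('a::real_vector \<Rightarrow> real) \<Rightarrow> bool" where
  "sublinear q \<longleftrightarrow> (\<forall>x y. q (x + y) \<le> q x + q y) \<and> (\<forall>t\<ge>0. \<forall>x. q (t *\<^sub>R x) = t * q x)"

lemma sublinearI:
  fixes q :: "'a::real_vector \<Rightarrow> real"
  assumes "\<And>x y. q (x + y) \<le> q x + q y" "q 0 = 0" and h: "\<And>t x. t > 0 \<Longrightarrow> t * q x \<le> q (t *\<^sub>R x)"
  shows "sublinear q"
proof -
  have "q (t *\<^sub>R x) = t * q x" if "t \<ge> 0" for t x
  proof (cases "t = 0")
    case False
    then have t: "t > 0" using that by simp
    have "(1 / t) * q (t *\<^sub>R x) \<le> q x" using h[of "1 / t" "t *\<^sub>R x"] t by simp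
    then show ?thesis using h[OF t, of x] t by (simp add: divide_simps mult.commute)
  qed (simp add: assms)
  then show ?thesis using assms(1) by (simp add: sublinear_def)
qed

lemma sublinear_zero: "sublinear q \<Longrightarrow> q 0 = 0"
  unfolding sublinear_def by (metis mult_zero_left order_refl scaleR_zero_left)

lemma sublinear_lower:
  assumes "sublinear q"
  shows "- q (- x) \<le> q x"
proof -
  have "q (x + - x) \<le> q x + q (- x)" using assms unfolding sublinear_def by blast
  then show ?thesis using sublinear_zero[OF assms] by simp
qed

text \<open>Lowers q along the direction y: t = 1 at x = - y gives u(- y) <= - q(y). It is used
  twice, on the norm to force the value at \<open>x0\<close>, and on a minimal functional to prove
  additivity.\<close>

lemma sublinear_shift:
  fixes q :: "'a::real_vector \<Rightarrow> real" and y :: 'a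
  assumes q: "sublinear q"
  defines "u \<equiv> \<lambda>x. INF t\<in>{0..}. q (x + t *\<^sub>R y) - t * q y"
  shows "sublinear u" "\<And>x t. 0 \<le> t \<Longrightarrow> u x \<le> q (x + t *\<^sub>R y) - t * q y"
proof -
  have qa: "q (a + b) \<le> q a + q b" for a b using q unfolding sublinear_def by blast
  have qh: "t \<ge> 0 \<Longrightarrow> q (t *\<^sub>R a) = t * q a" for a t using q unfolding sublinear_def by blast
  have bd: "bdd_below ((\<lambda>t. q (x + t *\<^sub>R y) - t * q y) ` {0..})" for x
  proof (rule bdd_belowI2[where m = "- q (- x)"])
    fix t :: real assume "t \<in> {0..}"
    then have "t * q y = q ((x + t *\<^sub>R y) + - x)" using qh by simp
    also have "\<dots> \<le> q (x + t *\<^sub>R y) + q (- x)" by (rule qa)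
    finally show "- q (- x) \<le> q (x + t *\<^sub>R y) - t * q y" by simp
  qed
  show low: "u x \<le> q (x + t *\<^sub>R y) - t * q y" if "0 \<le> t" for x t
    unfolding u_def by (rule cINF_lower[OF bd]) (use that in simp)
  have great: "c \<le> u x" if "\<And>t. t \<ge> 0 \<Longrightarrow> c \<le> q (x + t *\<^sub>R y) - t * q y" for c x
    unfolding u_def by (rule cINF_greatest) (use that in auto)
  show "sublinear u"
  proof (rule sublinearI)
    fix x z
    have "u (x + z) - (q (z + t *\<^sub>R y) - t * q y) \<le> q (x + s *\<^sub>R y) - s * q y"
      if st: "s \<ge> 0" "t \<ge> 0" for s t
    proof -
      have "u (x + z) \<le> q (x + z + (s + t) *\<^sub>R y) - (s + t) * q y" using low[of "s + t" "x + z"] st by simp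
      also have "x + z + (s + t) *\<^sub>R y = (x + s *\<^sub>R y) + (z + t *\<^sub>R y)" by (simp add: algebra_simps)
      finally show ?thesis using qa[of "x + s *\<^sub>R y" "z + t *\<^sub>R y"] by (simp add: algebra_simps)
    qed
    then have "u (x + z) - (q (z + t *\<^sub>R y) - t * q y) \<le> u x" if "t \<ge> 0" for t
      using that by (intro great) auto
    then have "u (x + z) - u x \<le> q (z + t *\<^sub>R y) - t * q y" if "t \<ge> 0" for t
      using that by fastforce
    then have "u (x + z) - u x \<le> u z" by (intro great) auto
    then show "u (x + z) \<le> u x + u z" by simp
  next
    have "(\<lambda>t. q (0 + t *\<^sub>R y) - t * q y) ` {0..} = {0}"
      using qh by (auto simp: image_iff intro!: exI[of _ 0])
    then show "u 0 = 0" unfolding u_def by (metis cInf_singleton)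
  next
    fix t :: real and x assume t: "t > 0"
    show "t * u x \<le> u (t *\<^sub>R x)"
    proof (rule great)
      fix s :: real assume s: "s \<ge> 0"
      have "q (t *\<^sub>R x + s *\<^sub>R y) = t * q (x + (s / t) *\<^sub>R y)"
        using qh[of t "x + (s / t) *\<^sub>R y"] t by (simp add: scaleR_add_right)
      moreover have "t * u x \<le> t * (q (x + (s / t) *\<^sub>R y) - (s / t) * q y)"
        using low[of "s / t" x] s t by (intro mult_left_mono) auto
      ultimately show "t * u x \<le> q (t *\<^sub>R x + s *\<^sub>R y) - s * q y"
        using t by (simp add: right_diff_distrib)
    qed
  qed
qed

text \<open>Zorn's lemma for the reversed pointwise order, a lower bound of a chain being its
  pointwise infimum.\<close>

lemma minimal_sublinear:
  fixes p :: "'a::real_vector \<Rightarrow> real"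
  assumes p: "sublinear p"
  obtains m where "sublinear m" "m \<le> p" "\<And>q. sublinear q \<Longrightarrow> q \<le> m \<Longrightarrow> q = m"
proof -
  define A where "A = {q. sublinear q \<and> q \<le> p}"
  have "\<exists>m\<in>A. \<forall>a\<in>A. m \<ge> a \<longrightarrow> a = m"
  proof (rule predicate_Zorn)
    show "partial_order_on A (relation_of (\<ge>) A)"
      by (rule partial_order_on_relation_ofI) auto
    fix C assume C: "C \<in> Chains (relation_of (\<ge>) A)"
    then have CA: "C \<subseteq> A" using Chains_relation_of by blast
    have tot: "a \<ge> b \<or> b \<ge> a" if "a \<in> C" "b \<in> C" for a b
      using C that unfolding Chains_def relation_of_def by blast
    show "\<exists>u\<in>A. \<forall>a\<in>C. a \<ge> u"
    proof (cases "C = {}")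
      case True
      then show ?thesis using p by (auto simp: A_def)
    next
      case False
      define u where "u x = (INF q\<in>C. q x)" for x
      have sub: "sublinear q" "q x \<le> p x" if "q \<in> C" for q x
        using that CA by (auto simp: A_def le_fun_def)
      have bd: "bdd_below ((\<lambda>q. q x) ` C)" for x
        by (rule bdd_belowI2[where m = "- p (- x)"])
          (use sub sublinear_lower in \<open>meson neg_le_iff_le order_trans\<close>)
      have low: "u x \<le> q x" if "q \<in> C" for q x
        unfolding u_def by (rule cINF_lower[OF bd that])
      have great: "c \<le> u x" if "\<And>q. q \<in> C \<Longrightarrow> c \<le> q x" for c x
        unfolding u_def by (rule cINF_greatest[OF False]) (use that in auto)
      have "sublinear u"
      proof (rule sublinearI)
        fix x y
        \<comment> \<open>Two members of a chain are comparable, so a single q lies below both, and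
          its subadditivity suffices.\<close>
        have "u (x + y) - q2 y \<le> q1 x" if q12: "q1 \<in> C" "q2 \<in> C" for q1 q2
        proof -
          obtain q where q: "q \<in> C" "q \<le> q1" "q \<le> q2" using tot[OF q12] q12 by blast
          have "u (x + y) \<le> q (x + y)" by (rule low[OF q(1)])
          also have "\<dots> \<le> q x + q y" using sub[OF q(1)] unfolding sublinear_def by blast
          also have "\<dots> \<le> q1 x + q2 y" using q by (auto simp: le_fun_def intro: add_mono)
          finally show ?thesis by simp
        qed
        then have "u (x + y) - q2 y \<le> u x" if "q2 \<in> C" for q2 using that by (intro great) auto
        then have "u (x + y) - u x \<le> q2 y" if "q2 \<in> C" for q2 using that by fastforce
        then have "u (x + y) - u x \<le> u y" by (intro great) auto
        then show "u (x + y) \<le> u x + u y" by simp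
      next
        have "(\<lambda>q. q 0) ` C = {0}" using False sub sublinear_zero by force
        then show "u 0 = 0" unfolding u_def by (metis cInf_singleton)
      next
        fix t :: real and x assume t: "t > 0"
        show "t * u x \<le> u (t *\<^sub>R x)"
        proof (rule great)
          fix q assume q: "q \<in> C"
          then have "q (t *\<^sub>R x) = t * q x" using sub t unfolding sublinear_def by simp
          then show "t * u x \<le> q (t *\<^sub>R x)" using low[OF q] t by simp
        qed
      qed
      moreover obtain q0 where "q0 \<in> C" using False by blast
      then have "u \<le> p" using low sub order_trans by (metis le_funI)
      ultimately show ?thesis using low by (auto simp: A_def le_fun_def)
    qed
  qed
  then obtain m where m: "m \<in> A" "\<And>a. a \<in> A \<Longrightarrow> a \<le> m \<Longrightarrow> a = m" by blast
  show ?thesis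
    by (rule that[of m]) (use m in \<open>auto simp: A_def\<close>)
qed

text \<open>Hahn--Banach: a minimal sublinear functional is linear.\<close>

lemma hahn_banach_real:
  fixes x0 :: "'a::real_normed_vector"
  obtains f :: "'a \<Rightarrow> real" where "bounded_linear f" "norm x0 \<le> f x0"
proof -
  have sn: "sublinear (norm :: 'a \<Rightarrow> real)" by (simp add: sublinear_def norm_triangle_ineq)
  define p where "p = (\<lambda>x. INF t\<in>{0..}. norm (x + t *\<^sub>R x0) - t * norm x0)"
  have sp: "sublinear p" and pl: "\<And>x t. 0 \<le> t \<Longrightarrow> p x \<le> norm (x + t *\<^sub>R x0) - t * norm x0"
    unfolding p_def using sublinear_shift[OF sn] by blast+
  obtain m where m: "sublinear m" "m \<le> p" "\<And>q. sublinear q \<Longrightarrow> q \<le> m \<Longrightarrow> q = m"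
    using minimal_sublinear[OF sp] by blast
  have add: "m (x + y) = m x + m y" for x y
  proof -
    define u where "u = (\<lambda>x. INF t\<in>{0..}. m (x + t *\<^sub>R y) - t * m y)"
    have su: "sublinear u" and ul: "\<And>x t. 0 \<le> t \<Longrightarrow> u x \<le> m (x + t *\<^sub>R y) - t * m y"
      unfolding u_def using sublinear_shift[OF m(1)] by blast+
    \<comment> \<open>Minimality turns this into u = m, and the defining bound of u at t = 1 becomes
      superadditivity of m.\<close>
    have "u \<le> m" using ul[of 0] by (simp add: le_fun_def)
    then have "m x \<le> m (x + y) - m y" using m(3)[OF su] ul[of 1 x] by simp
    moreover have "m (x + y) \<le> m x + m y" using m(1) unfolding sublinear_def by blast
    ultimately show ?thesis by simp
  qed
  have neg: "m (- x) = - m x" for x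
    using add[of x "- x"] sublinear_zero[OF m(1)] by simp
  have scale: "m (t *\<^sub>R x) = t * m x" for t x
  proof (cases "t \<ge> 0")
    case False
    have "s \<ge> 0 \<Longrightarrow> m (s *\<^sub>R y) = s * m y" for s y using m(1) unfolding sublinear_def by blast
    from this[of "- t" x] show ?thesis using False neg[of "t *\<^sub>R x"] by simp
  qed (use m(1) in \<open>simp add: sublinear_def\<close>)
  have le: "m x \<le> norm x" for x using m(2) pl[of 0 x] by (auto simp: le_fun_def intro: order_trans)
  have "bounded_linear m"
  proof (rule bounded_linear_intro[where K = 1])
    show "norm (m x) \<le> norm x * 1" for x using le[of x] le[of "- x"] neg[of x] by (auto simp: abs_le_iff)
  qed (simp_all add: add scale)
  moreover have "m (- x0) \<le> - norm x0"
    using m(2) pl[of 1 "- x0"] by (auto simp: le_fun_def intro: order_trans)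
  ultimately show ?thesis using that[of m] neg by simp
qed

text \<open>\<open>\<phi>\<close> is the unique complex-linear functional with real part f.\<close>

lemma separating_functional:
  fixes x0 :: "'a::cstar_algebra"
  assumes "x0 \<noteq> 0"
  obtains \<phi> :: "'a \<Rightarrow> complex" where "bounded_linear \<phi>" "\<And>c x. \<phi> (c *\<^sub>C x) = c * \<phi> x" "\<phi> x0 \<noteq> 0"
proof -
  obtain f :: "'a \<Rightarrow> real" where f: "bounded_linear f" "norm x0 \<le> f x0" using hahn_banach_real by blast
  interpret f: bounded_linear f by (rule f)
  define \<phi> where "\<phi> x = complex_of_real (f x) - \<i> * complex_of_real (f (\<i> *\<^sub>C x))" for x
  have "bounded_linear \<phi>" unfolding \<phi>_def
    by (intro bounded_linear_sub bounded_linear_const_mult bounded_linear_compose[OF bounded_linear_of_real]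
        bounded_linear_compose[OF f(1)] bounded_linear_scaleC f(1))
  moreover have "\<phi> (c *\<^sub>C x) = c * \<phi> x" for c x
  proof -
    have c: "c *\<^sub>C x = Re c *\<^sub>R x + Im c *\<^sub>R (\<i> *\<^sub>C x)"
      by (subst complex_eq[of c]) (simp add: scaleC_add_left scaleC_scaleC mult.commute flip: scaleC_of_real)
    have ic: "\<i> *\<^sub>C (c *\<^sub>C x) = Re c *\<^sub>R (\<i> *\<^sub>C x) - Im c *\<^sub>R x"
      unfolding c by (simp add: scaleC_add_right scaleC_scaleC mult.commute scaleC_minus_left
          flip: scaleC_of_real)
    show ?thesis
      unfolding \<phi>_def ic unfolding c
      by (simp add: f.add f.diff f.scaleR complex_eq_iff algebra_simps)
  qed
  moreover have "\<phi> x0 \<noteq> 0"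
  proof -
    have "Re (\<phi> x0) = f x0" by (simp add: \<phi>_def)
    moreover have "f x0 > 0" using f(2) assms by (meson less_le_trans zero_less_norm_iff)
    ultimately show ?thesis by auto
  qed
  ultimately show ?thesis using that by blast
qed

lemma scaleC_zero_right: "c *\<^sub>C (0::'a::cstar_algebra) = 0"
  using scaleC_diff_right[of c "0::'a" 0] by simp

lemma scaleC_minus_right: "c *\<^sub>C (- x) = - (c *\<^sub>C (x::'a::cstar_algebra))"
  using scaleC_diff_right[of c 0 x] by (simp add: scaleC_zero_right)

lemma norm_mult_le:
  fixes x y :: "'a::real_normed_algebra"
  assumes "norm x \<le> A" "norm y \<le> B"
  shows "norm (x * y) \<le> A * B"
  using assms by (meson mult_mono norm_ge_zero norm_mult_ineq order_trans)

definition complex_diff :: "('a::cstar_algebra \<Rightarrow> 'b::cstar_algebra) \<Rightarrow> 'a \<Rightarrow> bool" where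
  "complex_diff f x \<longleftrightarrow> (\<exists>f'. (f has_derivative f') (at x) \<and> (\<forall>c v. f' (c *\<^sub>C v) = c *\<^sub>C f' v))"

lemma analytic_map_on_iff: "analytic_map_on f S \<longleftrightarrow> (\<forall>x\<in>S. complex_diff f x)"
  by (simp add: analytic_map_on_def complex_diff_def)

text \<open>A complex-linear functional makes the map holomorphic in the usual sense. The domain
  lies in the complex plane; maps on balls of the algebra are later restricted to complex lines in
  order to use it.\<close>

lemma identity_theorem:
  fixes f :: "complex \<Rightarrow> 'b::cstar_algebra"
  assumes f: "\<And>z. z \<in> S \<Longrightarrow> complex_diff f z" and S: "open S" "connected S"
    and U: "open U" "p \<in> U" "p \<in> S" "\<And>z. z \<in> U \<Longrightarrow> z \<in> S \<Longrightarrow> f z = 0" and w: "w \<in> S"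
  shows "f w = 0"
proof (rule ccontr)
  assume "f w \<noteq> 0"
  then obtain \<phi> :: "'b \<Rightarrow> complex" where \<phi>: "bounded_linear \<phi>" "\<And>c x. \<phi> (c *\<^sub>C x) = c * \<phi> x" "\<phi> (f w) \<noteq> 0"
    using separating_functional by blast
  have "(\<lambda>z. \<phi> (f z)) holomorphic_on S"
  proof (rule holomorphic_onI)
    fix z assume "z \<in> S"
    then obtain f' where f': "(f has_derivative f') (at z)" "\<And>c v. f' (c *\<^sub>C v) = c *\<^sub>C f' v"
      using f unfolding complex_diff_def by blast
    have "((\<lambda>z. \<phi> (f z)) has_derivative (\<lambda>v. \<phi> (f' v))) (at z)"
      using bounded_linear.has_derivative[OF \<phi>(1) f'(1)] .
    moreover have "(\<lambda>v. \<phi> (f' v)) = (*) (\<phi> (f' 1))"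
    proof
      fix v
      have "f' v = v *\<^sub>C f' 1" using f'(2)[of v 1] by (simp add: scaleC_complex_def)
      then show "\<phi> (f' v) = \<phi> (f' 1) * v" by (simp add: \<phi>(2) mult.commute)
    qed
    ultimately have "((\<lambda>z. \<phi> (f z)) has_field_derivative \<phi> (f' 1)) (at z)"
      by (simp add: has_field_derivative_def)
    then show "(\<lambda>z. \<phi> (f z)) field_differentiable at z within S"
      using field_differentiable_at_within field_differentiable_def by blast
  qed
  moreover have "p islimpt (S \<inter> U)" using S(1) U by (intro interior_limit_point) (auto simp: interior_open)
  moreover have "\<phi> (f z) = 0" if "z \<in> S \<inter> U" for z
    using that U(4) linear_0[OF bounded_linear.linear[OF \<phi>(1)]] by simp
  ultimately have "\<phi> (f w) = 0"
    using analytic_continuation[of "\<lambda>z. \<phi> (f z)" S "S \<inter> U" p w] S U w by auto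
  then show False using \<phi>(3) by simp
qed

section \<open>Calculus of complex differentiable maps\<close>

definition bounded_clinear :: "('a::cstar_algebra \<Rightarrow> 'b::cstar_algebra) \<Rightarrow> bool" where
  "bounded_clinear f \<longleftrightarrow> bounded_linear f \<and> (\<forall>c v. f (c *\<^sub>C v) = c *\<^sub>C f v)"

lemma complex_diff_const: "complex_diff (\<lambda>x. a) x"
  unfolding complex_diff_def by (intro exI[of _ "\<lambda>_. 0"]) (auto simp: scaleC_zero_right)

lemma complex_diff_ident: "complex_diff (\<lambda>x. x) x"
  unfolding complex_diff_def by (intro exI[of _ "\<lambda>x. x"]) auto

lemma complex_diff_compose: "complex_diff f x \<Longrightarrow> complex_diff g (f x) \<Longrightarrow> complex_diff (\<lambda>x. g (f x)) x"
proof -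
  assume "complex_diff f x" "complex_diff g (f x)"
  then obtain f' g' where f: "(f has_derivative f') (at x)" "\<forall>c v. f' (c *\<^sub>C v) = c *\<^sub>C f' v"
    and g: "(g has_derivative g') (at (f x))" "\<forall>c v. g' (c *\<^sub>C v) = c *\<^sub>C g' v"
    unfolding complex_diff_def by blast
  show ?thesis unfolding complex_diff_def
    using has_derivative_compose[OF f(1) g(1)] f(2) g(2) by (intro exI[of _ "\<lambda>v. g' (f' v)"]) simp
qed

lemma complex_diff_bounded_clinear: "bounded_clinear g \<Longrightarrow> complex_diff f x \<Longrightarrow> complex_diff (\<lambda>x. g (f x)) x"
  by (rule complex_diff_compose[where g = g and f = f])
    (auto simp: complex_diff_def bounded_clinear_def intro!: exI[of _ g] bounded_linear_imp_has_derivative)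

lemma complex_diff_add:
  assumes "complex_diff f x" "complex_diff g x"
  shows "complex_diff (\<lambda>x. f x + g x) x"
proof -
  obtain f' g' where "(f has_derivative f') (at x)" "\<forall>c v. f' (c *\<^sub>C v) = c *\<^sub>C f' v"
    "(g has_derivative g') (at x)" "\<forall>c v. g' (c *\<^sub>C v) = c *\<^sub>C g' v" using assms unfolding complex_diff_def by blast
  then show ?thesis unfolding complex_diff_def
    by (intro exI[of _ "\<lambda>v. f' v + g' v"]) (auto simp: scaleC_add_right intro: has_derivative_add)
qed

lemma complex_diff_diff:
  assumes "complex_diff f x" "complex_diff g x"
  shows "complex_diff (\<lambda>x. f x - g x) x"
proof -
  obtain f' g' where "(f has_derivative f') (at x)" "\<forall>c v. f' (c *\<^sub>C v) = c *\<^sub>C f' v"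
    "(g has_derivative g') (at x)" "\<forall>c v. g' (c *\<^sub>C v) = c *\<^sub>C g' v" using assms unfolding complex_diff_def by blast
  then show ?thesis unfolding complex_diff_def
    by (intro exI[of _ "\<lambda>v. f' v - g' v"]) (auto simp: scaleC_diff_right intro: has_derivative_diff)
qed

lemma complex_diff_mult:
  assumes "complex_diff f x" "complex_diff g x"
  shows "complex_diff (\<lambda>x. f x * g x) x"
proof -
  obtain f' g' where "(f has_derivative f') (at x)" "\<forall>c v. f' (c *\<^sub>C v) = c *\<^sub>C f' v"
    "(g has_derivative g') (at x)" "\<forall>c v. g' (c *\<^sub>C v) = c *\<^sub>C g' v" using assms unfolding complex_diff_def by blast
  then show ?thesis unfolding complex_diff_def
    by (intro exI[of _ "\<lambda>v. f x * g' v + f' v * g x"])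
      (auto simp: scaleC_add_right scaleC_mult_left scaleC_mult_right intro!: has_derivative_mult)
qed

lemma bounded_clinear_scaleC_left: "bounded_clinear (\<lambda>z. z *\<^sub>C (x::'a::cstar_algebra))"
  unfolding bounded_clinear_def by (simp add: bounded_linear_scaleC_left scaleC_complex_def scaleC_scaleC)

lemma has_derivative_quadratic:
  assumes "bounded_linear f'" "0 < e"
    "\<And>y. dist y x < e \<Longrightarrow> norm (f y - f x - f' (y - x)) \<le> C * (norm (y - x))\<^sup>2"
  shows "(f has_derivative f') (at x)"
proof (rule has_derivativeI_sandwich[OF assms(2,1)])
  fix y assume "y \<noteq> x" "dist y x < e"
  then show "norm (f y - f x - f' (y - x)) / norm (y - x) \<le> C * norm (y - x)"
    using assms(3)[of y] by (simp add: divide_simps power2_eq_square mult.assoc)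
next
  have "((\<lambda>y. C * norm (y - x)) \<longlongrightarrow> C * norm (x - x)) (at x)" by (intro tendsto_intros)
  then show "((\<lambda>y. C * norm (y - x)) \<longlongrightarrow> 0) (at x)" by simp
qed

text \<open>With i and j the inverses of x and y and v = y - x, inserting j = i - j v i into itself
  leaves the remainder j v i v i, which is quadratic in v.\<close>

lemma complex_diff_inv_elem:
  fixes x :: "'a::cstar_algebra"
  assumes x: "invertible_elem x"
  shows "complex_diff inv_elem x"
proof -
  define i where "i = inv_elem x"
  define N where "N = norm i + 1"
  have N: "N > 0" "norm i \<le> N" by (auto simp: N_def intro: add_nonneg_pos)
  \<comment> \<open>Then N e = 1/2, so \<open>inv_near\<close> bounds the inverse of y by 2
    N.\<close>
  define e where "e = 1 / (2 * N)"
  define f' where "f' v = - (i * v * i)" for v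
  have bl: "bounded_linear f'" unfolding f'_def
    by (intro bounded_linear_minus
        bounded_linear_compose[OF bounded_linear_mult_left bounded_linear_mult_right])
  have "(inv_elem has_derivative f') (at x)"
  proof (rule has_derivative_quadratic[OF bl, where e = e and C = "2 * N * N * N"])
    show "0 < e" using N by (simp add: e_def)
    fix y assume y: "dist y x < e"
    have d: "norm (y - x) \<le> e" "N * e = 1 / 2" using y N by (auto simp: dist_norm e_def)
    have iy: "invertible_elem y" and ny: "norm (inv_elem y) \<le> 2 * N"
      using inv_near[OF x, of N y e] N d by (auto simp: i_def)
    let ?v = "y - x" and ?j = "inv_elem y"
    have jy: "?j * y = 1" and xi: "x * i = 1" using inv_elem_left[OF iy] inv_elem_right[OF x] by (auto simp: i_def)
    have ji: "?j = i - ?j * ?v * i"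
      by (simp add: algebra_simps jy xi)
    have eq: "?j - i - f' ?v = ?j * ?v * i * ?v * i"
    proof -
      have "?j - i - f' ?v = (i - ?j) * ?v * i" by (subst ji) (simp add: f'_def algebra_simps)
      also have "i - ?j = ?j * ?v * i" using ji by (simp add: algebra_simps)
      finally show ?thesis .
    qed
    have "norm (?j * ?v * i * ?v * i) \<le> (2 * N) * norm ?v * N * norm ?v * N"
      by (intro norm_mult_le ny N order_refl)
    also have "\<dots> = 2 * N * N * N * (norm ?v)\<^sup>2" by (simp add: power2_eq_square)
    finally show "norm (inv_elem y - inv_elem x - f' (y - x)) \<le> 2 * N * N * N * (norm (y - x))\<^sup>2"
      unfolding i_def[symmetric] eq .
  qed
  moreover have "f' (c *\<^sub>C v) = c *\<^sub>C f' v" for c v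
    by (simp add: f'_def scaleC_mult_left scaleC_mult_right scaleC_minus_right)
  ultimately show ?thesis unfolding complex_diff_def by blast
qed

lemma complex_diff_continuous: "complex_diff f x \<Longrightarrow> isCont f x"
  unfolding complex_diff_def using has_derivative_continuous by blast


section \<open>Boolean transforms of bounded variables\<close>

locale op_space =
  fixes \<iota> :: "'b::cstar_algebra \<Rightarrow> 'a::cstar_algebra" and E :: "'a \<Rightarrow> 'b"
  assumes incl: "unital_inclusion \<iota>" and expect: "conditional_expectation \<iota> E"
begin

lemma \<iota>_simps: "\<iota> 1 = 1" "\<iota> (x + y) = \<iota> x + \<iota> y" "\<iota> (c *\<^sub>C x) = c *\<^sub>C \<iota> x" "\<iota> (x * y) = \<iota> x * \<iota> y"
  "\<iota> (star x) = star (\<iota> x)"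
  using incl by (auto simp: unital_inclusion_def)

lemma \<iota>_zero: "\<iota> 0 = 0"
  using \<iota>_simps(2)[of 0 0] by simp

lemma \<iota>_scaleR: "\<iota> (r *\<^sub>R x) = r *\<^sub>R \<iota> x"
  using \<iota>_simps(3)[of "complex_of_real r" x] by (simp add: scaleC_of_real)

lemma \<iota>_minus: "\<iota> (- x) = - \<iota> x"
  using \<iota>_scaleR[of "- 1" x] by simp

lemma \<iota>_diff: "\<iota> (x - y) = \<iota> x - \<iota> y"
  using \<iota>_simps(2)[of x "- y"] by (simp add: \<iota>_minus)

lemma \<iota>_of_real: "\<iota> (of_real r) = of_real r"
  by (simp add: of_real_def \<iota>_scaleR \<iota>_simps)

lemma E_simps: "E (x + y) = E x + E y" "E (c *\<^sub>C x) = c *\<^sub>C E x" "E (\<iota> b) = b"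
  "norm (E x) \<le> norm x"
  using expect by (auto simp: conditional_expectation_def)

lemma E_positive: "norm_positive x \<Longrightarrow> norm_positive (E x)"
  using expect by (auto simp: conditional_expectation_def cstar_positive_iff)

lemma E_left: "E (\<iota> b * x) = b * E x"
  using expect \<iota>_simps(1) unfolding conditional_expectation_def by (metis mult_1_right)

lemma E_right: "E (x * \<iota> b) = E x * b"
  using expect \<iota>_simps(1) unfolding conditional_expectation_def by (metis mult_1_left)

lemma E_zero: "E 0 = 0"
  using E_simps(1)[of 0 0] by simp

lemma E_scaleR: "E (r *\<^sub>R x) = r *\<^sub>R E x"
  using E_simps(2)[of "complex_of_real r" x] by (simp add: scaleC_of_real)

lemma E_minus: "E (- x) = - E x"
  using E_scaleR[of "- 1" x] by simp

lemma E_diff: "E (x - y) = E x - E y"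
  using E_simps(1)[of x "- y"] by (simp add: E_minus)

lemma E_one: "E 1 = 1"
  using E_simps(3)[of 1] \<iota>_simps(1) by simp

lemma E_of_real: "E (of_real r) = of_real r"
  by (simp add: of_real_def E_scaleR E_one)

text \<open>One inequality: \<open>(norm b)\<^sup>2 - star b * b\<close> is the square of a
  self-adjoint element, a property that \<open>\<iota>\<close> preserves. The other:
  \<open>E\<close> is contractive.\<close>

lemma norm_\<iota>: "norm (\<iota> b) = norm b"
proof (rule antisym)
  let ?x = "star b * b"
  have "norm_positive (of_real (norm ?x) - ?x)"
    by (rule norm_positive_norm_minus[OF norm_positive_star_mult])
  then obtain z where z: "star z = z" "z * z = of_real (norm ?x) - ?x"
    using norm_positive_sqrt by blast
  have "norm_positive (\<iota> z * \<iota> z)"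
    by (rule norm_positive_square) (simp add: z(1) flip: \<iota>_simps(5))
  moreover have "\<iota> z * \<iota> z = of_real ((norm b)\<^sup>2) - star (\<iota> b) * \<iota> b"
    unfolding \<iota>_simps(4)[symmetric] z(2)
    by (simp add: \<iota>_diff \<iota>_of_real \<iota>_simps cstar_identity del: of_real_power)
  ultimately have "norm (star (\<iota> b) * \<iota> b) \<le> (norm b)\<^sup>2"
    by (intro norm_positive_norm_le[OF norm_positive_star_mult]) (auto simp del: of_real_power)
  then show "norm (\<iota> b) \<le> norm b" by (simp add: cstar_identity power2_le_iff_abs_le)
  show "norm b \<le> norm (\<iota> b)" using E_simps(4)[of "\<iota> b"] by (simp add: E_simps(3))
qed

lemma bounded_clinear_\<iota>: "bounded_clinear \<iota>"
  unfolding bounded_clinear_def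
  by (intro conjI bounded_linear_intro[where K = 1]) (simp_all add: \<iota>_simps \<iota>_scaleR norm_\<iota>)

lemma bounded_clinear_E: "bounded_clinear E"
  unfolding bounded_clinear_def
  by (intro conjI bounded_linear_intro[where K = 1]) (simp_all add: E_simps E_scaleR)

text \<open>For self-adjoint y the element \<open>norm y\<close> + y is positive, so its expectation
  is self-adjoint; the general case splits into real and imaginary parts.\<close>

lemma E_star: "E (star x) = star (E x)"
proof -
  have sa: "star (E y) = E y" if "star y = y" for y
  proof -
    have "norm_positive (of_real (norm y) + y)"
      unfolding norm_positive_def by (intro conjI exI[of _ "norm y"]) (auto simp: star_add star_of_real that)
    then have "star (E (of_real (norm y) + y)) = E (of_real (norm y) + y)"
      using E_positive norm_positive_star by blast
    then show ?thesis by (simp add: E_simps(1) E_of_real star_add star_of_real)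
  qed
  define u where "u = (1/2) *\<^sub>R (x + star x)"
  define v where "v = (1 / (2 * \<i>)) *\<^sub>C (x - star x)"
  have su: "star u = u" by (simp add: u_def star_scaleR star_add star_star add.commute)
  have sv: "star v = v"
    by (simp add: v_def star_scaleC star_diff star_star scaleC_diff_right scaleC_minus_left)
  have iv: "\<i> *\<^sub>C v = (1/2) *\<^sub>R (x - star x)"
    by (simp add: v_def scaleC_scaleC flip: scaleC_of_real)
  have x: "x = u + \<i> *\<^sub>C v" unfolding iv u_def
    by (simp add: scaleR_add_right scaleR_diff_right flip: scaleR_add_left)
  have sx: "star x = u - \<i> *\<^sub>C v" unfolding iv u_def
    by (simp add: scaleR_add_right scaleR_diff_right flip: scaleR_add_left)
  have "E (star x) = E u - \<i> *\<^sub>C E v" unfolding sx by (simp add: E_diff E_simps)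
  moreover have "star (E x) = E u - \<i> *\<^sub>C E v"
    unfolding x by (simp add: E_simps star_add star_scaleC sa[OF su] sa[OF sv] scaleC_minus_left)
  ultimately show ?thesis by simp
qed

text \<open>The seminorm of the pre-Hilbert module over \<open>B\<close> with inner product
  \<open>E (star x * y)\<close>; it may vanish on nonzero elements.\<close>

definition l2_norm :: "'a \<Rightarrow> real" where "l2_norm x = sqrt (norm (E (star x * x)))"

lemma l2_norm_nonneg: "0 \<le> l2_norm x"
  by (simp add: l2_norm_def)

lemma l2_norm_square: "(l2_norm x)\<^sup>2 = norm (E (star x * x))"
  by (simp add: l2_norm_def)

lemma l2_norm_mono:
  assumes "norm_positive (r *\<^sub>R E (star y * y) - E (star x * x))" "0 \<le> r"
  shows "l2_norm x \<le> sqrt r * l2_norm y"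
proof -
  have "norm (E (star x * x)) \<le> norm (r *\<^sub>R E (star y * y))"
    by (rule norm_positive_mono[OF E_positive[OF norm_positive_star_mult] assms(1)])
  then show ?thesis using assms(2) by (simp add: l2_norm_def flip: real_sqrt_mult)
qed

text \<open>Positivity of \<open>E (star z * z)\<close> for z = x - l y S, with Q replaced by its
  norm, gives (2 l - l^2 \<open>norm Q\<close>) \<open>star S * S\<close> <= P. The best choice is l
  = 1 / \<open>norm Q\<close>.\<close>

lemma cauchy_schwarz: "norm (E (star x * y)) \<le> l2_norm x * l2_norm y"
proof -
  define P Q S where "P = E (star x * x)" and "Q = E (star y * y)" and "S = E (star y * x)"
  have sS: "star S = E (star x * y)" by (simp add: S_def star_mult star_star flip: E_star)
  have key: "(2 * l - l\<^sup>2 * norm Q) * (norm S)\<^sup>2 \<le> norm P" if "2 * l - l\<^sup>2 * norm Q \<ge> 0" for l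
  proof -
    define z where "z = x - l *\<^sub>R (y * \<iota> S)"
    have "E (star z * z) = P - l *\<^sub>R (star S * S) - l *\<^sub>R (star S * S) + l\<^sup>2 *\<^sub>R (star S * Q * S)"
    proof -
      have "star z * z = star x * x - l *\<^sub>R (star x * y * \<iota> S) - l *\<^sub>R (\<iota> (star S) * (star y * x))
          + l\<^sup>2 *\<^sub>R (\<iota> (star S) * (star y * y) * \<iota> S)"
        by (simp add: z_def star_diff star_scaleR star_mult \<iota>_simps algebra_simps power2_eq_square)
      then show ?thesis
        by (simp add: E_simps(1) E_diff E_scaleR E_left E_right P_def[symmetric] Q_def[symmetric]
            S_def[symmetric] sS[symmetric])
    qed
    moreover have "norm_positive (E (star z * z))" by (rule E_positive[OF norm_positive_star_mult])
    moreover have "norm_positive (l\<^sup>2 *\<^sub>R (star S * (of_real (norm Q) - Q) * S))"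
      unfolding Q_def
      by (intro norm_positive_scaleR norm_positive_conj norm_positive_norm_minus E_positive
          norm_positive_star_mult) simp
    ultimately have "norm_positive ((P - l *\<^sub>R (star S * S) - l *\<^sub>R (star S * S) + l\<^sup>2 *\<^sub>R (star S * Q * S))
        + l\<^sup>2 *\<^sub>R (star S * (of_real (norm Q) - Q) * S))"
      by (metis norm_positive_add)
    also have "(P - l *\<^sub>R (star S * S) - l *\<^sub>R (star S * S) + l\<^sup>2 *\<^sub>R (star S * Q * S))
        + l\<^sup>2 *\<^sub>R (star S * (of_real (norm Q) - Q) * S) = P - (2 * l - l\<^sup>2 * norm Q) *\<^sub>R (star S * S)"
      by (simp add: of_real_def algebra_simps scaleR_2 scaleR_left_commute flip: scaleR_scaleR)
    finally have "norm ((2 * l - l\<^sup>2 * norm Q) *\<^sub>R (star S * S)) \<le> norm P"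
      by (intro norm_positive_mono norm_positive_scaleR norm_positive_star_mult that)
    then show ?thesis using that by (simp add: cstar_identity)
  qed
  have "(norm S)\<^sup>2 \<le> norm P * norm Q"
  proof (cases "norm Q = 0")
    case True
    show ?thesis
    proof (rule ccontr)
      assume "\<not> ?thesis"
      then have s: "(norm S)\<^sup>2 > 0" using True by simp
      \<comment> \<open>When Q = 0 the inequality is linear in l, so a large l forces S = 0.\<close>
      have "2 * ((norm P + 1) / (norm S)\<^sup>2) * (norm S)\<^sup>2 \<le> norm P"
        using key[of "(norm P + 1) / (norm S)\<^sup>2"] True s by simp
      then have "2 * (norm P + 1) \<le> norm P" using s by simp
      then show False by (smt (verit) norm_ge_zero)
    qed
  next
    case False
    then have "2 * (1 / norm Q) - (1 / norm Q)\<^sup>2 * norm Q = 1 / norm Q"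
      by (simp add: power2_eq_square divide_simps)
    then have "(1 / norm Q) * (norm S)\<^sup>2 \<le> norm P" using key[of "1 / norm Q"] by simp
    then show ?thesis using False by (simp add: divide_simps mult.commute)
  qed
  then have "norm S \<le> sqrt (norm P * norm Q)" by (rule real_le_rsqrt)
  moreover have "norm (E (star x * y)) = norm S" using norm_star[of S] sS by simp
  ultimately show ?thesis by (simp add: l2_norm_def P_def Q_def real_sqrt_mult)
qed

lemma l2_norm_triangle: "l2_norm (x + y) \<le> l2_norm x + l2_norm y"
proof -
  have "(l2_norm (x + y))\<^sup>2 = norm (E (star x * x) + E (star x * y) + (E (star y * x) + E (star y * y)))"
    by (simp add: l2_norm_square star_add algebra_simps E_simps)
  also have "\<dots> \<le> norm (E (star x * x)) + norm (E (star x * y)) + (norm (E (star y * x)) + norm (E (star y * y)))"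
    by (intro order_trans[OF norm_triangle_ineq] add_mono norm_triangle_ineq)
  also have "\<dots> \<le> (l2_norm x)\<^sup>2 + l2_norm x * l2_norm y + (l2_norm y * l2_norm x + (l2_norm y)\<^sup>2)"
    by (intro add_mono cauchy_schwarz) (simp_all add: l2_norm_square)
  also have "\<dots> = (l2_norm x + l2_norm y)\<^sup>2" by (simp add: power2_eq_square algebra_simps)
  finally show ?thesis by (rule power2_le_imp_le) (simp add: l2_norm_nonneg)
qed

text \<open>\<open>(norm b)\<^sup>2 - star b * b\<close> is a square z z, and expanding
  \<open>E\<close> of the positive element built from \<open>\<iota> z * x\<close> yields the
  comparison.\<close>

lemma l2_norm_module: "l2_norm (\<iota> b * x) \<le> norm b * l2_norm x"
proof -
  let ?B = "star b * b"
  have "norm_positive (of_real (norm ?B) - ?B)"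
    by (rule norm_positive_norm_minus[OF norm_positive_star_mult])
  then obtain z where z: "star z = z" "z * z = of_real (norm ?B) - ?B"
    using norm_positive_sqrt by blast
  have "norm_positive (E (star (\<iota> z * x) * (\<iota> z * x)))" by (rule E_positive[OF norm_positive_star_mult])
  also have "star (\<iota> z * x) * (\<iota> z * x) = star x * \<iota> (z * z) * x"
    by (simp add: star_mult \<iota>_simps mult.assoc z(1) flip: \<iota>_simps(5))
  also have "\<dots> = (norm b)\<^sup>2 *\<^sub>R (star x * x) - star (\<iota> b * x) * (\<iota> b * x)"
    by (simp add: z(2) \<iota>_diff \<iota>_of_real \<iota>_simps star_mult cstar_identity algebra_simps)
      (simp add: of_real_def \<iota>_scaleR \<iota>_simps flip: of_real_power)
  finally have "norm_positive ((norm b)\<^sup>2 *\<^sub>R E (star x * x) - E (star (\<iota> b * x) * (\<iota> b * x)))"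
    by (simp add: E_diff E_scaleR)
  then show ?thesis using l2_norm_mono by fastforce
qed

definition center :: "'a \<Rightarrow> 'a" where "center x = x - \<iota> (E x)"

lemma E_center: "E (center x) = 0"
  by (simp add: center_def E_diff E_simps)

lemma center_add: "center (x + y) = center x + center y"
  by (simp add: center_def E_simps \<iota>_simps)

lemma bounded_clinear_center: "bounded_clinear center"
proof -
  have "bounded_linear (\<lambda>x. x - \<iota> (E x))"
    using bounded_clinear_\<iota> bounded_clinear_E unfolding bounded_clinear_def
    by (intro bounded_linear_sub bounded_linear_ident bounded_linear_compose[of \<iota> E]) auto
  then show ?thesis
    unfolding bounded_clinear_def center_def by (simp add: E_simps \<iota>_simps scaleC_diff_right)
qed

lemma norm_center: "norm (center x) \<le> 2 * norm x"
proof -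
  have "norm (center x) \<le> norm x + norm (E x)"
    unfolding center_def using norm_triangle_ineq4[of x "\<iota> (E x)"] by (simp add: norm_\<iota>)
  then show ?thesis using E_simps(4)[of x] by linarith
qed

lemma l2_norm_center_square: "star (center x) * center x = star (center x) * x - star (center x) * \<iota> (E x)"
  by (simp add: center_def algebra_simps)

text \<open>Pythagoras: \<open>center x\<close> is orthogonal to the image of
  \<open>\<iota>\<close>. Hence the seminorm of \<open>center a\<close> is the standard
  deviation.\<close>

lemma E_center_square: "E (star (center x) * center x) = E (star x * x) - star (E x) * E x"
proof -
  have "E (star (center x) * \<iota> (E x)) = 0" by (simp add: E_right E_star E_center star_zero)
  moreover have "E (star (center x) * x) = E (star x * x) - star (E x) * E x"
    by (simp add: center_def star_diff left_diff_distrib E_diff E_left flip: \<iota>_simps(5))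
  ultimately show ?thesis unfolding l2_norm_center_square E_diff by simp
qed

lemma l2_norm_center: "l2_norm (center x) \<le> l2_norm x"
  using l2_norm_mono[of 1 x "center x"] by (simp add: E_center_square norm_positive_star_mult)

end

text \<open>\<open>R\<close> controls only moments along words with letters in \<open>B\<close>;
  \<open>norm a\<close> may exceed it, since \<open>E\<close> may have a kernel.\<close>

locale op_var = op_space \<iota> E for \<iota> :: "'b::cstar_algebra \<Rightarrow> 'a::cstar_algebra" and E :: "'a \<Rightarrow> 'b" +
  fixes a :: 'a and R :: real
  assumes a_star: "star a = a" and R_pos: "0 < R"
    and moment_bound: "norm (E (alt_word \<iota> a bs)) \<le> R ^ (length bs + 1) * prod_list (map norm bs)"
begin

primrec left_word :: "'b list \<Rightarrow> 'a \<Rightarrow> 'a" where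
  "left_word [] y = y"
| "left_word (b # bs) y = a * \<iota> b * left_word bs y"

lemma left_word_append: "left_word (bs @ cs) y = left_word bs (left_word cs y)"
  by (induction bs) auto

lemma left_word_add: "left_word bs (x + y) = left_word bs x + left_word bs y"
  by (induction bs) (auto simp: algebra_simps)

lemma left_word_alt_word: "left_word (bs @ [b]) y = alt_word \<iota> a bs * \<iota> b * y"
  by (induction bs) (auto simp: mult.assoc)

lemma prod_list_norm_nonneg: "0 \<le> prod_list (map norm bs)"
  by (induction bs) auto

lemma left_word_moment:
  "norm (E (\<iota> c * left_word bs (\<iota> d))) \<le> norm c * (R ^ length bs * prod_list (map norm bs)) * norm d"
proof (cases bs rule: rev_cases)
  case Nil
  then show ?thesis by (simp add: E_left E_simps norm_mult_ineq)
next
  case (snoc bs' b)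
  have "E (\<iota> c * left_word bs (\<iota> d)) = c * E (alt_word \<iota> a bs') * (b * d)"
    unfolding snoc left_word_alt_word by (simp add: mult.assoc E_left E_right flip: \<iota>_simps(4))
  also have "norm \<dots> \<le> norm c * (R ^ (length bs' + 1) * prod_list (map norm bs')) * (norm b * norm d)"
    by (intro norm_mult_le moment_bound order_refl)
  finally show ?thesis by (simp add: snoc algebra_simps)
qed

text \<open>Each induction step moves one letter across the adjoint: the factor a joins the
  right-hand word and f becomes its first letter, until \<open>left_word_moment\<close>
  applies.\<close>

lemma left_word_moment2:
  "norm (E (star (left_word bs (\<iota> d)) * (\<iota> f * left_word cs (\<iota> e))))
    \<le> norm d * norm f * norm e * (R ^ (length bs + length cs) * (prod_list (map norm bs) * prod_list (map norm cs)))"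
proof (induction bs arbitrary: f cs)
  case Nil
  have "norm (E (\<iota> (star d * f) * left_word cs (\<iota> e)))
      \<le> norm (star d * f) * (R ^ length cs * prod_list (map norm cs)) * norm e"
    by (rule left_word_moment)
  also have "\<dots> \<le> (norm d * norm f) * (R ^ length cs * prod_list (map norm cs)) * norm e"
    using R_pos norm_mult_ineq[of "star d" f]
    by (intro mult_right_mono mult_nonneg_nonneg prod_list_norm_nonneg) (auto simp: norm_star)
  finally show ?case by (simp add: \<iota>_simps algebra_simps)
next
  case (Cons b bs)
  have "star (left_word (b # bs) (\<iota> d)) * (\<iota> f * left_word cs (\<iota> e))
      = star (left_word bs (\<iota> d)) * (\<iota> (star b) * left_word (f # cs) (\<iota> e))"
    by (simp add: star_mult a_star \<iota>_simps mult.assoc)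
  then show ?case using Cons.IH[of "star b" "f # cs"] by (simp add: norm_star algebra_simps)
qed

text \<open>The vectors on which words act with the growth predicted by \<open>R\<close>, up to a
  constant depending on the vector. All \<open>V c n\<close> belong to them, and on them
  multiplication by \<open>a\<close> has seminorm at most \<open>R\<close>.\<close>

definition moderate :: "'a \<Rightarrow> bool" where
  "moderate y \<longleftrightarrow> (\<exists>C\<ge>0. \<forall>bs. l2_norm (left_word bs y) \<le> C * (R ^ length bs * prod_list (map norm bs)))"

lemma moderate_\<iota>: "moderate (\<iota> b)"
  unfolding moderate_def
proof (intro exI[of _ "norm b"] conjI allI)
  fix bs
  have "norm (E (star (left_word bs (\<iota> b)) * (\<iota> 1 * left_word bs (\<iota> b))))
      \<le> norm b * norm (1::'b) * norm b * (R ^ (length bs + length bs) * (prod_list (map norm bs) * prod_list (map norm bs)))"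
    by (rule left_word_moment2)
  then have "(l2_norm (left_word bs (\<iota> b)))\<^sup>2 \<le> (norm b * (R ^ length bs * prod_list (map norm bs)))\<^sup>2"
    unfolding l2_norm_square by (simp add: \<iota>_simps power2_eq_square power_add algebra_simps)
  then show "l2_norm (left_word bs (\<iota> b)) \<le> norm b * (R ^ length bs * prod_list (map norm bs))"
    by (rule power2_le_imp_le) (use R_pos prod_list_norm_nonneg in \<open>auto intro!: mult_nonneg_nonneg\<close>)
qed simp

lemma moderate_add:
  assumes "moderate x" "moderate y"
  shows "moderate (x + y)"
proof -
  obtain C D where C: "C \<ge> 0" "\<And>bs. l2_norm (left_word bs x) \<le> C * (R ^ length bs * prod_list (map norm bs))"
    and D: "D \<ge> 0" "\<And>bs. l2_norm (left_word bs y) \<le> D * (R ^ length bs * prod_list (map norm bs))"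
    using assms unfolding moderate_def by blast
  have "l2_norm (left_word bs (x + y)) \<le> (C + D) * (R ^ length bs * prod_list (map norm bs))" for bs
    unfolding left_word_add
    using l2_norm_triangle[of "left_word bs x" "left_word bs y"] C(2)[of bs] D(2)[of bs]
    by (simp add: algebra_simps)
  then show ?thesis unfolding moderate_def using C(1) D(1) by (intro exI[of _ "C + D"]) auto
qed

lemma moderate_module:
  assumes "moderate y"
  shows "moderate (\<iota> b * y)"
proof -
  obtain C where C: "C \<ge> 0" "\<And>bs. l2_norm (left_word bs y) \<le> C * (R ^ length bs * prod_list (map norm bs))"
    using assms unfolding moderate_def by blast
  have "l2_norm (left_word bs (\<iota> b * y)) \<le> (norm b * C) * (R ^ length bs * prod_list (map norm bs))" for bs
  proof (cases bs rule: rev_cases)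
    case Nil
    have "norm b * l2_norm y \<le> norm b * C" using C(2)[of "[]"] by (intro mult_left_mono) auto
    then show ?thesis using l2_norm_module[of b y] Nil by simp
  next
    case (snoc cs d)
    \<comment> \<open>The factor b is absorbed into the last letter, so the length of the word does
      not change.\<close>
    have "left_word bs (\<iota> b * y) = left_word (cs @ [d * b]) y"
      by (simp add: snoc left_word_append \<iota>_simps mult.assoc)
    then have "l2_norm (left_word bs (\<iota> b * y)) \<le> C * (R ^ length bs * (prod_list (map norm cs) * norm (d * b)))"
      using C(2)[of "cs @ [d * b]"] snoc by simp
    also have "\<dots> \<le> C * (R ^ length bs * (prod_list (map norm cs) * (norm d * norm b)))"
      using C(1) R_pos by (intro mult_left_mono norm_mult_ineq prod_list_norm_nonneg) auto
    finally show ?thesis by (simp add: snoc algebra_simps)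
  qed
  then show ?thesis unfolding moderate_def using C(1) by (intro exI[of _ "norm b * C"]) auto
qed

lemma moderate_var:
  assumes "moderate y"
  shows "moderate (a * y)"
proof -
  obtain C where C: "C \<ge> 0" "\<And>bs. l2_norm (left_word bs y) \<le> C * (R ^ length bs * prod_list (map norm bs))"
    using assms unfolding moderate_def by blast
  \<comment> \<open>A further factor a is a word of one letter, the unit.\<close>
  have "left_word bs (a * y) = left_word (bs @ [1]) y" for bs
    by (simp add: left_word_append \<iota>_simps)
  then have "l2_norm (left_word bs (a * y)) \<le> (C * R) * (R ^ length bs * prod_list (map norm bs))" for bs
    using C(2)[of "bs @ [1]"] by (simp add: algebra_simps)
  then show ?thesis unfolding moderate_def using C(1) R_pos by (intro exI[of _ "C * R"]) auto
qed

lemma moderate_center: "moderate y \<Longrightarrow> moderate (center y)"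
  using moderate_add[of y "\<iota> (- E y)"] moderate_\<iota>[of "- E y"] by (simp add: center_def \<iota>_minus)

text \<open>The sequence \<open>l2_norm (a\<^sup>N y)\<close> is log-convex and bounded by \<open>C R\<^sup>N\<close>, so its first ratio is at most \<open>R\<close>.\<close>

lemma l2_norm_var:
  assumes "moderate y"
  shows "l2_norm (a * y) \<le> R * l2_norm y"
proof (rule ccontr)
  assume less: "\<not> ?thesis"
  define s where "s N = l2_norm (a ^ N * y)" for N
  have s0: "s N \<ge> 0" for N by (simp add: s_def l2_norm_nonneg)
  obtain C where C: "C \<ge> 0" "\<And>bs. l2_norm (left_word bs y) \<le> C * (R ^ length bs * prod_list (map norm bs))"
    using assms unfolding moderate_def by blast
  have "left_word (replicate N 1) y = a ^ N * y" for N
    by (induction N) (auto simp: \<iota>_simps mult.assoc)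
  then have growth: "s N \<le> C * R ^ N" for N using C(2)[of "replicate N 1"] by (simp add: s_def)
  \<comment> \<open>Self-adjointness moves one factor a to the other side, and Cauchy--Schwarz
    compares the neighbours of \<open>Suc N\<close>.\<close>
  have lc: "(s (Suc N))\<^sup>2 \<le> s N * s (Suc (Suc N))" for N
  proof -
    have sp: "star (a ^ N) = a ^ N" for N
      by (induction N) (simp_all add: star_one star_mult a_star power_commutes)
    have "star (a ^ Suc N * y) * (a ^ Suc N * y) = star (a ^ N * y) * (a ^ Suc (Suc N) * y)"
    proof -
      have "a ^ Suc N * a ^ Suc N = a ^ N * a ^ Suc (Suc N)" by (simp del: power_Suc flip: power_add)
      then show ?thesis unfolding star_mult sp by (metis mult.assoc)
    qed
    then show ?thesis unfolding s_def l2_norm_square using cauchy_schwarz[of "a ^ N * y" "a ^ Suc (Suc N) * y"] by metis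
  qed
  have s1: "R * s 0 < s 1" using less by (simp add: s_def)
  have "s 0 \<noteq> 0"
  proof
    assume "s 0 = 0"
    then have "(s 1)\<^sup>2 \<le> 0" using lc[of 0] by simp
    then show False using s1 \<open>s 0 = 0\<close> by simp
  qed
  then have s0p: "s 0 > 0" using s0[of 0] by simp
  define q where "q = s 1 / s 0"
  have qR: "q > R" using s1 s0p by (simp add: q_def divide_simps mult.commute)
  have "s N > 0 \<and> q * s N \<le> s (Suc N)" for N
  proof (induction N)
    case 0
    then show ?case using s0p by (simp add: q_def)
  next
    case (Suc N)
    then have p: "s (Suc N) > 0" using qR R_pos by (smt (verit) mult_pos_pos)
    have "q * s N * s (Suc N) \<le> s (Suc N) * s (Suc N)" using Suc p by (intro mult_right_mono) auto
    also have "\<dots> \<le> s N * s (Suc (Suc N))" using lc[of N] by (simp add: power2_eq_square)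
    finally show ?case using Suc p by simp
  qed
  then have step: "q * s N \<le> s (Suc N)" for N by blast
  have geo: "q ^ N * s 0 \<le> s N" for N
  proof (induction N)
    case (Suc N)
    then have "q * (q ^ N * s 0) \<le> q * s N" using qR R_pos by (intro mult_left_mono) auto
    then show ?case using step[of N] by (simp add: mult.assoc)
  qed simp
  have "1 < q / R" using qR R_pos by simp
  then obtain N where "C / s 0 < (q / R) ^ N" using real_arch_pow by blast
  then have "C * R ^ N < q ^ N * s 0"
    using s0p R_pos by (simp add: power_divide divide_simps mult.commute)
  then show False using geo[of N] growth[of N] by linarith
qed

definition \<sigma> :: real where "\<sigma> = l2_norm (center a)"

lemma \<sigma>_nonneg: "0 \<le> \<sigma>"
  by (simp add: \<sigma>_def l2_norm_nonneg)

lemma center_a_star: "star (center a) = center a"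
  by (simp add: center_def star_diff a_star flip: \<iota>_simps(5) E_star)

text \<open>Because y has mean zero, a may be replaced by its centered part, which produces \<sigma>
  in place of \<open>R\<close>.\<close>

lemma E_var_bound:
  assumes "E y = 0"
  shows "norm (E (a * \<iota> c * y)) \<le> \<sigma> * norm c * l2_norm y"
proof -
  have "a * \<iota> c * y = star (center a) * (\<iota> c * y) + \<iota> (E a * c) * y"
    by (subst center_a_star) (simp add: center_def \<iota>_simps algebra_simps)
  then have "E (a * \<iota> c * y) = E (star (center a) * (\<iota> c * y))"
    by (simp add: E_simps(1) E_left assms)
  also have "norm \<dots> \<le> \<sigma> * l2_norm (\<iota> c * y)" unfolding \<sigma>_def by (rule cauchy_schwarz)
  also have "\<dots> \<le> \<sigma> * (norm c * l2_norm y)" by (intro mult_left_mono l2_norm_module \<sigma>_nonneg)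
  finally show ?thesis by (simp add: mult.assoc)
qed

lemma l2_norm_step:
  assumes "moderate y"
  shows "l2_norm (center (a * \<iota> c * y)) \<le> R * norm c * l2_norm y"
proof -
  have "l2_norm (center (a * \<iota> c * y)) \<le> l2_norm (a * (\<iota> c * y))"
    using l2_norm_center[of "a * \<iota> c * y"] by (simp add: mult.assoc)
  also have "\<dots> \<le> R * l2_norm (\<iota> c * y)" by (rule l2_norm_var[OF moderate_module[OF assms]])
  also have "\<dots> \<le> R * (norm c * l2_norm y)" using R_pos by (intro mult_left_mono l2_norm_module) auto
  finally show ?thesis by (simp add: mult.assoc)
qed

section \<open>Boolean cumulants and their derivatives\<close>

primrec V :: "'b \<Rightarrow> nat \<Rightarrow> 'a" where
  "V c 0 = center a"
| "V c (Suc n) = center (a * \<iota> c * V c n)"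

primrec V' :: "'b \<Rightarrow> 'b \<Rightarrow> nat \<Rightarrow> 'a" where
  "V' c v 0 = 0"
| "V' c v (Suc n) = center (a * \<iota> v * V c n + a * \<iota> c * V' c v n)"

definition \<kappa> :: "nat \<Rightarrow> 'b \<Rightarrow> 'b" where "\<kappa> n c = E (a * \<iota> c * V c n)"

definition \<kappa>' :: "nat \<Rightarrow> 'b \<Rightarrow> 'b \<Rightarrow> 'b" where
  "\<kappa>' n c v = E (a * \<iota> v * V c n + a * \<iota> c * V' c v n)"

lemma moderate_a: "moderate a"
  using moderate_var[OF moderate_\<iota>[of 1]] by (simp add: \<iota>_simps)

lemma moderate_V: "moderate (V c n)"
  by (induction n) (auto simp: mult.assoc intro!: moderate_center moderate_a moderate_var moderate_module)

lemma moderate_V': "moderate (V' c v n)"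
proof (induction n)
  case 0
  then show ?case using moderate_\<iota>[of 0] by (simp add: \<iota>_zero)
next
  case (Suc n)
  then show ?case
    by (auto simp: mult.assoc intro!: moderate_center moderate_add moderate_var moderate_module moderate_V)
qed

lemma E_V: "E (V c n) = 0"
  by (cases n) (auto simp: E_center)

lemma E_V': "E (V' c v n) = 0"
  by (cases n) (auto simp: E_center E_zero)

lemma l2_norm_V: "l2_norm (V c n) \<le> (R * norm c) ^ n * \<sigma>"
proof (induction n)
  case (Suc n)
  have "l2_norm (V c (Suc n)) \<le> R * norm c * l2_norm (V c n)" using l2_norm_step[OF moderate_V] by simp
  also have "\<dots> \<le> R * norm c * ((R * norm c) ^ n * \<sigma>)" using Suc R_pos by (intro mult_left_mono) auto
  finally show ?case by (simp add: mult.assoc)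
qed (simp add: \<sigma>_def)

text \<open>The product rule gives one term per occurrence of c. The truncated exponent at n = 0 is
  harmless because the factor \<open>real n\<close> vanishes.\<close>

lemma l2_norm_V': "l2_norm (V' c v n) \<le> real n * (R * norm v) * (R * norm c) ^ (n - 1) * \<sigma>"
proof (induction n)
  case 0
  then show ?case by (simp add: l2_norm_def E_zero)
next
  case (Suc n)
  have "l2_norm (V' c v (Suc n)) \<le> l2_norm (center (a * \<iota> v * V c n)) + l2_norm (center (a * \<iota> c * V' c v n))"
    by (simp add: center_add l2_norm_triangle)
  also have "\<dots> \<le> R * norm v * l2_norm (V c n) + R * norm c * l2_norm (V' c v n)"
    by (intro add_mono l2_norm_step moderate_V moderate_V')
  also have "\<dots> \<le> R * norm v * ((R * norm c) ^ n * \<sigma>)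
      + R * norm c * (real n * (R * norm v) * (R * norm c) ^ (n - 1) * \<sigma>)"
    using Suc R_pos by (intro add_mono mult_left_mono l2_norm_V) auto
  also have "\<dots> = real (Suc n) * (R * norm v) * (R * norm c) ^ (Suc n - 1) * \<sigma>"
    by (cases n) (simp_all add: algebra_simps)
  finally show ?case .
qed

lemma norm_\<kappa>: "norm (\<kappa> n c) \<le> \<sigma>\<^sup>2 * norm c * (R * norm c) ^ n"
proof -
  have "norm (\<kappa> n c) \<le> \<sigma> * norm c * l2_norm (V c n)" unfolding \<kappa>_def by (rule E_var_bound[OF E_V])
  also have "\<dots> \<le> \<sigma> * norm c * ((R * norm c) ^ n * \<sigma>)"
    by (intro mult_left_mono l2_norm_V mult_nonneg_nonneg \<sigma>_nonneg) auto
  finally show ?thesis by (simp add: power2_eq_square algebra_simps)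
qed

text \<open>The letter c occurs n + 1 times in \<open>\<kappa> n c\<close>. This factor turns the
  geometric series into the square in the Lipschitz constant.\<close>

lemma norm_\<kappa>': "norm (\<kappa>' n c v) \<le> \<sigma>\<^sup>2 * norm v * (real (Suc n) * (R * norm c) ^ n)"
proof -
  have "norm (\<kappa>' n c v) \<le> norm (E (a * \<iota> v * V c n)) + norm (E (a * \<iota> c * V' c v n))"
    unfolding \<kappa>'_def E_simps(1) by (rule norm_triangle_ineq)
  also have "\<dots> \<le> \<sigma> * norm v * l2_norm (V c n) + \<sigma> * norm c * l2_norm (V' c v n)"
    by (intro add_mono E_var_bound E_V E_V')
  also have "\<dots> \<le> \<sigma> * norm v * ((R * norm c) ^ n * \<sigma>)
      + \<sigma> * norm c * (real n * (R * norm v) * (R * norm c) ^ (n - 1) * \<sigma>)"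
    by (intro add_mono mult_left_mono l2_norm_V l2_norm_V' mult_nonneg_nonneg \<sigma>_nonneg) auto
  also have "\<dots> = \<sigma>\<^sup>2 * norm v * (real (Suc n) * (R * norm c) ^ n)"
    by (cases n) (simp_all add: power2_eq_square algebra_simps)
  finally show ?thesis .
qed

lemma V_has_derivative: "((\<lambda>c. V c n) has_derivative (\<lambda>v. V' c v n)) (at c)"
proof (induction n)
  case 0
  then show ?case by simp
next
  case (Suc n)
  have i: "(\<iota> has_derivative \<iota>) (at c)" using bounded_clinear_\<iota> unfolding bounded_clinear_def
    by (intro bounded_linear_imp_has_derivative) auto
  have "((\<lambda>c. a * \<iota> c) has_derivative (\<lambda>v. a * \<iota> v)) (at c)"
    by (rule has_derivative_mult_right[OF i])
  from has_derivative_mult[OF this Suc]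
  have "((\<lambda>c. a * \<iota> c * V c n) has_derivative (\<lambda>v. a * \<iota> v * V c n + a * \<iota> c * V' c v n)) (at c)"
    by (simp add: add.commute)
  then show ?case
    using bounded_linear.has_derivative[of center] bounded_clinear_center unfolding bounded_clinear_def by auto
qed

lemma \<kappa>_has_derivative: "(\<kappa> n has_derivative \<kappa>' n c) (at c)"
proof -
  have i: "(\<iota> has_derivative \<iota>) (at c)" using bounded_clinear_\<iota> unfolding bounded_clinear_def
    by (intro bounded_linear_imp_has_derivative) auto
  have "((\<lambda>c. a * \<iota> c) has_derivative (\<lambda>v. a * \<iota> v)) (at c)"
    by (rule has_derivative_mult_right[OF i])
  from has_derivative_mult[OF this V_has_derivative]
  have "((\<lambda>c. a * \<iota> c * V c n) has_derivative (\<lambda>v. a * \<iota> v * V c n + a * \<iota> c * V' c v n)) (at c)"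
    by (simp add: add.commute)
  then show ?thesis
    using bounded_linear.has_derivative[of E] bounded_clinear_E unfolding bounded_clinear_def \<kappa>_def[abs_def] \<kappa>'_def[abs_def]
    by auto
qed

lemma V'_scaleC: "V' c (z *\<^sub>C v) n = z *\<^sub>C V' c v n"
proof (induction n)
  case (Suc n)
  have "center (z *\<^sub>C x) = z *\<^sub>C center x" for x using bounded_clinear_center unfolding bounded_clinear_def by blast
  then show ?case
    by (simp add: Suc \<iota>_simps scaleC_mult_left scaleC_mult_right flip: scaleC_add_right)
qed (simp add: scaleC_zero_right)

lemma \<kappa>'_scaleC: "\<kappa>' n c (z *\<^sub>C v) = z *\<^sub>C \<kappa>' n c v"
  by (simp add: \<kappa>'_def V'_scaleC \<iota>_simps scaleC_mult_left scaleC_mult_right E_simps(2) flip: scaleC_add_right)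

section \<open>The Boolean series and its derivative\<close>

definition h :: "'b \<Rightarrow> 'b" where "h c = E a + (\<Sum>n. \<kappa> n c)"

definition h' :: "'b \<Rightarrow> 'b \<Rightarrow> 'b" where "h' c v = (\<Sum>n. \<kappa>' n c v)"

lemma summable_\<kappa>: "R * norm c < 1 \<Longrightarrow> summable (\<lambda>n. \<kappa> n c)"
  by (rule summable_comparison_test'[where N = 0 and g = "\<lambda>n. \<sigma>\<^sup>2 * norm c * (R * norm c) ^ n"])
    (use R_pos norm_\<kappa> in \<open>auto intro!: summable_mult summable_geometric\<close>)

lemma norm_h_minus:
  assumes "R * norm c < 1"
  shows "norm (h c - E a) \<le> \<sigma>\<^sup>2 * norm c / (1 - R * norm c)"
proof -
  have "norm (\<Sum>n. \<kappa> n c) \<le> (\<Sum>n. \<sigma>\<^sup>2 * norm c * (R * norm c) ^ n)"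
    by (rule norm_suminf_le[OF norm_\<kappa>]) (use assms R_pos in \<open>auto intro!: summable_mult summable_geometric\<close>)
  also have "\<dots> = \<sigma>\<^sup>2 * norm c * (1 / (1 - R * norm c))"
    using assms R_pos by (subst suminf_mult) (auto intro!: summable_geometric simp: suminf_geometric)
  finally show ?thesis by (simp add: h_def)
qed

lemma norm_\<kappa>'_le:
  assumes "norm c \<le> r"
  shows "norm (\<kappa>' n c v) \<le> \<sigma>\<^sup>2 * norm v * (real (Suc n) * (R * r) ^ n)"
proof -
  have "(R * norm c) ^ n \<le> (R * r) ^ n" using assms R_pos by (intro power_mono mult_left_mono) auto
  then show ?thesis
    by (intro order_trans[OF norm_\<kappa>'] mult_left_mono mult_nonneg_nonneg) auto
qed

lemma deriv_sums: "0 \<le> q \<Longrightarrow> q < 1 \<Longrightarrow> (\<lambda>n. real (Suc n) * q ^ n) sums (1 / (1 - q)\<^sup>2)"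
  using geometric_deriv_sums[of q] by simp

lemma summable_\<kappa>':
  assumes "R * norm c < 1"
  shows "summable (\<lambda>n. \<kappa>' n c v)"
  by (rule summable_comparison_test'[where N = 0
        and g = "\<lambda>n. \<sigma>\<^sup>2 * norm v * (real (Suc n) * (R * norm c) ^ n)"])
    (use R_pos norm_\<kappa>' assms deriv_sums[of "R * norm c"] in \<open>auto intro!: summable_mult simp: sums_iff\<close>)

lemma norm_h':
  assumes "norm c \<le> r" "R * r < 1"
  shows "norm (h' c v) \<le> \<sigma>\<^sup>2 / (1 - R * r)\<^sup>2 * norm v"
proof -
  have r: "0 \<le> R * r" using assms(1) R_pos norm_ge_zero[of c] by (simp del: norm_ge_zero)
  note s = deriv_sums[OF r assms(2)]
  have "norm (h' c v) \<le> (\<Sum>n. \<sigma>\<^sup>2 * norm v * (real (Suc n) * (R * r) ^ n))"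
    unfolding h'_def
    by (rule norm_suminf_le[OF norm_\<kappa>'_le[OF assms(1)]]) (use s in \<open>intro summable_mult, simp add: sums_iff\<close>)
  also have "\<dots> = \<sigma>\<^sup>2 * norm v * (1 / (1 - R * r)\<^sup>2)"
    using s by (subst suminf_mult) (simp_all add: sums_iff)
  finally show ?thesis by simp
qed

text \<open>On the ball whose radius is midway between \<open>norm c\<close> and
  \<open>1 / R\<close> the derivative series has a summable majorant independent of the point, which
  justifies differentiation term by term.\<close>

lemma h_has_derivative:
  assumes c: "norm c < 1 / R"
  shows "(h has_derivative h' c) (at c)"
proof -
  define r where "r = (norm c + 1 / R) / 2"
  have r: "norm c < r" "r < 1 / R" using c by (simp_all add: r_def)
  have Rr: "0 \<le> R * r" "R * r < 1"
    using r R_pos norm_ge_zero[of c] by (auto simp: divide_simps mult.commute simp del: norm_ge_zero intro!: mult_nonneg_nonneg)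
  note s = deriv_sums[OF Rr]
  have less: "R * norm x < 1" if "x \<in> ball 0 r" for x
  proof -
    have "R * norm x \<le> R * r" using that R_pos by (intro mult_left_mono) auto
    then show ?thesis using Rr by linarith
  qed
  have "\<exists>g. \<forall>x\<in>ball 0 r. (\<lambda>n. \<kappa> n x) sums (g x) \<and> (g has_derivative h' x) (at x within ball 0 r)"
  proof (rule has_derivative_series)
    show "convex (ball (0::'b) r)" by simp
    show "(\<kappa> n has_derivative \<kappa>' n x) (at x within ball 0 r)" for n x
      using \<kappa>_has_derivative has_derivative_at_withinI by blast
    show "c \<in> ball 0 r" using r by simp
    then show "(\<lambda>n. \<kappa> n c) sums (\<Sum>n. \<kappa> n c)" using less summable_\<kappa> summable_sums by blast
    fix e :: real assume e: "e > 0"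
    let ?t = "\<lambda>n. real (Suc n) * (R * r) ^ n"
    have "(\<lambda>n. \<Sum>i<n. ?t i) \<longlonglongrightarrow> suminf ?t"
      by (rule summable_LIMSEQ[OF sums_summable[OF s]])
    then have "(\<lambda>n. \<sigma>\<^sup>2 * (suminf ?t - (\<Sum>i<n. ?t i))) \<longlonglongrightarrow> \<sigma>\<^sup>2 * (suminf ?t - suminf ?t)"
      by (intro tendsto_intros)
    then have "\<forall>\<^sub>F n in sequentially. \<sigma>\<^sup>2 * (suminf ?t - (\<Sum>i<n. ?t i)) < e"
      using e by (auto dest!: order_tendstoD(2)[of _ _ _ e])
    then show "\<forall>\<^sub>F n in sequentially. \<forall>x\<in>ball 0 r. \<forall>v. norm ((\<Sum>i<n. \<kappa>' i x v) - h' x v) \<le> e * norm v"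
    proof eventually_elim
      case (elim n)
      show ?case
      proof (intro ballI allI)
        fix x v assume x: "x \<in> ball (0::'b) r"
        have st: "summable ?t" using s by (simp add: sums_iff)
        have "h' x v - (\<Sum>i<n. \<kappa>' i x v) = (\<Sum>i. \<kappa>' (i + n) x v)"
          unfolding h'_def using suminf_minus_initial_segment[OF summable_\<kappa>'[OF less[OF x]]] by simp
        also have "norm \<dots> \<le> (\<Sum>i. \<sigma>\<^sup>2 * norm v * ?t (i + n))"
          by (rule norm_suminf_le[OF norm_\<kappa>'_le])
            (use x summable_ignore_initial_segment[OF st, of n] in \<open>auto intro!: summable_mult\<close>)
        also have "\<dots> = \<sigma>\<^sup>2 * norm v * (suminf ?t - (\<Sum>i<n. ?t i))"
          using suminf_minus_initial_segment[OF st, of n] summable_ignore_initial_segment[OF st, of n]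
          by (simp only: suminf_mult)
        also have "\<dots> = norm v * (\<sigma>\<^sup>2 * (suminf ?t - (\<Sum>i<n. ?t i)))" by simp
        also have "\<dots> \<le> norm v * e" using elim by (intro mult_left_mono) auto
        finally show "norm ((\<Sum>i<n. \<kappa>' i x v) - h' x v) \<le> e * norm v"
          by (simp add: norm_minus_commute mult.commute)
      qed
    qed
  qed
  then obtain g where g: "\<And>x. x \<in> ball 0 r \<Longrightarrow> (\<lambda>n. \<kappa> n x) sums (g x)"
    "\<And>x. x \<in> ball 0 r \<Longrightarrow> (g has_derivative h' x) (at x within ball 0 r)" by blast
  have "(g has_derivative h' c) (at c)"
    using g(2)[of c] r at_within_open[of c "ball 0 r"] by simp
  then have "((\<lambda>x. E a + g x) has_derivative h' c) (at c)"
    using has_derivative_add[OF has_derivative_const] by fastforce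
  moreover have "E a + g x = h x" if "x \<in> ball 0 r" for x
    using g(1)[OF that] by (simp add: h_def sums_iff)
  ultimately show ?thesis
    using has_derivative_transform_within_open[of "\<lambda>x. E a + g x" "h' c" c UNIV "ball 0 r" h] r by simp
qed

lemma h'_scaleC:
  assumes "norm c < 1 / R"
  shows "h' c (z *\<^sub>C v) = z *\<^sub>C h' c v"
proof -
  have "R * norm c < 1" using assms R_pos by (simp add: divide_simps mult.commute)
  from summable_\<kappa>'[OF this] show ?thesis unfolding h'_def \<kappa>'_scaleC
    using bounded_linear.suminf[OF bounded_linear_scaleC] by metis
qed

lemma complex_diff_h: "norm c < 1 / R \<Longrightarrow> complex_diff h c"
  unfolding complex_diff_def using h_has_derivative h'_scaleC by blast

lemma h_lipschitz:
  assumes "norm x \<le> r" "norm y \<le> r" "R * r < 1"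
  shows "norm (h x - h y) \<le> \<sigma>\<^sup>2 / (1 - R * r)\<^sup>2 * norm (x - y)"
proof (rule differentiable_bound[of "cball 0 r"])
  fix z assume z: "z \<in> cball (0::'b) r"
  have "norm z < 1 / R" using z assms(3) R_pos by (auto simp: pos_less_divide_eq mult.commute intro: le_less_trans)
      (smt (verit) mult_left_mono)
  then have d: "(h has_derivative h' z) (at z)" by (rule h_has_derivative)
  then show "(h has_derivative h' z) (at z within cball 0 r)" by (rule has_derivative_at_withinI)
  show "onorm (h' z) \<le> \<sigma>\<^sup>2 / (1 - R * r)\<^sup>2"
    by (rule onorm_bound) (use z norm_h'[OF _ assms(3)] in auto)
qed (use assms in auto)

end

text \<open>For small c this is the sum of the moments \<open>E (a c a ... c a)\<close> with equal
  letters. It therefore depends only on the distribution, which allows a change of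
  realization.\<close>

definition moment_gen :: "('b::cstar_algebra \<Rightarrow> 'a::cstar_algebra) \<Rightarrow> ('a \<Rightarrow> 'b) \<Rightarrow> 'a \<Rightarrow> 'b \<Rightarrow> 'b" where
  "moment_gen \<iota> E a c = E (inv_elem (1 - a * \<iota> c) * a)"

context op_space
begin

lemma norm_mult_\<iota>: "norm (a * \<iota> c) \<le> norm a * norm c"
  using norm_mult_ineq[of a "\<iota> c"] by (simp add: norm_\<iota>)

lemma E_inv:
  assumes "invertible_elem (1 - a * \<iota> c)"
  shows "E (inv_elem (1 - a * \<iota> c)) = 1 + moment_gen \<iota> E a c * c"
proof -
  let ?i = "inv_elem (1 - a * \<iota> c)"
  have "?i * (1 - a * \<iota> c) = 1" by (rule inv_elem_left[OF assms])
  then have "?i = 1 + ?i * a * \<iota> c" by (simp add: algebra_simps)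
  then have "E ?i = E 1 + E (?i * a * \<iota> c)" using E_simps(1) by metis
  then show ?thesis by (simp add: E_one E_right moment_gen_def)
qed

lemma moment_gen_sums:
  assumes "norm a * norm c < 1"
  shows "(\<lambda>n. E (alt_word \<iota> a (replicate n c))) sums moment_gen \<iota> E a c"
proof -
  let ?x = "a * \<iota> c"
  have nx: "norm ?x < 1" using norm_mult_\<iota>[of a c] assms by linarith
  from geometric_sums_inverse[OF nx] have "(\<lambda>n. ?x ^ n) sums inv_elem (1 - ?x)" .
  then have "(\<lambda>n. E (?x ^ n * a)) sums E (inv_elem (1 - ?x) * a)"
    using bounded_clinear_E unfolding bounded_clinear_def by (intro bounded_linear.sums[of E] sums_mult2) auto
  moreover have "?x ^ n * a = alt_word \<iota> a (replicate n c)" for n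
    by (induction n) (simp_all add: mult.assoc)
  ultimately show ?thesis by (simp add: moment_gen_def)
qed

end

context op_var
begin

text \<open>The sum S of all \<open>V c n\<close> has mean zero and satisfies (1 - a c) S = a -
  h(c); inverting and applying \<open>E\<close> gives the relation. Convergence in norm is needed
  here, and the factor 2 is the norm bound for \<open>center\<close>.\<close>

lemma moment_gen_h:
  assumes c: "2 * norm a * norm c < 1"  and Rc: "R * norm c < 1"
  shows "moment_gen \<iota> E a c = h c + moment_gen \<iota> E a c * c * h c"
proof -
  define q where "q = 2 * norm a * norm c"
  have nac: "norm (a * \<iota> c) < 1" 
    using norm_mult_\<iota>[of a c] c mult_nonneg_nonneg[OF norm_ge_zero[of a] norm_ge_zero[of c]]
    by (simp add: mult.assoc)
  then have inv: "invertible_elem (1 - a * \<iota> c)" by (rule invertible_one_minus)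
  have "norm (V c n) \<le> q ^ n * (2 * norm a)" for n
  proof (induction n)
    case 0
    then show ?case using norm_center[of a] by simp
  next
    case (Suc n)
    have "norm (V c (Suc n)) \<le> 2 * norm (a * \<iota> c * V c n)" using norm_center by simp
    also have "\<dots> \<le> 2 * (norm a * norm c * (q ^ n * (2 * norm a)))"
      using Suc by (intro mult_left_mono norm_mult_le) (auto simp: norm_\<iota>)
    finally show ?case by (simp add: q_def algebra_simps)
  qed
  then have sV: "summable (V c)"
    by (rule summable_comparison_test'[where N = 0 and g = "\<lambda>n. q ^ n * (2 * norm a)", rotated])
      (use c in \<open>auto simp: q_def intro!: summable_mult2 summable_geometric\<close>)
  define S where "S = (\<Sum>n. V c n)"
  have bE: "bounded_linear E" and bc: "bounded_linear center"
    using bounded_clinear_E bounded_clinear_center unfolding bounded_clinear_def by auto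
  have ES: "E S = 0" unfolding S_def
    using bounded_linear.suminf[OF bE sV] by (simp add: E_V)
  have sacV: "summable (\<lambda>n. a * \<iota> c * V c n)" by (rule summable_mult[OF sV])
  have acS: "(\<Sum>n. a * \<iota> c * V c n) = a * \<iota> c * S" unfolding S_def by (rule suminf_mult[OF sV])
  have "S = center a + (\<Sum>n. V c (Suc n))" unfolding S_def using suminf_split_head[OF sV] by simp
  also have "(\<Sum>n. V c (Suc n)) = center (a * \<iota> c * S)"
    using bounded_linear.suminf[OF bc sacV] by (simp add: acS)
  finally have S: "S = center a + center (a * \<iota> c * S)" .
  have "h c = E a + E (a * \<iota> c * S)"
    unfolding h_def \<kappa>_def using bounded_linear.suminf[OF bE sacV] by (simp add: acS)
  then have eq: "(1 - a * \<iota> c) * S = a - \<iota> (h c)"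
    using S by (simp add: center_def \<iota>_simps left_diff_distrib algebra_simps)
  let ?i = "inv_elem (1 - a * \<iota> c)"
  have "S = ?i * ((1 - a * \<iota> c) * S)" using inv_elem_left[OF inv] by (simp flip: mult.assoc)
  then have "S = ?i * a - ?i * \<iota> (h c)" unfolding eq by (simp add: right_diff_distrib)
  then have "0 = moment_gen \<iota> E a c - E ?i * h c"
    using ES by (simp add: E_diff E_right moment_gen_def)
  then show ?thesis using E_inv[OF inv] by (simp add: algebra_simps)
qed

end


section \<open>Half planes and analytic extension\<close>

lemma strictly_positive_near:
  assumes "norm_positive (x - of_real e)" "star y = y" "norm (y - x) < e"
  shows "strictly_positive y"
proof -
  let ?d = "norm (y - x)"
  have sx: "star x = x"
    using norm_positive_star[OF assms(1)] by (simp add: star_diff star_of_real)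
  have "norm_positive (y - x + of_real ?d)"
    unfolding norm_positive_def
    by (intro conjI exI[of _ ?d]) (auto simp: star_add star_diff star_of_real sx assms(2) norm_minus_commute)
  from norm_positive_add[OF assms(1) this]
  have "norm_positive (y - of_real (e - ?d))" by (simp add: algebra_simps)
  then show ?thesis unfolding strictly_positive_iff using assms(3) by (intro exI[of _ "e - ?d"]) auto
qed

lemma strictly_positive_add:
  assumes "strictly_positive x" "norm_positive y"
  shows "strictly_positive (x + y)"
proof -
  obtain e where e: "e > 0" "norm_positive (x - of_real e)" using assms(1) strictly_positive_iff by blast
  have "norm_positive (x + y - of_real e)" using norm_positive_add[OF e(2) assms(2)] by (simp add: algebra_simps)
  then show ?thesis using e(1) strictly_positive_iff by blast
qed

lemma strictly_positive_scaleR: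
  assumes "strictly_positive x" "0 < r"
  shows "strictly_positive (r *\<^sub>R x)"
proof -
  obtain e where e: "e > 0" "norm_positive (x - of_real e)" using assms(1) strictly_positive_iff by blast
  have "norm_positive (r *\<^sub>R x - of_real (r * e))"
    using norm_positive_scaleR[OF e(2), of r] assms(2) by (simp add: scaleR_diff_right of_real_def)
  then show ?thesis using e(1) assms(2) strictly_positive_iff by (metis mult_pos_pos)
qed

lemma strictly_positive_convex: "convex {x. strictly_positive x}"
proof (rule convexI; clarsimp)
  fix x y :: 'a and u v :: real
  assume *: "strictly_positive x" "strictly_positive y" "0 \<le> u" "0 \<le> v" "u + v = 1"
  then have p: "norm_positive x" "norm_positive y"
    by (auto simp: strictly_positive_def cstar_positive_iff)
  show "strictly_positive (u *\<^sub>R x + v *\<^sub>R y)"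
  proof (cases "u = 0")
    case False
    then show ?thesis using * p by (intro strictly_positive_add strictly_positive_scaleR norm_positive_scaleR) auto
  qed (use * in auto)
qed

lemma strictly_positive_conj:
  assumes "strictly_positive x" "invertible_elem t"
  shows "strictly_positive (star t * x * t)"
proof -
  have "invertible_elem (star t)"
    by (rule invertible_elemI[where y = "star (inv_elem t)"])
      (simp_all add: inv_elem_left inv_elem_right assms star_one flip: star_mult)
  then show ?thesis using assms norm_positive_conj
    by (auto simp: strictly_positive_def cstar_positive_iff intro!: invertible_elem_mult)
qed

section \<open>Imaginary parts and half planes\<close>

lemma Im_part_add: "Im_part (x + y) = Im_part x + Im_part y"
  by (simp add: Im_part_def star_add scaleC_add_right[symmetric] add_diff_add)

lemma Im_part_scaleR: "Im_part (r *\<^sub>R x) = r *\<^sub>R Im_part x"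
  by (simp add: Im_part_def star_scaleR flip: scaleR_diff_right)
    (simp add: scaleC_scaleC mult.commute flip: scaleC_of_real)

lemma Im_part_star: "star (Im_part x) = Im_part x"
  by (simp add: Im_part_def star_scaleC star_diff star_star scaleC_diff_right scaleC_minus_left)

lemma norm_Im_part: "norm (Im_part x) \<le> norm x"
proof -
  have "norm (x - star x) \<le> norm x + norm (star x)" by (rule norm_triangle_ineq4)
  then show ?thesis by (simp add: Im_part_def norm_scaleC norm_star norm_divide norm_mult)
qed

lemma Im_part_decomp: "x = (1/2) *\<^sub>R (x + star x) + \<i> *\<^sub>C Im_part x"
proof -
  have "\<i> *\<^sub>C Im_part x = (1/2) *\<^sub>R (x - star x)"
    by (simp add: Im_part_def scaleC_scaleC flip: scaleC_of_real)
  then show ?thesis by (simp add: scaleR_add_right scaleR_diff_right flip: scaleR_add_left)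
qed

lemma invertible_commuting_factor:
  assumes "u * v = w" "v * u = w" "invertible_elem w"
  shows "invertible_elem u"
proof -
  obtain z where z: "w * z = 1" "z * w = 1" using assms(3) unfolding invertible_elem_def by blast
  have r: "u * (v * z) = 1" using assms(1) z(1) by (simp flip: mult.assoc)
  have l: "(z * v) * u = 1" using assms(2) z(2) by (simp add: mult.assoc)
  have "v * z = z * v" by (metis l r mult.assoc mult_1_left mult_1_right)
  then show ?thesis using r l by (intro invertible_elemI[where y = "v * z"]) auto
qed

text \<open>Write x = p + i q with q = z z. Then x = z (y + i) z with y = k p k self-adjoint, k the
  inverse of z, and (y + i)(y - i) = 1 + y y is invertible.\<close>

lemma invertible_Im_part_pos:
  assumes "strictly_positive (Im_part x)"
  shows "invertible_elem x"
proof -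
  let ?q = "Im_part x" and ?p = "(1/2) *\<^sub>R (x + star x)"
  have sp: "star ?p = ?p" by (simp add: star_scaleR star_add star_star add.commute)
  have q: "norm_positive ?q" "invertible_elem ?q"
    using assms by (auto simp: strictly_positive_def cstar_positive_iff)
  obtain z where z: "star z = z" "z * z = ?q" using norm_positive_sqrt[OF q(1)] by blast
  have iz: "invertible_elem z" using invertible_commuting_factor[OF z(2) z(2) q(2)] .
  define k where "k = inv_elem z"
  have k: "k * z = 1" "z * k = 1" using iz by (simp_all add: k_def inv_elem_left inv_elem_right)
  have sk: "star k = k"
    by (metis k star_mult star_one z(1) mult.assoc mult_1_left mult_1_right)
  define y where "y = k * ?p * k"
  have sy: "star y = y" by (simp only: y_def star_mult sk sp mult.assoc)
  have "(y + \<i> *\<^sub>C 1) * (y - \<i> *\<^sub>C 1) = of_real 1 + y * y" "(y - \<i> *\<^sub>C 1) * (y + \<i> *\<^sub>C 1) = of_real 1 + y * y"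
    by (simp_all add: algebra_simps scaleC_mult_left scaleC_mult_right scaleC_scaleC scaleC_minus_one
        scaleC_add_right scaleC_diff_right)
  then have iy: "invertible_elem (y + \<i> *\<^sub>C 1)"
    by (rule invertible_commuting_factor)
      (rule invertible_norm_positive_add[OF norm_positive_square[OF sy]], simp)
  have "z * (y + \<i> *\<^sub>C 1) * z = (z * k) * ?p * (k * z) + \<i> *\<^sub>C (z * z)"
    unfolding y_def by (simp add: algebra_simps scaleC_mult_left scaleC_mult_right)
  then have "z * (y + \<i> *\<^sub>C 1) * z = x" using Im_part_decomp[of x] by (simp add: k z(2))
  then show ?thesis using invertible_elem_mult[OF invertible_elem_mult[OF iz iy] iz] by simp
qed

text \<open>The values s = 1 and s = -1 give the upper and the lower half plane, so both parts of
  \<open>half_planes\<close> share one argument.\<close>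

definition signed_half_plane :: "real \<Rightarrow> 'a::cstar_algebra set" where
  "signed_half_plane s = {b. strictly_positive (s *\<^sub>R Im_part b)}"

lemma half_planes_iff: "b \<in> half_planes \<longleftrightarrow> b \<in> signed_half_plane 1 \<or> b \<in> signed_half_plane (- 1)"
  by (simp add: half_planes_def signed_half_plane_def)

lemma signed_half_plane_invertible:
  assumes "b \<in> signed_half_plane s"
  shows "invertible_elem b"
proof -
  have i: "invertible_elem (s *\<^sub>R b)"
    using assms by (intro invertible_Im_part_pos) (simp add: signed_half_plane_def Im_part_scaleR)
  then have s: "s \<noteq> 0" by (auto simp: invertible_elem_def)
  show ?thesis
    by (rule invertible_elemI[where y = "s *\<^sub>R inv_elem (s *\<^sub>R b)"])
      (use inv_elem_left[OF i] inv_elem_right[OF i] in simp_all)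
qed

text \<open>Conjugating b - \<open>star b\<close> by i = \<open>inv_elem b\<close> gives
  \<open>star i\<close> - i, so inversion changes the sign of the imaginary part.\<close>

lemma signed_half_plane_inverse:
  assumes "b \<in> signed_half_plane s"
  shows "inv_elem b \<in> signed_half_plane (- s)"
proof -
  have ib: "invertible_elem b" by (rule signed_half_plane_invertible[OF assms])
  let ?i = "inv_elem b"
  have bi: "b * ?i = 1" by (rule inv_elem_right[OF ib])
  then have sbi: "star ?i * star b = 1" by (metis star_mult star_one)
  have "star ?i * (b - star b) * ?i = star ?i * (b * ?i) - (star ?i * star b) * ?i"
    by (simp only: left_diff_distrib right_diff_distrib mult.assoc)
  then have "star ?i * (b - star b) * ?i = - (?i - star ?i)" by (simp add: bi sbi)
  then have "star ?i * Im_part b * ?i = - Im_part ?i"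
    by (simp add: Im_part_def scaleC_mult_left scaleC_mult_right flip: scaleC_minus_right)
  then have "star ?i * (s *\<^sub>R Im_part b) * ?i = (- s) *\<^sub>R Im_part ?i" by simp
  then show ?thesis
    using strictly_positive_conj[of "s *\<^sub>R Im_part b" ?i] assms invertible_inv_elem[OF ib]
    by (simp add: signed_half_plane_def)
qed

lemma signed_half_plane_near:
  assumes "b \<in> signed_half_plane s" "\<bar>s\<bar> = 1"
  obtains e where "e > 0" "\<And>b'. norm (b' - b) < e \<Longrightarrow> b' \<in> signed_half_plane s"
proof -
  obtain e where e: "e > 0" "norm_positive (s *\<^sub>R Im_part b - of_real e)"
    using assms(1) unfolding signed_half_plane_def strictly_positive_iff by blast
  have "b' \<in> signed_half_plane s" if "norm (b' - b) < e" for b'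
  proof -
    have "s *\<^sub>R Im_part b' - s *\<^sub>R Im_part b = s *\<^sub>R Im_part (b' - b)"
      using Im_part_add[of "b' - b" b] by (simp add: scaleR_add_right)
    then have "norm (s *\<^sub>R Im_part b' - s *\<^sub>R Im_part b) < e"
      using norm_Im_part[of "b' - b"] that assms(2) by simp
    then show ?thesis unfolding signed_half_plane_def
      using strictly_positive_near[OF e(2), of "s *\<^sub>R Im_part b'"] by (simp add: star_scaleR Im_part_star)
  qed
  then show ?thesis using that e(1) by blast
qed

lemma convex_signed_half_plane: "convex (signed_half_plane s)"
proof (rule convexI)
  fix x y :: 'a and u v :: real
  assume *: "x \<in> signed_half_plane s" "y \<in> signed_half_plane s" "0 \<le> u" "0 \<le> v" "u + v = 1"
  have "s *\<^sub>R Im_part (u *\<^sub>R x + v *\<^sub>R y) = u *\<^sub>R (s *\<^sub>R Im_part x) + v *\<^sub>R (s *\<^sub>R Im_part y)"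
    by (simp add: Im_part_add Im_part_scaleR scaleR_add_right mult.commute)
  then show "u *\<^sub>R x + v *\<^sub>R y \<in> signed_half_plane s"
    using convexD[OF strictly_positive_convex, of "s *\<^sub>R Im_part x" "s *\<^sub>R Im_part y" u v] *
    by (simp add: signed_half_plane_def)
qed

lemma open_signed_half_plane:
  assumes "\<bar>s\<bar> = 1"
  shows "open (signed_half_plane s)"
  unfolding open_dist
proof
  fix b :: 'a assume "b \<in> signed_half_plane s"
  from signed_half_plane_near[OF this assms]
  show "\<exists>e>0. \<forall>y. dist y b < e \<longrightarrow> y \<in> signed_half_plane s" by (metis dist_norm)
qed

text \<open>Restrict f to the complex line through b and the point i r / 2 of the upper half plane.
  The parameters sent into the ball form a convex set, and f vanishes along the line near that
  point.\<close>

lemma vanish_off_half_planes: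
  fixes f :: "'b::cstar_algebra \<Rightarrow> 'c::cstar_algebra"
  assumes f: "\<And>x. norm x < r \<Longrightarrow> complex_diff f x" and z: "\<And>x. norm x < r \<Longrightarrow> x \<in> half_planes \<Longrightarrow> f x = 0"
    and b: "norm b < r"
  shows "f b = 0"
proof -
  have r: "r > 0" using b norm_ge_zero[of b] by linarith
  define p where "p z = (\<i> * complex_of_real (r / 2)) *\<^sub>C 1 + z *\<^sub>C (b - (\<i> * complex_of_real (r / 2)) *\<^sub>C 1)" for z
  have bl: "bounded_linear (\<lambda>z. z *\<^sub>C (b - (\<i> * complex_of_real (r / 2)) *\<^sub>C 1))"
    by (rule bounded_linear_scaleC_left)
  have cp: "complex_diff p z" for z unfolding p_def
    by (intro complex_diff_add complex_diff_const complex_diff_bounded_clinear[OF bounded_clinear_scaleC_left complex_diff_ident])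
  have contp: "continuous_on UNIV p"
    using complex_diff_continuous[OF cp] by (simp add: continuous_on_eq_continuous_at)
  define S where "S = p -` ball 0 r"
  have oS: "open S" unfolding S_def by (rule open_vimage[OF open_ball contp])
  have "convex S"
  proof (rule convexI)
    fix x y and u v :: real
    assume *: "x \<in> S" "y \<in> S" "0 \<le> u" "0 \<le> v" "u + v = 1"
    have "u *\<^sub>R ((\<i> * complex_of_real (r / 2)) *\<^sub>C (1::'b)) + v *\<^sub>R ((\<i> * complex_of_real (r / 2)) *\<^sub>C 1)
        = (\<i> * complex_of_real (r / 2)) *\<^sub>C 1"
      using *(5) by (simp flip: scaleR_add_left)
    then have "p (u *\<^sub>R x + v *\<^sub>R y) = u *\<^sub>R p x + v *\<^sub>R p y"
      using linear_add[OF bounded_linear.linear[OF bl]] linear_scale[OF bounded_linear.linear[OF bl]]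
      unfolding p_def scaleR_add_right by (simp add: add_ac)
    then show "u *\<^sub>R x + v *\<^sub>R y \<in> S"
      using convexD[OF convex_ball, of "p x" 0 r "p y" u v] * by (simp add: S_def)
  qed
  have p0: "p 0 = (\<i> * complex_of_real (r / 2)) *\<^sub>C 1" by (simp add: p_def scaleC_zero_left)
  have n0: "norm (p 0) = r / 2" using r by (simp add: p0 norm_scaleC norm_mult)
  have p1: "p 1 = b" by (simp add: p_def scaleC_one)
  have "star (p 0) = - p 0" by (simp add: p0 star_scaleC star_one scaleC_minus_left)
  moreover have "p 0 + p 0 = (2::complex) *\<^sub>C p 0" by (metis one_add_one scaleC_add_left scaleC_one)
  ultimately have "Im_part (p 0) = complex_of_real (r / 2) *\<^sub>C 1"
    by (simp add: Im_part_def) (simp add: p0 scaleC_scaleC)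
  then have "Im_part (p 0) = of_real (r / 2)" unfolding scaleC_of_real by (simp add: of_real_def)
  moreover have "strictly_positive (of_real (r / 2) :: 'b)"
    unfolding strictly_positive_iff using r norm_positive_of_real[of 0] by (intro exI[of _ "r / 2"]) auto
  ultimately have h0: "p 0 \<in> signed_half_plane 1" by (simp add: signed_half_plane_def)
  define U where "U = p -` signed_half_plane 1"
  have oU: "open U" unfolding U_def by (rule open_vimage[OF open_signed_half_plane contp]) simp
  have "f (p 1) = 0"
  proof (rule identity_theorem[where f = "\<lambda>z. f (p z)" and w = 1 and S = S and U = U and p = 0])
    show "complex_diff (\<lambda>z. f (p z)) z" if "z \<in> S" for z
      using that by (intro complex_diff_compose[OF cp f]) (simp add: S_def)
    show "connected S" using \<open>convex S\<close> by (rule convex_connected)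
    show "0 \<in> U" using h0 by (simp add: U_def)
    show "0 \<in> S" using n0 r by (simp add: S_def)
    show "1 \<in> S" using b by (simp add: S_def p1)
    show "f (p z) = 0" if "z \<in> U" "z \<in> S" for z
      using that by (intro z) (auto simp: S_def U_def half_planes_iff)
  qed (fact oS oU)+
  then show ?thesis by (simp add: p1)
qed

text \<open>Two extensions may live on balls of different radii; on the smaller ball their
  difference vanishes on the half planes, hence at b.\<close>

lemma H_transform_eq:
  assumes h: "H_extension \<iota> E a r h" and b: "norm b < r"
  shows "b \<in> H_domain \<iota> E a" "H_transform \<iota> E a b = h b"
proof -
  show dom: "b \<in> H_domain \<iota> E a" using assms unfolding H_domain_def by blast
  have "v = h b" if "norm b < r'" "H_extension \<iota> E a r' k" "v = k b" for v r' k
  proof -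
    have "k b - h b = 0"
    proof (rule vanish_off_half_planes[where f = "\<lambda>x. k x - h x" and r = "min r r'"])
      show "complex_diff (\<lambda>x. k x - h x) x" if "norm x < min r r'" for x
        using that h \<open>H_extension \<iota> E a r' k\<close>
        by (intro complex_diff_diff) (auto simp: H_extension_def analytic_map_on_iff)
      show "k x - h x = 0" if "norm x < min r r'" "x \<in> half_planes" for x
        using that h \<open>H_extension \<iota> E a r' k\<close> by (auto simp: H_extension_def)
    qed (use b that in auto)
    then show ?thesis using that by simp
  qed
  then have "(THE v. \<exists>r h. norm b < r \<and> H_extension \<iota> E a r h \<and> v = h b) = h b"
    using assms by (intro the_equality) blast+
  then show "H_transform \<iota> E a b = h b" using dom by (simp add: H_transform_def)
qed

section \<open>Resolvents on half planes and a criterion for analytic extension\<close>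

context op_space
begin

lemma invertible_\<iota>: "invertible_elem x \<Longrightarrow> invertible_elem (\<iota> x)"
  by (rule invertible_elemI[where y = "\<iota> (inv_elem x)"])
    (simp_all add: inv_elem_left inv_elem_right \<iota>_simps(1) flip: \<iota>_simps(4))

lemma signed_half_plane_resolvent:
  assumes "star a = a" "b \<in> signed_half_plane s"
  shows "invertible_elem (\<iota> b - a)"
proof -
  have "strictly_positive (s *\<^sub>R Im_part b)" using assms(2) by (simp add: signed_half_plane_def)
  then obtain z where z: "star z = z" "z * z = s *\<^sub>R Im_part b" "invertible_elem (s *\<^sub>R Im_part b)"
    using norm_positive_sqrt unfolding strictly_positive_def cstar_positive_iff by blast
  have "norm_positive (\<iota> z * \<iota> z)"
    by (rule norm_positive_square) (simp add: z(1) flip: \<iota>_simps(5))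
  moreover have "invertible_elem (\<iota> (s *\<^sub>R Im_part b))"
    by (rule invertible_\<iota>[OF z(3)])
  moreover have "\<iota> z * \<iota> z = \<iota> (s *\<^sub>R Im_part b)" by (simp only: z(2) flip: \<iota>_simps(4))
  moreover have "Im_part (\<iota> b - a) = \<iota> (Im_part b)"
    by (simp add: Im_part_def star_diff assms(1) \<iota>_diff \<iota>_simps)
  ultimately have "strictly_positive (s *\<^sub>R Im_part (\<iota> b - a))"
    by (simp add: strictly_positive_def cstar_positive_iff \<iota>_scaleR)
  then show ?thesis using signed_half_plane_invertible[of "\<iota> b - a" s] by (simp add: signed_half_plane_def)
qed

lemma invertible_one_minus_half_plane:
  assumes "star a = a" "c \<in> signed_half_plane s"
  shows "invertible_elem (1 - a * \<iota> c)" "invertible_elem (\<iota> (inv_elem c) - a)"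
    "inv_elem (\<iota> (inv_elem c) - a) = \<iota> c * inv_elem (1 - a * \<iota> c)"
proof -
  have ic: "invertible_elem c" by (rule signed_half_plane_invertible[OF assms(2)])
  have i\<iota>: "invertible_elem (\<iota> c)" by (rule invertible_\<iota>[OF ic])
  have cc: "\<iota> (inv_elem c) * \<iota> c = 1" "\<iota> c * \<iota> (inv_elem c) = 1"
    by (simp_all add: inv_elem_left[OF ic] inv_elem_right[OF ic] \<iota>_simps(1) flip: \<iota>_simps(4))
  show r: "invertible_elem (\<iota> (inv_elem c) - a)"
    by (rule signed_half_plane_resolvent[OF assms(1) signed_half_plane_inverse[OF assms(2)]])
  have eq: "(\<iota> (inv_elem c) - a) * \<iota> c = 1 - a * \<iota> c" by (simp add: left_diff_distrib cc)
  show i: "invertible_elem (1 - a * \<iota> c)" using invertible_elem_mult[OF r i\<iota>] eq by simp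
  show "inv_elem (\<iota> (inv_elem c) - a) = \<iota> c * inv_elem (1 - a * \<iota> c)"
  proof (rule inv_elem_eqI)
    show "(\<iota> (inv_elem c) - a) * (\<iota> c * inv_elem (1 - a * \<iota> c)) = 1"
      using inv_elem_right[OF i] by (simp flip: mult.assoc eq)
    have "\<iota> c * (inv_elem (1 - a * \<iota> c) * ((\<iota> (inv_elem c) - a) * \<iota> c)) * \<iota> (inv_elem c) = 1"
      unfolding eq using inv_elem_left[OF i] cc by simp
    then show "\<iota> c * inv_elem (1 - a * \<iota> c) * (\<iota> (inv_elem c) - a) = 1"
      by (metis cc(2) mult.assoc mult_1_right)
  qed
qed

text \<open>The moment relation is given only near 0. On the convex set of scalars z with z c in the
  half plane and in the ball, both factors are analytic in z, so the relation spreads to z = 1. Both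
  orders are treated because inverses are two-sided.\<close>

lemma resolvent_inverse:
  assumes sa: "star a = a" and r: "r > 0" and h: "\<And>c. norm c < r \<Longrightarrow> complex_diff h c"
    and small: "\<And>c. norm c < d \<Longrightarrow> c \<in> half_planes \<Longrightarrow> moment_gen \<iota> E a c = h c + moment_gen \<iota> E a c * c * h c"
    and d: "d > 0" and c: "norm c < r" "c \<in> signed_half_plane s" and s: "\<bar>s\<bar> = 1"
  shows "E (inv_elem (1 - a * \<iota> c)) * (1 - h c * c) = 1" "(1 - h c * c) * E (inv_elem (1 - a * \<iota> c)) = 1"
proof -
  define W where "W c = E (inv_elem (1 - a * \<iota> c))" for c
  \<comment> \<open>Near 0 the element 1 - h(c) c is invertible, which upgrades the one-sided
    relation to a two-sided one.\<close>
  have "isCont (\<lambda>c. h c * c) 0"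
    by (intro continuous_intros complex_diff_continuous h) (simp add: r)
  then obtain e where e: "e > 0" "\<And>c. norm c < e \<Longrightarrow> norm (h c * c) < 1"
    using LIM_D[of "\<lambda>c. h c * c" 0 0 1] unfolding isCont_def by (auto, metis mult_zero_right norm_zero zero_less_one)
  have sm: "W c * (1 - h c * c) = 1 \<and> (1 - h c * c) * W c = 1"
    if nc: "norm c < min d e" and hp: "c \<in> signed_half_plane s" for c
  proof -
    let ?M = "moment_gen \<iota> E a c"
    have W: "W c = 1 + ?M * c"
      unfolding W_def by (rule E_inv[OF invertible_one_minus_half_plane(1)[OF sa hp]])
    have "?M = h c + ?M * c * h c"
      by (rule small) (use nc hp s in \<open>auto simp: half_planes_iff abs_if split: if_splits\<close>)
    note arg_cong[OF this, of "\<lambda>x. x * c"]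
    also have "(h c + ?M * c * h c) * c = h c * c + ?M * c * h c * c" by (simp only: ring_distribs)
    finally have rel: "?M * c = h c * c + ?M * c * h c * c" .
    have "W c * (1 - h c * c) = 1 + (?M * c - (h c * c + ?M * c * h c * c))"
      by (simp add: W algebra_simps)
    then have l: "W c * (1 - h c * c) = 1" using rel by simp
    have i: "invertible_elem (1 - h c * c)" using e(2) nc by (intro invertible_one_minus) auto
    have "W c = inv_elem (1 - h c * c)"
      using l inv_elem_right[OF i] by (metis mult.assoc mult_1_left mult_1_right)
    then show ?thesis using l inv_elem_right[OF i] by simp
  qed
  define S where "S = (\<lambda>z. z *\<^sub>C c) -` (signed_half_plane s \<inter> ball 0 r)"
  have cz: "complex_diff (\<lambda>z. z *\<^sub>C c) z" for z by (rule complex_diff_bounded_clinear[OF bounded_clinear_scaleC_left complex_diff_ident])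
  have contz: "continuous_on UNIV (\<lambda>z. z *\<^sub>C c)"
    using complex_diff_continuous[OF cz] by (simp add: continuous_on_eq_continuous_at)
  have oS: "open S" unfolding S_def
    by (intro open_vimage[OF _ contz] open_Int open_signed_half_plane[OF s] open_ball)
  have cS: "connected S" unfolding S_def
    by (intro convex_connected convex_linear_vimage bounded_linear.linear[OF bounded_linear_scaleC_left]
        convex_Int convex_signed_half_plane convex_ball)
  have cW: "complex_diff W x" if "x \<in> signed_half_plane s" for x
  proof -
    have "complex_diff (\<lambda>c. 1 - a * \<iota> c) x"
      by (intro complex_diff_diff complex_diff_const complex_diff_mult complex_diff_bounded_clinear[OF bounded_clinear_\<iota>] complex_diff_ident)
    then show ?thesis unfolding W_def
      by (intro complex_diff_bounded_clinear[OF bounded_clinear_E] complex_diff_compose[OF _ complex_diff_inv_elem]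
          invertible_one_minus_half_plane(1)[OF sa that])
  qed
  define U where "U = (\<lambda>z. z *\<^sub>C c) -` ball 0 (min d e)"
  have oU: "open U" unfolding U_def by (rule open_vimage[OF open_ball contz])
  define t where "t = min 1 (min d e / (2 * (norm c + 1)))"
  have "0 < min d e / (2 * (norm c + 1))"
    using d e by (intro divide_pos_pos mult_pos_pos add_nonneg_pos) auto
  then have t: "t > 0" "t \<le> 1" unfolding t_def by linarith+
  have "t * norm c \<le> min d e / (2 * (norm c + 1)) * norm c"
    by (intro mult_right_mono) (auto simp: t_def)
  moreover have "min d e / (2 * (norm c + 1)) * norm c = (min d e / 2) * (norm c / (norm c + 1))" by simp
  moreover have "norm c / (norm c + 1) \<le> 1" by (intro divide_le_eq_1[THEN iffD2] disjI1 conjI add_nonneg_pos) auto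
  then have "(min d e / 2) * (norm c / (norm c + 1)) \<le> (min d e / 2) * 1"
    using d e by (intro mult_left_mono) auto
  ultimately have "t * norm c < min d e" using d e by linarith
  then have tc: "norm (complex_of_real t *\<^sub>C c) < min d e" using t by (simp add: scaleC_of_real)
  have tU: "complex_of_real t \<in> U" using tc by (simp add: U_def)
  have tS: "complex_of_real t \<in> S"
  proof -
    have "t * norm c \<le> 1 * norm c" using t by (intro mult_right_mono) auto
    then have "norm (t *\<^sub>R c) < r" using t c(1) by simp
    moreover have "t *\<^sub>R c \<in> signed_half_plane s"
      using strictly_positive_scaleR[OF _ t(1), of "s *\<^sub>R Im_part c"] c(2)
      by (simp add: signed_half_plane_def Im_part_scaleR mult.commute)
    ultimately show ?thesis by (simp add: S_def scaleC_of_real)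
  qed
  have oneS: "1 \<in> S" using c by (simp add: S_def scaleC_one)
  have ch: "complex_diff (\<lambda>x. 1 - h x * x) x" if "norm x < r" for x
    by (intro complex_diff_diff complex_diff_const complex_diff_mult complex_diff_ident h that)
  have "W (1 *\<^sub>C c) * (1 - h (1 *\<^sub>C c) * (1 *\<^sub>C c)) - 1 = 0"
  proof (rule identity_theorem[where f = "\<lambda>z. W (z *\<^sub>C c) * (1 - h (z *\<^sub>C c) * (z *\<^sub>C c)) - 1" and w = 1 and S = S and U = U and p = "complex_of_real t"])
    show "complex_diff (\<lambda>z. W (z *\<^sub>C c) * (1 - h (z *\<^sub>C c) * (z *\<^sub>C c)) - 1) z" if "z \<in> S" for z
      using that by (intro complex_diff_compose[OF cz, where g = "\<lambda>x. W x * (1 - h x * x) - 1"]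
          complex_diff_diff[OF _ complex_diff_const] complex_diff_mult cW ch) (auto simp: S_def)
    show "W (z *\<^sub>C c) * (1 - h (z *\<^sub>C c) * (z *\<^sub>C c)) - 1 = 0" if "z \<in> U" "z \<in> S" for z
      using that sm[of "z *\<^sub>C c"] by (simp add: U_def S_def)
  qed (fact oS cS oU tU tS oneS)+
  then show "E (inv_elem (1 - a * \<iota> c)) * (1 - h c * c) = 1" by (simp add: W_def scaleC_one)
  have "(1 - h (1 *\<^sub>C c) * (1 *\<^sub>C c)) * W (1 *\<^sub>C c) - 1 = 0"
  proof (rule identity_theorem[where f = "\<lambda>z. (1 - h (z *\<^sub>C c) * (z *\<^sub>C c)) * W (z *\<^sub>C c) - 1" and w = 1 and S = S and U = U and p = "complex_of_real t"])
    show "complex_diff (\<lambda>z. (1 - h (z *\<^sub>C c) * (z *\<^sub>C c)) * W (z *\<^sub>C c) - 1) z" if "z \<in> S" for z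
      using that by (intro complex_diff_compose[OF cz, where g = "\<lambda>x. (1 - h x * x) * W x - 1"]
          complex_diff_diff[OF _ complex_diff_const] complex_diff_mult cW ch) (auto simp: S_def)
    show "(1 - h (z *\<^sub>C c) * (z *\<^sub>C c)) * W (z *\<^sub>C c) - 1 = 0" if "z \<in> U" "z \<in> S" for z
      using that sm[of "z *\<^sub>C c"] by (simp add: U_def S_def)
  qed (fact oS cS oU tU tS oneS)+
  then show "(1 - h c * c) * E (inv_elem (1 - a * \<iota> c)) = 1" by (simp add: W_def scaleC_one)
qed

text \<open>With W the expectation of the inverse of 1 - a c, G at the inverse of c is c W, whose
  inverse is \<open>inv_elem c - h c\<close>. The criterion serves \<mu>1 and \<mu>3 through
  \<open>h\<close>, and later \<mu>2 through the fixed point.\<close>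

lemma H_extensionI:
  assumes sa: "star a = a" and r: "r > 0" and h: "\<And>c. norm c < r \<Longrightarrow> complex_diff h c"
    and small: "\<And>c. norm c < d \<Longrightarrow> c \<in> half_planes \<Longrightarrow> moment_gen \<iota> E a c = h c + moment_gen \<iota> E a c * c * h c"
    and d: "d > 0"
  shows "H_extension \<iota> E a r h"
  unfolding H_extension_def
proof (intro conjI ballI)
  show "analytic_map_on h (ball 0 r)" using h by (simp add: analytic_map_on_iff)
  fix c :: 'b assume "c \<in> ball 0 r \<inter> half_planes"
  then obtain s where c: "norm c < r" "c \<in> signed_half_plane s" and s: "\<bar>s\<bar> = 1"
    by (force simp: half_planes_iff)
  let ?W = "E (inv_elem (1 - a * \<iota> c))"
  have W: "?W * (1 - h c * c) = 1" "(1 - h c * c) * ?W = 1"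
    using resolvent_inverse[OF sa r h small d c s] by blast+
  have ic: "invertible_elem c" by (rule signed_half_plane_invertible[OF c(2)])
  let ?b = "inv_elem c"
  have bc: "?b * c = 1" "c * ?b = 1" using inv_elem_left[OF ic] inv_elem_right[OF ic] by auto
  have G: "G_transform0 \<iota> E a ?b = c * ?W"
    unfolding G_transform0_def invertible_one_minus_half_plane(3)[OF sa c(2)] by (rule E_left)
  have eq: "1 - h c * c = (?b - h c) * c" by (simp add: left_diff_distrib bc)
  have "inv_elem (c * ?W) = ?b - h c"
  proof (rule inv_elem_eqI)
    have "c * ?W * (?b - h c) = c * (?W * (1 - h c * c)) * ?b"
      unfolding eq by (simp add: mult.assoc bc)
    then show "c * ?W * (?b - h c) = 1" by (simp add: W bc)
    show "(?b - h c) * (c * ?W) = 1" using W(2) unfolding eq by (simp add: mult.assoc)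
  qed
  then show "h c = H_transform0 \<iota> E a c"
    by (simp add: H_transform0_def h_transform0_def F_transform0_def G)
qed

end

context op_var
begin

lemma H_extension_h: "H_extension \<iota> E a (1 / R) h"
proof (rule H_extensionI[OF a_star])
  show "0 < 1 / R" using R_pos by simp
  show "0 < min (1 / (2 * (norm a + 1))) (1 / R)" using R_pos by (auto intro!: divide_pos_pos add_nonneg_pos)
  fix c :: 'b
  show "complex_diff h c" if "norm c < 1 / R" using that by (rule complex_diff_h)
  show "moment_gen \<iota> E a c = h c + moment_gen \<iota> E a c * c * h c"
    if "norm c < min (1 / (2 * (norm a + 1))) (1 / R)"
  proof (rule moment_gen_h)
    show "R * norm c < 1" using that R_pos by (simp add: pos_less_divide_eq mult.commute)
    have "norm c * (2 * (norm a + 1)) < 1"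
      using that by (simp add: pos_less_divide_eq add_nonneg_pos)
    moreover have "2 * norm a * norm c \<le> norm c * (2 * (norm a + 1))" by (simp add: algebra_simps)
    ultimately show "2 * norm a * norm c < 1" by linarith
  qed
qed

lemma H_transform_h:
  assumes "norm c < 1 / R"
  shows "c \<in> H_domain \<iota> E a" "H_transform \<iota> E a c = h c"
  using H_transform_eq[OF H_extension_h assms] by auto

end


section \<open>Subordination by freeness\<close>

lemma norm_inv_le_2:
  fixes x :: "'a::{real_normed_algebra_1,banach}"
  assumes "norm x \<le> 1 / 2"
  shows "invertible_elem (1 - x)" "norm (inv_elem (1 - x)) \<le> 2"
proof -
  have x: "norm x < 1" using assms by simp
  show "invertible_elem (1 - x)" by (rule invertible_one_minus[OF x])
  have "1 / (1 - norm x) \<le> 1 / (1 / 2)" using assms by (intro frac_le) auto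
  then show "norm (inv_elem (1 - x)) \<le> 2" using norm_inv_one_minus[OF x] by simp
qed

lemma mult_left_cancel_inv:
  fixes x y :: "'a::monoid_mult"
  assumes "z * x = 1" "x * y = x * y'"
  shows "y = y'"
proof -
  have "z * (x * y) = z * (x * y')" using assms(2) by simp
  then show ?thesis using assms(1) by (simp flip: mult.assoc)
qed

lemma inverses_unique:
  fixes x y :: "'a::monoid_mult"
  assumes "z * x = 1" "x * y = 1"
  shows "z = y"
proof -
  have "z * (x * y) = z" using assms(2) by simp
  then show ?thesis using assms(1) by (simp flip: mult.assoc)
qed

section \<open>Freeness on closed generated algebras\<close>

context op_space
begin

text \<open>The inverse of 1 - a c can be moved across a, where it becomes the inverse of 1 - c
  a.\<close>

lemma moment_gen_swap:
  assumes "norm (a * \<iota> c) \<le> 1 / 2" "norm (\<iota> c * a) \<le> 1 / 2"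
  shows "E (a * inv_elem (1 - \<iota> c * a)) = moment_gen \<iota> E a c"
    "E (inv_elem (1 - \<iota> c * a)) = 1 + c * moment_gen \<iota> E a c"
proof -
  note i = norm_inv_le_2[OF assms(1)] and j = norm_inv_le_2[OF assms(2)]
  let ?i = "inv_elem (1 - a * \<iota> c)" and ?j = "inv_elem (1 - \<iota> c * a)"
  have "a * (1 - \<iota> c * a) = (1 - a * \<iota> c) * a" by (simp add: algebra_simps)
  then have "?i * (a * (1 - \<iota> c * a)) * ?j = ?i * ((1 - a * \<iota> c) * a) * ?j" by simp
  then have "?i * a * ((1 - \<iota> c * a) * ?j) = (?i * (1 - a * \<iota> c)) * a * ?j" by (simp only: mult.assoc)
  then have eq: "a * ?j = ?i * a" by (simp add: inv_elem_right[OF j(1)] inv_elem_left[OF i(1)])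
  then show 1: "E (a * ?j) = moment_gen \<iota> E a c" by (simp add: moment_gen_def)
  have "?j = 1 + \<iota> c * (a * ?j)" using inv_elem_right[OF j(1)] by (simp add: algebra_simps)
  then have "E ?j = E 1 + E (\<iota> c * (a * ?j))" using E_simps(1) by metis
  then show "E ?j = 1 + c * moment_gen \<iota> E a c" using 1 by (simp add: E_one E_left)
qed

lemma norm_moment_gen:
  assumes "norm (a * \<iota> c) \<le> 1 / 2"
  shows "norm (moment_gen \<iota> E a c) \<le> 2 * norm a"
  unfolding moment_gen_def
  by (rule order_trans[OF E_simps(4)]) (intro norm_mult_le norm_inv_le_2(2) assms order_refl)

text \<open>Freeness is stated for polynomials, but the resolvents used below are only limits of
  polynomials; hence the closure.\<close>

definition gen_alg :: "'a \<Rightarrow> 'a set" where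
  "gen_alg a = closure (range (nc_eval \<iota> a))"

lemma gen_alg_\<iota>: "\<iota> b \<in> gen_alg a"
  unfolding gen_alg_def using nc_eval_simps(1)[OF incl, of a b] closure_subset by (metis rangeI subsetD)

lemma gen_alg_var: "a \<in> gen_alg a"
  unfolding gen_alg_def using nc_eval_simps(2)[OF incl, of a] closure_subset by (metis rangeI subsetD)

lemma gen_alg_binop:
  assumes "x \<in> gen_alg a" "y \<in> gen_alg a"
  shows "x + y \<in> gen_alg a" "x * y \<in> gen_alg a"
proof -
  obtain f g where f: "\<And>n. f n \<in> range (nc_eval \<iota> a)" "f \<longlonglongrightarrow> x"
    and g: "\<And>n. g n \<in> range (nc_eval \<iota> a)" "g \<longlonglongrightarrow> y"
    using assms unfolding gen_alg_def closure_sequential by blast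
  have "f n + g n \<in> range (nc_eval \<iota> a)" "f n * g n \<in> range (nc_eval \<iota> a)" for n
  proof -
    obtain F G where "f n = nc_eval \<iota> a F" "g n = nc_eval \<iota> a G" using f(1)[of n] g(1)[of n] by blast
    then have "f n + g n = nc_eval \<iota> a (F + G)" "f n * g n = nc_eval \<iota> a (F * G)"
      by (simp_all add: nc_eval_simps(4,5)[OF incl])
    then show "f n + g n \<in> range (nc_eval \<iota> a)" "f n * g n \<in> range (nc_eval \<iota> a)" by simp_all
  qed
  note r = this
  show "x + y \<in> gen_alg a"
    unfolding gen_alg_def closure_sequential using tendsto_add[OF f(2) g(2)] r(1)
    by (intro exI[of _ "\<lambda>n. f n + g n"]) simp
  show "x * y \<in> gen_alg a"
    unfolding gen_alg_def closure_sequential using tendsto_mult[OF f(2) g(2)] r(2)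
    by (intro exI[of _ "\<lambda>n. f n * g n"]) simp
qed

lemma gen_alg_diff: "x \<in> gen_alg a \<Longrightarrow> y \<in> gen_alg a \<Longrightarrow> x - y \<in> gen_alg a"
  using gen_alg_binop(1)[of x a "\<iota> (- 1) * y"] gen_alg_binop(2)[OF gen_alg_\<iota>, of y a "- 1"]
  by (simp add: \<iota>_minus \<iota>_simps)

lemma gen_alg_one: "1 \<in> gen_alg a"
  using gen_alg_\<iota>[of 1 a] by (simp add: \<iota>_simps)

lemma gen_alg_inv:
  assumes "x \<in> gen_alg a" "norm x \<le> 1 / 2"
  shows "inv_elem (1 - x) \<in> gen_alg a"
proof -
  have n: "norm x < 1" using assms(2) by simp
  have "x ^ i \<in> gen_alg a" for i
    by (induction i) (simp_all add: gen_alg_one gen_alg_binop(2) assms(1))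
  then have "(\<Sum>i<n. x ^ i) \<in> gen_alg a" for n
    by (induction n) (use gen_alg_\<iota>[of 0 a] in \<open>simp_all add: \<iota>_zero gen_alg_binop(1)\<close>)
  then show ?thesis
    using Lim_in_closed_set[OF _ _ _ geometric_sums_inverse[OF n, unfolded sums_def], of "gen_alg a"]
    by (simp add: gen_alg_def)
qed

text \<open>Subtract the means from approximating polynomials; these means tend to E x = 0.\<close>

lemma centered_approx:
  assumes "x \<in> gen_alg a" "E x = 0"
  shows "\<exists>f. (\<forall>n::nat. f n \<in> range (nc_eval \<iota> a) \<and> E (f n) = 0) \<and> f \<longlonglongrightarrow> x"
proof -
  obtain f where f: "\<And>n. f n \<in> range (nc_eval \<iota> a)" "f \<longlonglongrightarrow> x"
    using assms(1) unfolding gen_alg_def closure_sequential by blast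
  have bl: "bounded_linear E" "bounded_linear \<iota>" using bounded_clinear_E bounded_clinear_\<iota> unfolding bounded_clinear_def by auto
  define g where "g n = f n + \<iota> (- E (f n))" for n
  have "g n \<in> range (nc_eval \<iota> a)" for n
  proof -
    obtain P where "f n = nc_eval \<iota> a P" using f(1) by blast
    then have "g n = nc_eval \<iota> a (P + nc_const (- E (f n)))"
      by (simp add: g_def nc_eval_simps(1,4)[OF incl])
    then show ?thesis by blast
  qed
  moreover have "E (g n) = 0" for n by (simp add: g_def E_simps)
  moreover have "g \<longlonglongrightarrow> x + \<iota> (- E x)"
    unfolding g_def
    by (intro tendsto_add tendsto_minus bounded_linear.tendsto[OF bl(1)] bounded_linear.tendsto[OF bl(2)] f(2))
  ultimately show ?thesis using assms(2) \<iota>_zero by auto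
qed

lemma free_closure:
  assumes free: "free_over \<iota> E a1 a2" and ne: "xs \<noteq> []"
    and xs: "\<And>i x. (i, x) \<in> set xs \<Longrightarrow> x \<in> gen_alg (if i then a1 else a2) \<and> E x = 0"
    and alt: "successively (\<noteq>) (map fst xs)"
  shows "E (prod_list (map snd xs)) = 0"
proof -
  have "\<exists>f. (\<forall>n::nat. f n \<in> range (nc_eval \<iota> (if fst p then a1 else a2)) \<and> E (f n) = 0) \<and> f \<longlonglongrightarrow> snd p"
    if "p \<in> set xs" for p
    using centered_approx[of "snd p" "if fst p then a1 else a2"] xs[of "fst p" "snd p"] that by auto
  then obtain Y where Y: "\<And>p n. p \<in> set xs \<Longrightarrow> Y p n \<in> range (nc_eval \<iota> (if fst p then a1 else a2)) \<and> E (Y p n) = 0"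
    "\<And>p. p \<in> set xs \<Longrightarrow> Y p \<longlonglongrightarrow> snd p" by metis
  have "(\<lambda>n. prod_list (map (\<lambda>p. Y p n) ys)) \<longlonglongrightarrow> prod_list (map snd ys)" if "set ys \<subseteq> set xs" for ys
    using that by (induction ys) (auto intro!: tendsto_mult Y(2))
  then have lim: "(\<lambda>n. E (prod_list (map (\<lambda>p. Y p n) xs))) \<longlonglongrightarrow> E (prod_list (map snd xs))"
    using bounded_linear.tendsto[of E] bounded_clinear_E unfolding bounded_clinear_def by blast
  have "E (prod_list (map (\<lambda>p. Y p n) xs)) = 0" for n
  proof -
    let ?zs = "map (\<lambda>p. (fst p, Y p n)) xs"
    have "E (prod_list (map snd ?zs)) = 0"
      by (rule free[unfolded free_over_def, rule_format]) (use ne alt Y(1) in \<open>auto simp: comp_def\<close>)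
    then show ?thesis by (simp add: comp_def)
  qed
  then show ?thesis using lim by (simp add: LIMSEQ_const_iff)
qed

lemma successively_alternating:
  "successively (\<noteq>) (concat (replicate n [True, False]))"
  "successively (\<noteq>) (concat (replicate n [True, False]) @ [True])"
  "successively (\<noteq>) (False # concat (replicate n [True, False]))"
  "successively (\<noteq>) (False # concat (replicate n [True, False]) @ [True])"
proof -
  have 1: "successively (\<noteq>) (False # concat (replicate n [True, False]))" for n
    by (induction n) auto
  have 2: "successively (\<noteq>) (False # concat (replicate n [True, False]) @ [True])" for n
    by (induction n) auto
  show "successively (\<noteq>) (False # concat (replicate n [True, False]))"
    "successively (\<noteq>) (False # concat (replicate n [True, False]) @ [True])" by (fact 1 2)+
  show "successively (\<noteq>) (concat (replicate n [True, False]))"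
    using 1[of n] by (auto simp: successively_Cons)
  show "successively (\<noteq>) (concat (replicate n [True, False]) @ [True])"
    using 2[of n] by (auto simp: successively_Cons)
qed

text \<open>These four shapes are the ones occurring in the expansion of the resolvent of the
  product. At n = 0 the first word is 1, whence the condition on n.\<close>

lemma free_words:
  assumes free: "free_over \<iota> E a1 a2"
    and x: "x \<in> gen_alg a1" "E x = 0" and y: "y \<in> gen_alg a2" "E y = 0" and z: "z \<in> gen_alg a2" "E z = 0"
  shows "0 < n \<Longrightarrow> E ((x * y) ^ n) = 0" "E ((x * y) ^ n * x) = 0" "E (z * (x * y) ^ n) = 0"
    "E (z * (x * y) ^ n * x) = 0"
proof -
  define W where "W = concat (replicate n [(True, x), (False, y)])"
  have W: "prod_list (map snd W) = (x * y) ^ n" "map fst W = concat (replicate n [True, False])"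
    unfolding W_def by (induction n) (auto simp: mult.assoc)
  have set: "v \<in> gen_alg (if i then a1 else a2) \<and> E v = 0" if "(i, v) \<in> set W" for i v
    using that x y unfolding W_def by (auto split: if_splits)
  note sets = set set[of True, simplified] set[of False, simplified]
  note f = free_closure[OF free]
  show "E ((x * y) ^ n) = 0" if "0 < n"
  proof -
    have "W \<noteq> []" using that by (cases n) (simp_all add: W_def)
    then show ?thesis using f[OF _ set, of W] W successively_alternating(1)[of n] by simp
  qed
  have "E (prod_list (map snd (W @ [(True, x)]))) = 0"
    by (rule f) (use W sets successively_alternating(2)[of n] x in auto)
  then show "E ((x * y) ^ n * x) = 0" using W by simp
  have "E (prod_list (map snd ((False, z) # W))) = 0"
    by (rule f) (use W sets successively_alternating(3)[of n] z in auto)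
  then show "E (z * (x * y) ^ n) = 0" using W by simp
  have "E (prod_list (map snd ((False, z) # W @ [(True, x)]))) = 0"
    by (rule f) (use W sets successively_alternating(4)[of n] x z in auto)
  then show "E (z * (x * y) ^ n * x) = 0" using W by (simp add: mult.assoc)
qed

text \<open>With \<open>\<alpha> = w a\<^sub>1\<close>, \<open>\<xi>\<^sub>1 = (\<alpha> - c) (1 - p \<alpha>)\<^sup>-\<^sup>1\<close> and \<open>\<xi>\<^sub>2 = (1 - a\<^sub>2 c)\<^sup>-\<^sup>1 (a\<^sub>2 - p)\<close>, both centered, one has
  \<open>(1 + \<xi>\<^sub>1 p) \<alpha> = \<xi>\<^sub>1 + c\<close> and \<open>a\<^sub>2 (1 + c \<xi>\<^sub>2) = \<xi>\<^sub>2 + p\<close>, hence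
  \<open>(1 + \<xi>\<^sub>1 p) (1 - \<alpha> a\<^sub>2) (1 + c \<xi>\<^sub>2) = (1 - c p) - \<xi>\<^sub>1 (1 - p c) \<xi>\<^sub>2\<close>. Expanding the inverse of the right-hand side
  in a Neumann series, freeness kills all terms but \<open>(1 - c p)\<^sup>-\<^sup>1\<close>.\<close>

lemma moment_gen_eq:
  assumes "op_space \<iota>' E'" "\<And>bs. E (alt_word \<iota> a bs) = E' (alt_word \<iota>' a' bs)"
    and "norm a * norm c < 1" "norm a' * norm c < 1"
  shows "moment_gen \<iota> E a c = moment_gen \<iota>' E' a' c"
  using moment_gen_sums[OF assms(3)] op_space.moment_gen_sums[OF assms(1,4)] sums_unique2
  unfolding assms(2) by blast

text \<open>Read p, h1 and h3 as the values H2(c), H1(p w) and H3(w). They enter only through their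
  moment relations, so no domain of a transform is involved. The condition \<open>small\<close>
  keeps every Neumann series below at ratio at most 1/2.\<close>

lemma free_subordination:
  assumes free: "free_over \<iota> E a1 a2"
    and A: "norm a1 \<le> A" "norm a2 \<le> A" and P: "norm p \<le> P" and \<delta>: "norm c \<le> \<delta>" "norm w \<le> \<delta>"
    and small: "32 * \<delta> * (A + 1) * (A + P) \<le> 1"
    and m2: "moment_gen \<iota> E a2 c = p + moment_gen \<iota> E a2 c * c * p"
    and m1: "moment_gen \<iota> E a1 (p * w) = h1 + moment_gen \<iota> E a1 (p * w) * (p * w) * h1"
    and wh: "w * h1 = c"
    and m3: "moment_gen \<iota> E (a1 * a2) w = h3 + moment_gen \<iota> E (a1 * a2) w * w * h3"
  shows "w * h3 = c * p"
proof -
  have A0: "A \<ge> 0" and P0: "P \<ge> 0" and \<delta>0: "\<delta> \<ge> 0"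
    using A(1) P \<delta>(1) norm_ge_zero order_trans by blast+
  have "32 * \<delta> * (A + 1) * (A + P) = 32 * (\<delta> * A * A) + 32 * (\<delta> * A * P) + 32 * (\<delta> * A) + 32 * (\<delta> * P)"
    by (simp add: algebra_simps)
  moreover have "0 \<le> \<delta> * A * A" "0 \<le> \<delta> * A * P" "0 \<le> \<delta> * A" "0 \<le> \<delta> * P"
    using A0 P0 \<delta>0 by (auto intro!: mult_nonneg_nonneg)
  ultimately have b: "\<delta> * A * A \<le> 1/16" "\<delta> * A * P \<le> 1/16" "\<delta> * A \<le> 1/16" "\<delta> * P \<le> 1/16"
    using small by linarith+
  define u where "u = p * w"
  have nu: "norm u \<le> P * \<delta>" unfolding u_def by (intro norm_mult_le P \<delta>)
  have n\<iota>: "norm (\<iota> c) \<le> \<delta>" "norm (\<iota> w) \<le> \<delta>" "norm (\<iota> p) \<le> P" "norm (\<iota> u) \<le> P * \<delta>"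
    using \<delta> P nu by (simp_all add: norm_\<iota>)
  define \<alpha> where "\<alpha> = \<iota> w * a1"
  have n\<alpha>: "norm \<alpha> \<le> \<delta> * A" unfolding \<alpha>_def by (intro norm_mult_le n\<iota> A)
  have ux: "\<iota> p * \<alpha> = \<iota> u * a1" by (simp add: \<alpha>_def u_def \<iota>_simps mult.assoc)
  have n1: "norm (\<iota> u * a1) \<le> 1/2"
    using norm_mult_le[OF n\<iota>(4) A(1)] b(2) by (simp add: mult_ac)
  have n1': "norm (a1 * \<iota> u) \<le> 1/2"
    using norm_mult_le[OF A(1) n\<iota>(4)] b(2) by (simp add: mult_ac)
  have n2': "norm (a2 * \<iota> c) \<le> 1/2"
    using norm_mult_le[OF A(2) n\<iota>(1)] b(3) by (simp add: mult_ac)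
  let ?M1 = "moment_gen \<iota> E a1 u" and ?M2 = "moment_gen \<iota> E a2 c" and ?M3 = "moment_gen \<iota> E (a1 * a2) w"
  define i1 where "i1 = inv_elem (1 - \<iota> u * a1)"
  define i2 where "i2 = inv_elem (1 - a2 * \<iota> c)"
  have i1: "i1 * (1 - \<iota> u * a1) = 1" "norm i1 \<le> 2" and i2: "(1 - a2 * \<iota> c) * i2 = 1" "norm i2 \<le> 2"
    using norm_inv_le_2[OF n1] norm_inv_le_2[OF n2'] by (simp_all add: i1_def i2_def inv_elem_left inv_elem_right)
  define \<xi>1 where "\<xi>1 = (\<alpha> - \<iota> c) * i1"
  define \<xi>2 where "\<xi>2 = i2 * (a2 - \<iota> p)"
  have n\<xi>1: "norm \<xi>1 \<le> (\<delta> * A + \<delta>) * 2" unfolding \<xi>1_def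
    by (intro norm_mult_le i1 order_trans[OF norm_triangle_ineq4] add_mono n\<alpha> n\<iota>)
  have n\<xi>2: "norm \<xi>2 \<le> 2 * (A + P)" unfolding \<xi>2_def
    by (intro norm_mult_le i2 order_trans[OF norm_triangle_ineq4] add_mono A n\<iota>)
  have "\<xi>1 * (1 - \<iota> u * a1) = \<alpha> - \<iota> c" by (simp add: \<xi>1_def mult.assoc i1)
  then have r1: "(1 + \<xi>1 * \<iota> p) * \<alpha> = \<xi>1 + \<iota> c"
    by (simp add: algebra_simps flip: ux)
  have "(1 - a2 * \<iota> c) * \<xi>2 = a2 - \<iota> p" using i2(1) by (simp add: \<xi>2_def flip: mult.assoc)
  then have r2: "a2 * (1 + \<iota> c * \<xi>2) = \<xi>2 + \<iota> p" by (simp add: algebra_simps)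
  have fact: "(1 + \<xi>1 * \<iota> p) * (1 - \<alpha> * a2) * (1 + \<iota> c * \<xi>2)
      = (1 - \<iota> (c * p)) - \<xi>1 * (1 - \<iota> (p * c)) * \<xi>2"
  proof -
    have "(1 + \<xi>1 * \<iota> p) * (1 - \<alpha> * a2) * (1 + \<iota> c * \<xi>2)
        = (1 + \<xi>1 * \<iota> p) * (1 + \<iota> c * \<xi>2) - ((1 + \<xi>1 * \<iota> p) * \<alpha>) * (a2 * (1 + \<iota> c * \<xi>2))"
      by (simp only: left_diff_distrib right_diff_distrib mult.assoc mult_1_left mult_1_right)
    also have "\<dots> = (1 - \<iota> (c * p)) - \<xi>1 * (1 - \<iota> (p * c)) * \<xi>2"
      unfolding r1 r2 by (simp add: algebra_simps \<iota>_simps)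
    finally show ?thesis .
  qed
  have E2: "E \<xi>2 = 0"
  proof -
    have "E \<xi>2 = E (i2 * a2) - E i2 * p" by (simp add: \<xi>2_def right_diff_distrib E_diff E_right)
    also have "E (i2 * a2) = ?M2" by (simp add: moment_gen_def i2_def)
    also have "E i2 = 1 + ?M2 * c" unfolding i2_def by (rule E_inv[OF norm_inv_le_2(1)[OF n2']])
    finally have "E \<xi>2 = ?M2 - (p + ?M2 * c * p)" by (simp add: ring_distribs)
    then show ?thesis unfolding m2[symmetric] by simp
  qed
  have E1: "E \<xi>1 = 0"
  proof -
    have "E \<xi>1 = w * E (a1 * i1) - c * E i1"
      by (simp add: \<xi>1_def \<alpha>_def left_diff_distrib E_diff E_left mult.assoc)
    then have e: "E \<xi>1 = w * (?M1 - h1 * (1 + u * ?M1))"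
      unfolding i1_def moment_gen_swap[OF n1' n1] by (simp add: algebra_simps flip: wh)
    have "norm (?M1 * u) \<le> (2 * A) * (P * \<delta>)"
      using norm_moment_gen[OF n1'] A(1) by (intro norm_mult_le nu) auto
    then have "norm (- (?M1 * u)) \<le> 1/2" using b(2) by (simp add: mult_ac)
    from norm_inv_le_2(1)[OF this] have inv: "invertible_elem (1 + ?M1 * u)" by simp
    have m1': "(1 + ?M1 * u) * h1 = ?M1"
    proof -
      have "(1 + ?M1 * u) * h1 = h1 + ?M1 * u * h1" by (simp add: ring_distribs)
      then show ?thesis using m1[folded u_def] by simp
    qed
    \<comment> \<open>Both sides become (1 + M u) M, using M (1 + u M) = (1 + M u) M, and the
      invertible factor 1 + M u cancels.\<close>
    have "(1 + ?M1 * u) * (h1 * (1 + u * ?M1)) = ((1 + ?M1 * u) * h1) * (1 + u * ?M1)" by (simp only: mult.assoc)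
    also have "\<dots> = (1 + ?M1 * u) * ?M1" unfolding m1' by (simp add: algebra_simps)
    finally have "h1 * (1 + u * ?M1) = ?M1"
      by (rule mult_left_cancel_inv[OF inv_elem_left[OF inv]])
    then show ?thesis using e by simp
  qed
  have ncp: "norm (c * p) \<le> 1/2" "norm (p * c) \<le> 1"
    using norm_mult_le[OF \<delta>(1) P] norm_mult_le[OF P \<delta>(1)] b(4) by (simp_all add: mult_ac)
  define q where "q = inv_elem (1 - c * p)"
  have q: "(1 - c * p) * q = 1" "q * (1 - c * p) = 1" "norm q \<le> 2"
    using norm_inv_le_2[OF ncp(1)] by (simp_all add: q_def inv_elem_left inv_elem_right)
  define \<eta>1 where "\<eta>1 = \<iota> q * \<xi>1"
  define \<eta>2 where "\<eta>2 = (1 - \<iota> (p * c)) * \<xi>2"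
  have "norm (1 - \<iota> (p * c)) \<le> norm (1::'a) + norm (\<iota> (p * c))" by (rule norm_triangle_ineq4)
  then have nd: "norm (1 - \<iota> (p * c)) \<le> 2" using ncp(2) by (simp add: norm_\<iota>)
  have qq: "\<iota> q * (1 - \<iota> (c * p)) = 1" using q(2) \<iota>_simps(1,4) by (metis \<iota>_diff)
  define N where "N = \<eta>1 * \<eta>2"
  have "norm N \<le> (2 * ((\<delta> * A + \<delta>) * 2)) * (2 * (2 * (A + P)))"
    unfolding N_def \<eta>1_def \<eta>2_def using q(3) by (intro norm_mult_le n\<xi>1 n\<xi>2 nd) (simp add: norm_\<iota>)
  \<comment> \<open>The constant 32 in \<open>small\<close> is twice this 16, which yields the bound
    1/2.\<close>
  also have "\<dots> = 16 * \<delta> * (A + 1) * (A + P)" by (simp add: algebra_simps)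
  finally have nN: "norm N \<le> 1/2" using small by linarith
  then have nN1: "norm N < 1" by simp
  define Z where "Z = inv_elem (1 - N)"
  have Z: "Z * (1 - N) = 1" using norm_inv_le_2(1)[OF nN] by (simp add: Z_def inv_elem_left)
  have Zs: "(\<lambda>n. N ^ n) sums Z" unfolding Z_def by (rule geometric_sums_inverse[OF nN1])
  \<comment> \<open>Multiplying the factorization by q turns its right-hand side into 1 - N. Solving
    formally for the inverse of the middle factor gives X.\<close>
  define X where "X = (1 + \<iota> c * \<xi>2) * Z * (\<iota> q * (1 + \<xi>1 * \<iota> p))"
  have X: "X * (1 - \<alpha> * a2) = 1"
  proof -
    have "norm (\<iota> c * \<xi>2) \<le> \<delta> * (2 * (A + P))" by (intro norm_mult_le n\<iota> n\<xi>2)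
    then have "norm (- (\<iota> c * \<xi>2)) \<le> 1/2" using b by (simp add: algebra_simps)
    from norm_inv_le_2(1)[OF this] have inv: "invertible_elem (1 + \<iota> c * \<xi>2)" by simp
    have "\<iota> q * ((1 + \<xi>1 * \<iota> p) * (1 - \<alpha> * a2) * (1 + \<iota> c * \<xi>2)) = 1 - N"
    proof -
      have "\<iota> q * ((1 - \<iota> (c * p)) - \<xi>1 * (1 - \<iota> (p * c)) * \<xi>2)
          = \<iota> q * (1 - \<iota> (c * p)) - \<iota> q * (\<xi>1 * (1 - \<iota> (p * c)) * \<xi>2)" by (rule right_diff_distrib)
      also have "\<dots> = 1 - N" unfolding qq by (simp add: N_def \<eta>1_def \<eta>2_def mult.assoc)
      finally show ?thesis unfolding fact .
    qed
    then have "X * (1 - \<alpha> * a2) * (1 + \<iota> c * \<xi>2) = (1 + \<iota> c * \<xi>2) * (Z * (1 - N))"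
      by (simp add: X_def mult.assoc)
    then have "X * (1 - \<alpha> * a2) * (1 + \<iota> c * \<xi>2) = 1 + \<iota> c * \<xi>2" by (simp add: Z)
    then show ?thesis using inv_elem_right[OF inv] by (metis mult.assoc mult_1_right)
  qed
  have al1: "\<alpha> \<in> gen_alg a1" unfolding \<alpha>_def by (intro gen_alg_binop(2) gen_alg_\<iota> gen_alg_var)
  have x1: "\<xi>1 \<in> gen_alg a1" unfolding \<xi>1_def i1_def
    by (intro gen_alg_binop(2) gen_alg_diff al1 gen_alg_\<iota> gen_alg_inv n1 gen_alg_var)
  have x2: "\<xi>2 \<in> gen_alg a2" unfolding \<xi>2_def i2_def
    by (intro gen_alg_binop(2) gen_alg_diff gen_alg_\<iota> gen_alg_inv n2' gen_alg_var)
  have e1: "\<eta>1 \<in> gen_alg a1" "E \<eta>1 = 0" unfolding \<eta>1_def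
    by (simp_all add: gen_alg_binop(2) gen_alg_\<iota> x1 E_left E1)
  have e2: "\<eta>2 \<in> gen_alg a2" "E \<eta>2 = 0" unfolding \<eta>2_def
    by (simp_all add: gen_alg_binop(2) gen_alg_\<iota> gen_alg_diff gen_alg_one x2 left_diff_distrib E_diff E_left E2)
  note fw = free_words[OF free e1 e2 x2 E2]
  have words: "E ((1 + \<iota> c * \<xi>2) * N ^ n * (\<iota> q * (1 + \<xi>1 * \<iota> p))) = (if n = 0 then q else 0)" for n
  proof -
    \<comment> \<open>Up to coefficients from \<open>B\<close> the four summands are the words of
      \<open>free_words\<close>; only the power with exponent 0 survives.\<close>
    have "(1 + \<iota> c * \<xi>2) * N ^ n * (\<iota> q * (1 + \<xi>1 * \<iota> p))
        = N ^ n * \<iota> q + (N ^ n * \<eta>1) * \<iota> p + \<iota> c * ((\<xi>2 * N ^ n) * \<iota> q) + \<iota> c * ((\<xi>2 * N ^ n * \<eta>1) * \<iota> p)"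
      by (simp add: \<eta>1_def algebra_simps)
    then have "E ((1 + \<iota> c * \<xi>2) * N ^ n * (\<iota> q * (1 + \<xi>1 * \<iota> p))) = E (N ^ n) * q"
      using fw(2-4)[of n] by (simp add: E_simps(1) E_left E_right N_def)
    then show ?thesis using fw(1)[of n] by (auto simp: N_def E_one)
  qed
  have "E X = q"
  proof -
    have "(\<lambda>n. (1 + \<iota> c * \<xi>2) * N ^ n * (\<iota> q * (1 + \<xi>1 * \<iota> p))) sums X"
      unfolding X_def by (intro sums_mult2 sums_mult Zs)
    then have "(\<lambda>n. E ((1 + \<iota> c * \<xi>2) * N ^ n * (\<iota> q * (1 + \<xi>1 * \<iota> p)))) sums E X"
      using bounded_clinear_E unfolding bounded_clinear_def by (intro bounded_linear.sums[of E]) auto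
    then have "(\<lambda>n. if n = 0 then q else 0) sums E X" unfolding words .
    then show ?thesis using sums_If_finite_set[of "{0}" "\<lambda>_. q"] sums_unique2 by fastforce
  qed
  have n3: "norm (\<iota> w * (a1 * a2)) \<le> 1/2" "norm (a1 * a2 * \<iota> w) \<le> 1/2"
    using norm_mult_le[OF n\<iota>(2) norm_mult_le[OF A]] norm_mult_le[OF norm_mult_le[OF A] n\<iota>(2)] b(1)
    by (simp_all add: mult_ac)
  have "X = inv_elem (1 - \<iota> w * (a1 * a2))"
    using inverses_unique[OF X[unfolded \<alpha>_def mult.assoc] inv_elem_right[OF norm_inv_le_2(1)[OF n3(1)]]] .
  then have m3q: "1 + w * ?M3 = q" using moment_gen_swap(2)[OF n3(2,1)] \<open>E X = q\<close> by simp
  \<comment> \<open>The moment relation reduces this product to 1, so 1 - w h3 and 1 - c p are both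
    inverse to q.\<close>
  have "(1 + w * ?M3) * (1 - w * h3) = 1 + w * (?M3 - (h3 + ?M3 * w * h3))" by (simp add: algebra_simps)
  then have "q * (1 - w * h3) = 1" using m3 m3q by simp
  then have "1 - w * h3 = 1 - c * p" by (rule inverses_unique[OF q(1), symmetric])
  then show ?thesis by simp
qed

end


section \<open>The fixed point\<close>

text \<open>All that the fixed point argument uses about a transform, with mean m, moment bound R
  and standard deviation s; realizations no longer appear.\<close>

definition transform_bounds :: "('b::cstar_algebra \<Rightarrow> 'b) \<Rightarrow> 'b \<Rightarrow> real \<Rightarrow> real \<Rightarrow> bool" where
  "transform_bounds h m R s \<longleftrightarrow> 0 < R \<and> 0 \<le> s
    \<and> (\<forall>c. R * norm c < 1 \<longrightarrow> norm (h c - m) \<le> s\<^sup>2 * norm c / (1 - R * norm c))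
    \<and> (\<forall>x y r. norm x \<le> r \<longrightarrow> norm y \<le> r \<longrightarrow> R * r < 1 \<longrightarrow> norm (h x - h y) \<le> s\<^sup>2 / (1 - R * r)\<^sup>2 * norm (x - y))
    \<and> (\<forall>c. norm c < 1 / R \<longrightarrow> complex_diff h c)"

text \<open>The pair (c, w) lives in a product of two algebras, so complex linearity of the
  derivative is stated componentwise.\<close>

definition complex_diff2 :: "('b::cstar_algebra \<times> 'b \<Rightarrow> 'b) \<Rightarrow> 'b \<times> 'b \<Rightarrow> bool" where
  "complex_diff2 f p \<longleftrightarrow> (\<exists>D. (f has_derivative D) (at p) \<and> (\<forall>z v d. D (z *\<^sub>C v, z *\<^sub>C d) = z *\<^sub>C D (v, d)))"

section \<open>Analytic dependence of a fixed point on a parameter\<close>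

lemma complex_diff2_fst: "complex_diff2 fst p" and complex_diff2_snd: "complex_diff2 snd p"
  unfolding complex_diff2_def
  by (intro exI[of _ fst] conjI bounded_linear_imp_has_derivative bounded_linear_fst; simp)
    (intro exI[of _ snd] conjI bounded_linear_imp_has_derivative bounded_linear_snd; simp)

lemma complex_diff2_mult:
  assumes "complex_diff2 f p" "complex_diff2 g p"
  shows "complex_diff2 (\<lambda>p. f p * g p) p"
proof -
  obtain f' g' where f: "(f has_derivative f') (at p)" "\<And>z v d. f' (z *\<^sub>C v, z *\<^sub>C d) = z *\<^sub>C f' (v, d)"
    and g: "(g has_derivative g') (at p)" "\<And>z v d. g' (z *\<^sub>C v, z *\<^sub>C d) = z *\<^sub>C g' (v, d)"
    using assms unfolding complex_diff2_def by blast
  show ?thesis unfolding complex_diff2_def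
    using has_derivative_mult[OF f(1) g(1)] f(2) g(2)
    by (intro exI[of _ "\<lambda>h. f p * g' h + f' h * g p"])
      (simp add: scaleC_add_right scaleC_mult_left scaleC_mult_right)
qed

lemma complex_diff2_compose:
  assumes "complex_diff2 f p" "complex_diff g (f p)"
  shows "complex_diff2 (\<lambda>p. g (f p)) p"
proof -
  obtain f' g' where f: "(f has_derivative f') (at p)" "\<And>z v d. f' (z *\<^sub>C v, z *\<^sub>C d) = z *\<^sub>C f' (v, d)"
    and g: "(g has_derivative g') (at (f p))" "\<And>z v. g' (z *\<^sub>C v) = z *\<^sub>C g' v"
    using assms unfolding complex_diff2_def complex_diff_def by blast
  show ?thesis unfolding complex_diff2_def
    using has_derivative_compose[OF f(1) g(1)] f(2) g(2) by (intro exI[of _ "\<lambda>h. g' (f' h)"]) simp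
qed

text \<open>L is the sum of the powers of A. Only L (1 - A) = 1 is recorded, which is enough to
  solve for an increment.\<close>

lemma operator_neumann:
  fixes A :: "'b::cstar_algebra \<Rightarrow> 'b"
  assumes A: "bounded_linear A" "\<And>z d. A (z *\<^sub>C d) = z *\<^sub>C A d" "\<And>d. norm (A d) \<le> q * norm d" and q: "0 \<le> q" "q < 1"
  obtains L where "bounded_linear L" "\<And>z d. L (z *\<^sub>C d) = z *\<^sub>C L d" "\<And>d. L (d - A d) = d"
    "\<And>d. norm (L d) \<le> 1 / (1 - q) * norm d"
proof -
  interpret A: bounded_linear A by (rule A(1))
  have An: "bounded_linear (A ^^ n)" for n
    by (induction n) (auto simp: comp_def intro: bounded_linear_compose[OF A(1)] bounded_linear_ident)
  have nA: "norm ((A ^^ n) d) \<le> q ^ n * norm d" for n d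
  proof (induction n)
    case (Suc n)
    have "norm ((A ^^ Suc n) d) \<le> q * norm ((A ^^ n) d)" using A(3) by simp
    also have "\<dots> \<le> q * (q ^ n * norm d)" using Suc q by (intro mult_left_mono) auto
    finally show ?case by simp
  qed simp
  have sm: "summable (\<lambda>n. (A ^^ n) d)" for d
    by (rule summable_comparison_test'[where N = 0 and g = "\<lambda>n. q ^ n * norm d"])
      (use nA q in \<open>auto intro!: summable_mult2 summable_geometric\<close>)
  define L where "L d = (\<Sum>n. (A ^^ n) d)" for d
  have nL: "norm (L d) \<le> 1 / (1 - q) * norm d" for d
  proof -
    have "norm (L d) \<le> (\<Sum>n. q ^ n * norm d)" unfolding L_def
      by (rule norm_suminf_le[OF nA]) (use q in \<open>auto intro!: summable_mult2 summable_geometric\<close>)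
    also have "\<dots> = 1 / (1 - q) * norm d"
      using q by (subst suminf_mult2[symmetric]) (auto simp: suminf_geometric intro!: summable_geometric)
    finally show ?thesis .
  qed
  have zc: "(A ^^ n) (z *\<^sub>C d) = z *\<^sub>C (A ^^ n) d" for n z d by (induction n) (simp_all add: A(2))
  have "bounded_linear L"
  proof (rule bounded_linear_intro[where K = "1 / (1 - q)"])
    show "L (x + y) = L x + L y" for x y
      unfolding L_def linear_add[OF bounded_linear.linear[OF An]] by (rule suminf_add[OF sm sm, symmetric])
    show "L (r *\<^sub>R x) = r *\<^sub>R L x" for r x
      unfolding L_def linear_scale[OF bounded_linear.linear[OF An]]
      by (rule bounded_linear.suminf[OF bounded_linear_scaleR_right sm, symmetric])
    show "norm (L x) \<le> norm x * (1 / (1 - q))" for x using nL[of x] by (simp add: mult.commute)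
  qed
  moreover have "L (z *\<^sub>C d) = z *\<^sub>C L d" for z d
    unfolding L_def zc by (rule bounded_linear.suminf[OF bounded_linear_scaleC sm, symmetric])
  moreover have "L (d - A d) = d" for d
  proof -
    have s2: "summable (\<lambda>n. (A ^^ Suc n) d)" using summable_Suc_iff[of "\<lambda>n. (A ^^ n) d"] sm[of d] by blast
    have "(A ^^ n) (d - A d) = (A ^^ n) d - (A ^^ Suc n) d" for n
      unfolding linear_diff[OF bounded_linear.linear[OF An]] funpow_Suc_right comp_def ..
    then have "L (d - A d) = (\<Sum>n. (A ^^ n) d) - (\<Sum>n. (A ^^ Suc n) d)"
      unfolding L_def using suminf_diff[OF sm s2] by simp
    then show ?thesis using suminf_split_head[OF sm[of d]] by simp
  qed
  ultimately show ?thesis using that nL by blast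
qed

text \<open>Let A and B be the partial derivatives in w and in c. The increment satisfies \<delta> =
  A \<delta> + B v + error, and the Lipschitz condition makes the norm of A at most q < 1; so L B is
  the derivative, L inverting 1 - A.\<close>

lemma fixed_point_complex_diff:
  fixes \<Psi> :: "'b::cstar_algebra \<times> 'b \<Rightarrow> 'b" and W :: "'b \<Rightarrow> 'b"
  assumes \<Psi>: "complex_diff2 \<Psi> (c0, W c0)"
    and lip: "e > 0" "\<And>w. norm (w - W c0) < e \<Longrightarrow> norm (\<Psi> (c0, w) - \<Psi> (c0, W c0)) \<le> q * norm (w - W c0)"
    and q: "0 \<le> q" "q < 1"
    and fixpt: "e' > 0" "\<And>c. norm (c - c0) < e' \<Longrightarrow> \<Psi> (c, W c) = W c"
    and cont: "isCont W c0"
  shows "complex_diff W c0"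
proof -
  obtain D where D: "(\<Psi> has_derivative D) (at (c0, W c0))" "\<And>z v d. D (z *\<^sub>C v, z *\<^sub>C d) = z *\<^sub>C D (v, d)"
    using \<Psi> unfolding complex_diff2_def by blast
  have bD: "bounded_linear D" using has_derivative_bounded_linear[OF D(1)] .
  interpret D: bounded_linear D by (rule bD)
  have alt: "\<exists>d>0. \<forall>c w. norm (c - c0) < d \<longrightarrow> norm (w - W c0) < d \<longrightarrow>
      norm (\<Psi> (c, w) - \<Psi> (c0, W c0) - D (c - c0, w - W c0)) \<le> \<epsilon> * (norm (c - c0) + norm (w - W c0))"
    if \<epsilon>: "\<epsilon> > 0" for \<epsilon>
  proof -
    obtain d where d: "d > 0" "\<And>y. norm (y - (c0, W c0)) < d \<Longrightarrow>
        norm (\<Psi> y - \<Psi> (c0, W c0) - D (y - (c0, W c0))) \<le> \<epsilon> * norm (y - (c0, W c0))"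
      using D(1)[unfolded has_derivative_at_alt] \<epsilon> by blast
    have np: "norm ((c, w) - (c0, W c0)) \<le> norm (c - c0) + norm (w - W c0)" for c w
      using norm_Pair_le[of "c - c0" "w - W c0"] by simp
    show ?thesis
    proof (intro exI[of _ "d / 2"] conjI allI impI)
      fix c w assume "norm (c - c0) < d / 2" "norm (w - W c0) < d / 2"
      then have "norm ((c, w) - (c0, W c0)) < d" using np[of c w] by linarith
      from order_trans[OF d(2)[OF this] mult_left_mono[OF np[of c w] less_imp_le[OF \<epsilon>]]]
      show "norm (\<Psi> (c, w) - \<Psi> (c0, W c0) - D (c - c0, w - W c0)) \<le> \<epsilon> * (norm (c - c0) + norm (w - W c0))"
        by simp
    qed (use d(1) in simp)
  qed
  define A where "A d = D (0, d)" for d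
  have nA: "norm (A d) \<le> q * norm d" for d
  proof (rule field_le_epsilon)
    fix \<eta> :: real assume \<eta>: "\<eta> > 0"
    define n1 where "n1 = norm d + 1"
    have n1: "n1 > 0" "norm d \<le> n1" by (simp_all add: n1_def add_nonneg_pos)
    define \<epsilon> where "\<epsilon> = \<eta> / n1"
    have \<epsilon>: "\<epsilon> > 0" using \<eta> n1 by (simp add: \<epsilon>_def)
    have \<epsilon>d: "\<epsilon> * norm d \<le> \<eta>"
    proof -
      have "\<epsilon> * norm d \<le> \<epsilon> * n1" using \<epsilon> n1 by (intro mult_left_mono) auto
      also have "\<dots> = \<eta>" using n1 by (simp add: \<epsilon>_def)
      finally show ?thesis .
    qed
    obtain r where r: "r > 0" "\<And>c w. norm (c - c0) < r \<Longrightarrow> norm (w - W c0) < r \<Longrightarrow>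
      norm (\<Psi> (c, w) - \<Psi> (c0, W c0) - D (c - c0, w - W c0)) \<le> \<epsilon> * (norm (c - c0) + norm (w - W c0))"
      using alt[OF \<epsilon>] by blast
    \<comment> \<open>The step t d stays in both neighbourhoods; dividing by t afterwards turns the
      Lipschitz bound into one for the partial derivative. Using \<open>norm d + 1\<close> covers d
      = 0.\<close>
    define t where "t = min r e / (2 * n1)"
    have t: "t > 0" using r(1) lip(1) n1 by (simp add: t_def)
    have "t * norm d \<le> t * n1" using t n1 by (intro mult_left_mono) auto
    also have "t * n1 = min r e / 2" using n1 by (simp add: t_def)
    finally have td: "t * norm d < r" "t * norm d < e" using r(1) lip(1) by linarith+
    have tn: "norm (t *\<^sub>R d) = t * norm d" using t by simp
    let ?w = "W c0 + t *\<^sub>R d"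
    have "norm (\<Psi> (c0, ?w) - \<Psi> (c0, W c0) - D (0, t *\<^sub>R d)) \<le> \<epsilon> * (t * norm d)"
      using r(2)[of c0 ?w] td r(1) t by simp
    moreover have "norm (\<Psi> (c0, ?w) - \<Psi> (c0, W c0)) \<le> q * (t * norm d)"
      using lip(2)[of ?w] td t by simp
    ultimately have "norm (D (0, t *\<^sub>R d)) \<le> q * (t * norm d) + \<epsilon> * (t * norm d)"
      using norm_triangle_ineq4[of "\<Psi> (c0, ?w) - \<Psi> (c0, W c0)" "\<Psi> (c0, ?w) - \<Psi> (c0, W c0) - D (0, t *\<^sub>R d)"]
      by simp
    also have "D (0, t *\<^sub>R d) = t *\<^sub>R A d" using D.scaleR[of t "(0, d)"] by (simp add: A_def)
    finally have "t * norm (A d) \<le> t * (q * norm d + \<epsilon> * norm d)"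
      using t by (simp add: algebra_simps)
    then have "norm (A d) \<le> q * norm d + \<epsilon> * norm d" using t by simp
    then show "norm (A d) \<le> q * norm d + \<eta>" using \<epsilon>d by simp
  qed
  have blA: "bounded_linear A" unfolding A_def
    by (rule bounded_linear_compose[OF bD]) (intro bounded_linear_Pair bounded_linear_zero bounded_linear_ident)
  have Az: "A (z *\<^sub>C d) = z *\<^sub>C A d" for z d using D(2)[of z 0 d] by (simp add: A_def scaleC_zero_right)
  obtain L where L: "bounded_linear L" "\<And>z d. L (z *\<^sub>C d) = z *\<^sub>C L d" "\<And>d. L (d - A d) = d"
    "\<And>d. norm (L d) \<le> 1 / (1 - q) * norm d" using operator_neumann[OF blA Az nA q] by blast
  interpret L: bounded_linear L by (rule L(1))
  define B where "B v = D (v, 0)" for v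
  have blB: "bounded_linear B" unfolding B_def
    by (rule bounded_linear_compose[OF bD]) (intro bounded_linear_Pair bounded_linear_zero bounded_linear_ident)
  obtain KB where KB: "KB \<ge> 0" "\<And>v. norm (B v) \<le> norm v * KB" using bounded_linear.nonneg_bounded[OF blB] by blast
  have DAB: "D (v, d) = B v + A d" for v d
    using D.add[of "(v, 0)" "(0, d)"] by (simp add: A_def B_def)
  define Q where "Q = 1 / (1 - q)"
  have Q: "Q > 0" using q by (simp add: Q_def)
  \<comment> \<open>The a priori constant in \<open>norm \<delta> \<le> C * norm v\<close>, obtained
    after half of \<open>norm \<delta>\<close> is absorbed on the left.\<close>
  define C where "C = 2 * Q * (KB + 1)"
  have C: "C \<ge> 0" using Q KB by (simp add: C_def)
  have "(W has_derivative (\<lambda>v. L (B v))) (at c0)"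
    unfolding has_derivative_at_alt
  proof (intro conjI allI impI)
    show "bounded_linear (\<lambda>v. L (B v))" by (rule bounded_linear_compose[OF L(1) blB])
    fix \<epsilon>0 :: real assume \<epsilon>0: "\<epsilon>0 > 0"
    \<comment> \<open>The entry 1 / (2 Q) allows the absorption, 1 keeps C independent of
      \<epsilon>, and the last entry compensates the final factor Q (1 + C).\<close>
    define \<epsilon> where "\<epsilon> = min (min 1 (1 / (2 * Q))) (\<epsilon>0 / (Q * (1 + C)))"
    have \<epsilon>: "\<epsilon> > 0" "\<epsilon> \<le> 1" "\<epsilon> \<le> 1 / (2 * Q)" "\<epsilon> \<le> \<epsilon>0 / (Q * (1 + C))"
      using Q C \<epsilon>0 by (auto simp: \<epsilon>_def)
    obtain r where r: "r > 0" "\<And>c w. norm (c - c0) < r \<Longrightarrow> norm (w - W c0) < r \<Longrightarrow>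
      norm (\<Psi> (c, w) - \<Psi> (c0, W c0) - D (c - c0, w - W c0)) \<le> \<epsilon> * (norm (c - c0) + norm (w - W c0))"
      using alt[OF \<epsilon>(1)] by blast
    obtain r2 where r2: "r2 > 0" "\<And>c. norm (c - c0) < r2 \<Longrightarrow> norm (W c - W c0) < r"
      using cont r(1) unfolding continuous_at_eps_delta dist_norm by metis
    show "\<exists>d>0. \<forall>y. norm (y - c0) < d \<longrightarrow> norm (W y - W c0 - L (B (y - c0))) \<le> \<epsilon>0 * norm (y - c0)"
    proof (intro exI[of _ "min (min r r2) e'"] conjI allI impI)
      show "0 < min (min r r2) e'" using r(1) r2(1) fixpt(1) by simp
      fix c assume c: "norm (c - c0) < min (min r r2) e'"
      define v where "v = c - c0"
      define \<delta> where "\<delta> = W c - W c0"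
      define S where "S = \<delta> - A \<delta> - B v"
      have f: "\<Psi> (c, W c) = W c" "\<Psi> (c0, W c0) = W c0" using fixpt c by auto
      have "norm (\<Psi> (c, W c) - \<Psi> (c0, W c0) - D (c - c0, W c - W c0)) \<le> \<epsilon> * (norm v + norm \<delta>)"
        unfolding v_def \<delta>_def using c r2(2) by (intro r(2)) auto
      then have nS: "norm S \<le> \<epsilon> * (norm v + norm \<delta>)"
        unfolding f DAB S_def v_def \<delta>_def by (simp add: algebra_simps)
      have \<delta>: "\<delta> = L (B v + S)" using L(3)[of \<delta>] by (simp add: S_def)
      have "norm \<delta> \<le> Q * norm (B v + S)" using L(4)[of "B v + S"] \<delta> by (simp add: Q_def)
      also have "\<dots> \<le> Q * (norm v * KB + \<epsilon> * (norm v + norm \<delta>))"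
        using Q nS KB(2)[of v] norm_triangle_ineq[of "B v" S] by (intro mult_left_mono) auto
      also have "\<dots> = Q * KB * norm v + (Q * \<epsilon>) * norm v + (Q * \<epsilon>) * norm \<delta>" by (simp add: algebra_simps)
      also have "\<dots> \<le> Q * KB * norm v + Q * norm v + (1 / 2) * norm \<delta>"
      proof (intro add_mono mult_right_mono)
        show "Q * \<epsilon> \<le> Q" using Q \<epsilon> by simp
        show "Q * \<epsilon> \<le> 1 / 2" using Q \<epsilon>(3) by (simp add: field_simps)
      qed (use KB in auto)
      finally have n\<delta>: "norm \<delta> \<le> C * norm v" by (simp add: C_def algebra_simps)
      have "\<delta> - L (B v) = L S" using \<delta> L.add[of "B v" S] by simp
      then have "norm (\<delta> - L (B v)) \<le> Q * norm S" using L(4)[of S] by (simp add: Q_def)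
      also have "\<dots> \<le> Q * (\<epsilon> * (norm v + C * norm v))"
        using Q nS n\<delta> \<epsilon>(1) by (intro mult_left_mono order_trans[OF nS] add_left_mono) auto
      also have "\<dots> = (Q * (1 + C)) * \<epsilon> * norm v" by (simp add: algebra_simps)
      also have "\<dots> \<le> \<epsilon>0 * norm v"
      proof (rule mult_right_mono)
        have "0 < Q * (1 + C)" using Q C by simp
        then show "Q * (1 + C) * \<epsilon> \<le> \<epsilon>0" using \<epsilon>(4) by (simp add: pos_le_divide_eq mult.commute)
      qed simp
      finally show "norm (W c - W c0 - L (B (c - c0))) \<le> \<epsilon>0 * norm (c - c0)" by (simp add: \<delta>_def v_def)
    qed
  qed
  moreover have "L (B (z *\<^sub>C v)) = z *\<^sub>C L (B v)" for z v
    using D(2)[of z v 0] L(2) by (simp add: B_def scaleC_zero_right)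
  ultimately show ?thesis unfolding complex_diff_def by blast
qed

lemma quotient_bound1:
  fixes g r :: real
  assumes "0 \<le> g" "0 \<le> r" "r + g \<le> 49 / 100"
  shows "g / (1 - r)\<^sup>2 \<le> 49 / 100"
proof -
  have "0 \<le> (49 / 100) * r\<^sup>2 + (2 / 100) * r" using assms by simp
  then have "49 / 100 - r \<le> 49 / 100 * (1 - r)\<^sup>2" by (simp add: power2_eq_square algebra_simps)
  then have "g \<le> 49 / 100 * (1 - r)\<^sup>2" using assms by simp
  then show ?thesis using assms by (simp add: pos_divide_le_eq)
qed

text \<open>5/6 (1 - z)^2 - (7/10 - z) is the square 5/6 (z - 2/5)^2, so 5/6 is the best constant
  for the threshold 7/10.\<close>

lemma quotient_bound2:
  fixes y z :: real
  assumes "0 \<le> y" "0 \<le> z" "y + z \<le> 7 / 10"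
  shows "y\<^sup>2 / (1 - z)\<^sup>2 \<le> 5 / 6 * y"
proof -
  have "0 \<le> (5 / 6) * (z - 2 / 5)\<^sup>2" by simp
  then have "7 / 10 - z \<le> 5 / 6 * (1 - z)\<^sup>2" by (simp add: power2_eq_square algebra_simps)
  then have "y \<le> 5 / 6 * (1 - z)\<^sup>2" using assms by simp
  then have "y * y \<le> y * (5 / 6 * (1 - z)\<^sup>2)" using assms by (intro mult_left_mono) auto
  then show ?thesis using assms by (simp add: pos_divide_le_eq power2_eq_square mult_ac)
qed

text \<open>The right-hand side is the chord of the convex function 1 / (2 - s^2) between s = 2/3
  and s = 1, and 15/14 is its slope.\<close>

lemma scalar_iteration:
  fixes s :: real
  assumes "2 / 3 < s" "s < 1"
  shows "1 / (2 - s\<^sup>2) \<le> 1 - 15 / 14 * (1 - s)"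
proof -
  have "s * s \<le> 1 * 1" using assms by (intro mult_mono) auto
  then have p: "0 < 2 - s\<^sup>2" by (simp add: power2_eq_square)
  have "14 * ((1 - 15 / 14 * (1 - s)) * (2 - s\<^sup>2) - 1) = (1 - s) * (s - 2 / 3) * (15 * s + 24)"
    by (simp add: power2_eq_square field_simps)
  moreover have "0 \<le> (1 - s) * (s - 2 / 3) * (15 * s + 24)"
    using assms by (intro mult_nonneg_nonneg) auto
  moreover have "14 * (Y - 1) = Z \<Longrightarrow> 0 \<le> Z \<Longrightarrow> 1 \<le> Y" for Y Z :: real by simp
  ultimately have "1 \<le> (1 - 15 / 14 * (1 - s)) * (2 - s\<^sup>2)" by blast
  then show ?thesis using p by (simp add: pos_divide_le_eq)
qed

text \<open>Here k stands for 1 / K and \<rho> for \<open>2 / mean_inf \<mu>1\<close>. The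
  conditions \<open>k1\<close> and \<open>k2\<close> correspond to the two entries of the maximum in
  \<open>K_const\<close>.\<close>

locale subordination =
  fixes h1 h3 :: "'b::cstar_algebra \<Rightarrow> 'b" and m1 m3 :: 'b and R1 s1 R3 s3 \<rho> k :: real
  assumes b1: "transform_bounds h1 m1 R1 s1" and b3: "transform_bounds h3 m3 R3 s3"
    and m1: "invertible_elem m1" "norm (inv_elem m1) \<le> \<rho> / 2" and \<rho>: "0 < \<rho>" and k: "0 < k"
    and k1: "\<rho> * k * (R3 + s3) \<le> 1" and k2: "\<rho>\<^sup>2 * k * (norm m3 + s3) * (R1 + s1\<^sup>2 * \<rho>) \<le> 1"
begin

lemma R_pos: "0 < R1" "0 < R3" and s_nonneg: "0 \<le> s1" "0 \<le> s3"
  using b1 b3 by (auto simp: transform_bounds_def)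

text \<open>The deviation from the mean is at most t^2 / \<rho>, and the inverse of the mean at most
  \<rho> / 2. The relative perturbation is thus t^2 / 2, and \<open>inv_near\<close> gives (\<rho> /
  2) / (1 - t^2 / 2).\<close>

lemma h1_inv:
  assumes v: "(R1 + s1\<^sup>2 * \<rho>) * norm v \<le> t\<^sup>2" and t: "0 \<le> t" "t < 1"
  shows "R1 * norm v < 1" "invertible_elem (h1 v)" "norm (inv_elem (h1 v)) \<le> \<rho> / (2 - t\<^sup>2)"
proof -
  have t2: "t\<^sup>2 < 1" using t by (simp add: abs_square_less_1)
  have g: "0 \<le> s1\<^sup>2 * \<rho> * norm v" using \<rho> by simp
  have sum: "R1 * norm v + s1\<^sup>2 * \<rho> * norm v \<le> t\<^sup>2" using v by (simp add: algebra_simps)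
  show r: "R1 * norm v < 1" using sum g t2 by linarith
  have rt: "R1 * norm v * t\<^sup>2 \<le> R1 * norm v * 1" using R_pos t2 by (intro mult_left_mono) auto
  then have "s1\<^sup>2 * \<rho> * norm v \<le> t\<^sup>2 * (1 - R1 * norm v)" using sum by (simp add: algebra_simps)
  then have "s1\<^sup>2 * norm v \<le> t\<^sup>2 / \<rho> * (1 - R1 * norm v)" using \<rho> by (simp add: field_simps)
  then have "s1\<^sup>2 * norm v / (1 - R1 * norm v) \<le> t\<^sup>2 / \<rho>" using r by (simp add: pos_divide_le_eq)
  then have d: "norm (h1 v - m1) \<le> t\<^sup>2 / \<rho>" using b1 r unfolding transform_bounds_def by fastforce
  have e: "\<rho> / 2 * (t\<^sup>2 / \<rho>) = t\<^sup>2 / 2" using \<rho> by simp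
  note n = inv_near[OF m1 d]
  show "invertible_elem (h1 v)" using n(1) t2 unfolding e by simp
  have "norm (inv_elem (h1 v)) \<le> \<rho> / 2 / (1 - t\<^sup>2 / 2)" using n(2) t2 unfolding e by simp
  also have "\<dots> = \<rho> / (2 - t\<^sup>2)" using t2 by (simp add: divide_simps)
  finally show "norm (inv_elem (h1 v)) \<le> \<rho> / (2 - t\<^sup>2)" .
qed

lemma h1_inv_two_thirds:
  assumes "(R1 + s1\<^sup>2 * \<rho>) * norm v \<le> 49 / 100"
  shows "invertible_elem (h1 v)" "norm (inv_elem (h1 v)) \<le> 2 / 3 * \<rho>" "norm (inv_elem (h1 v)) < 2 / 3 * \<rho>"
proof -
  \<comment> \<open>With t = 7/10 the bound is \<rho> / 1.51, just below 2/3 \<rho>.\<close>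
  have v: "(R1 + s1\<^sup>2 * \<rho>) * norm v \<le> (7 / 10)\<^sup>2" using assms by (simp add: power2_eq_square)
  note h = h1_inv[OF v]
  show "invertible_elem (h1 v)" using h by simp
  have "norm (inv_elem (h1 v)) \<le> \<rho> / (2 - (7 / 10)\<^sup>2)" using h by simp
  also have "\<dots> < 2 / 3 * \<rho>" using \<rho> by (simp add: power2_eq_square)
  finally show "norm (inv_elem (h1 v)) < 2 / 3 * \<rho>" .
  then show "norm (inv_elem (h1 v)) \<le> 2 / 3 * \<rho>" by simp
qed

text \<open>By the resolvent identity the difference of inverses has two inverse factors of norm at
  most 2/3 \<rho>, whence 4/9; G collects the remaining \<rho> and the Lipschitz constant of
  \<open>h1\<close>.\<close>

lemma h1_inv_lipschitz:
  assumes B: "(R1 + s1\<^sup>2 * \<rho>) * B \<le> 49 / 100" "norm x \<le> B" "norm y \<le> B"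
  obtains G where "0 \<le> G" "G * B \<le> 49 / 100"
    "norm (inv_elem (h1 x) - inv_elem (h1 y)) \<le> 4 / 9 * \<rho> * G * norm (x - y)"
proof -
  have B0: "B \<ge> 0" using B(2) norm_ge_zero order_trans by blast
  have c0: "0 \<le> R1 + s1\<^sup>2 * \<rho>" using R_pos \<rho> by simp
  have le: "(R1 + s1\<^sup>2 * \<rho>) * norm v \<le> 49 / 100" if "norm v \<le> B" for v
    using mult_left_mono[OF that c0] B(1) by linarith
  note x = h1_inv_two_thirds[OF le[OF B(2)]] and y = h1_inv_two_thirds[OF le[OF B(3)]]
  define G where "G = \<rho> * s1\<^sup>2 / (1 - R1 * B)\<^sup>2"
  have s: "R1 * B + s1\<^sup>2 * \<rho> * B \<le> 49 / 100" using B(1) by (simp add: algebra_simps)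
  have nn: "0 \<le> s1\<^sup>2 * \<rho> * B" "0 \<le> R1 * B" using \<rho> B0 R_pos by auto
  have r: "R1 * B < 1" using s nn by linarith
  have G0: "0 \<le> G" using \<rho> by (simp add: G_def)
  have "G * B = s1\<^sup>2 * \<rho> * B / (1 - R1 * B)\<^sup>2" by (simp add: G_def)
  then have GB: "G * B \<le> 49 / 100" using quotient_bound1[OF nn s] by simp
  have l: "norm (h1 y - h1 x) \<le> s1\<^sup>2 / (1 - R1 * B)\<^sup>2 * norm (y - x)"
    using b1 B r unfolding transform_bounds_def by blast
  let ?X = "h1 x" and ?Y = "h1 y"
  have "inv_elem ?X - inv_elem ?Y = inv_elem ?X * (?Y - ?X) * inv_elem ?Y"
  proof -
    have "inv_elem ?X * (?Y - ?X) * inv_elem ?Y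
        = inv_elem ?X * (?Y * inv_elem ?Y) - (inv_elem ?X * ?X) * inv_elem ?Y"
      by (simp only: left_diff_distrib right_diff_distrib mult.assoc)
    then show ?thesis using x(1) y(1) by (simp add: inv_elem_left inv_elem_right)
  qed
  then have "norm (inv_elem ?X - inv_elem ?Y)
      \<le> 2 / 3 * \<rho> * (s1\<^sup>2 / (1 - R1 * B)\<^sup>2 * norm (y - x)) * (2 / 3 * \<rho>)"
    using norm_mult_le[OF norm_mult_le[OF x(2) l] y(2)] by simp
  also have "\<dots> = 4 / 9 * \<rho> * G * norm (x - y)" by (simp add: G_def norm_minus_commute)
  finally show ?thesis using that G0 GB by blast
qed

definition arg :: "'b \<Rightarrow> 'b \<Rightarrow> 'b" where "arg c w = w * h3 (c * w) * (c * w)"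

definition \<Psi> :: "'b \<Rightarrow> 'b \<Rightarrow> 'b" where "\<Psi> c w = inv_elem (h1 (arg c w))"

text \<open>The assumption says \<open>s3 * norm x \<le> 1 - R3 * norm x\<close>, so the deviation
  from the mean is at most \<open>s3\<close>.\<close>

lemma h3_bound:
  assumes "(R3 + s3) * norm x \<le> 1" "R3 * norm x < 1"
  shows "norm (h3 x) \<le> norm m3 + s3"
proof -
  have "norm (h3 x - m3) \<le> s3\<^sup>2 * norm x / (1 - R3 * norm x)" using b3 assms(2) unfolding transform_bounds_def by blast
  moreover have "s3 * norm x \<le> 1 - R3 * norm x" using assms(1) by (simp add: algebra_simps)
  then have "s3 * (s3 * norm x) \<le> s3 * (1 - R3 * norm x)" using s_nonneg by (intro mult_left_mono) auto
  then have "s3\<^sup>2 * norm x / (1 - R3 * norm x) \<le> s3"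
    using assms(2) by (simp add: pos_divide_le_eq power2_eq_square mult.assoc)
  moreover have "norm (h3 x) \<le> norm m3 + norm (h3 x - m3)" using norm_triangle_ineq[of m3 "h3 x - m3"] by simp
  ultimately show ?thesis by linarith
qed

text \<open>Here \<open>radius\<close> is still a free variable. The pairs used for (u, radius) are
  (s \<rho>, k) for orbits and (2/3 \<rho>, 21/20 k) for the contraction.\<close>

lemma arg_bounds:
  assumes c: "norm c \<le> radius" and w: "norm w \<le> u" and radius: "u * radius * (R3 + s3) \<le> t" "t < 1"
  shows "norm (c * w) \<le> u * radius" "R3 * norm (c * w) < 1" "norm (h3 (c * w)) \<le> norm m3 + s3"
    "norm (arg c w) \<le> u * (norm m3 + s3) * (u * radius)"
proof -
  show n: "norm (c * w) \<le> u * radius" using norm_mult_le[OF c w] by (simp add: mult.commute)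
  have "(R3 + s3) * norm (c * w) \<le> (R3 + s3) * (u * radius)" using n R_pos s_nonneg by (intro mult_left_mono) auto
  then have a: "(R3 + s3) * norm (c * w) < 1" using radius by (simp add: mult.commute)
  moreover have "0 \<le> s3 * norm (c * w)" using s_nonneg by simp
  ultimately show r: "R3 * norm (c * w) < 1" by (simp add: ring_distribs)
  show h: "norm (h3 (c * w)) \<le> norm m3 + s3" using h3_bound[OF _ r] a by simp
  show "norm (arg c w) \<le> u * (norm m3 + s3) * (u * radius)"
    unfolding arg_def by (intro norm_mult_le w h n)
qed

lemma \<Psi>_bound:
  assumes c: "norm c \<le> k" and w: "norm w \<le> s * \<rho>" and s: "0 \<le> s" "s < 1"
  shows "norm (c * w) < 1 / R3" "norm (arg c w) < 1 / R1" "invertible_elem (h1 (arg c w))"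
    "norm (\<Psi> c w) \<le> \<rho> / (2 - s\<^sup>2)"
proof -
  have "s * (\<rho> * k * (R3 + s3)) \<le> s * 1" using s k1 by (intro mult_left_mono) auto
  then have 1: "s * \<rho> * k * (R3 + s3) \<le> s" by (simp add: mult.assoc)
  note a = arg_bounds[OF c w 1 s(2)]
  show "norm (c * w) < 1 / R3" using a(2) R_pos by (simp add: pos_less_divide_eq mult.commute)
  have "(R1 + s1\<^sup>2 * \<rho>) * norm (arg c w) \<le> (R1 + s1\<^sup>2 * \<rho>) * (s * \<rho> * (norm m3 + s3) * (s * \<rho> * k))"
    using a(4) R_pos \<rho> by (intro mult_left_mono) auto
  \<comment> \<open>Both outer factors of \<open>arg\<close> carry w, which is the origin of the
    square of s.\<close>
  also have "\<dots> = s\<^sup>2 * (\<rho>\<^sup>2 * k * (norm m3 + s3) * (R1 + s1\<^sup>2 * \<rho>))" by (simp add: power2_eq_square)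
  also have "\<dots> \<le> s\<^sup>2 * 1" using k2 by (intro mult_left_mono) auto
  finally have v: "(R1 + s1\<^sup>2 * \<rho>) * norm (arg c w) \<le> s\<^sup>2" by simp
  note h = h1_inv[OF v s]
  show "norm (arg c w) < 1 / R1" using h(1) R_pos by (simp add: pos_less_divide_eq mult.commute)
  show "invertible_elem (h1 (arg c w))" "norm (\<Psi> c w) \<le> \<rho> / (2 - s\<^sup>2)" using h by (simp_all add: \<Psi>_def)
qed

text \<open>The factor exceeds 1 to reach past the closed ball of radius k, and 2/3 * 21/20 = 7/10
  fits the threshold of \<open>quotient_bound2\<close>.\<close>

definition radius :: real where "radius = 21 / 20 * k"

lemma radius_bounds:
  "2 / 3 * \<rho> * radius * (R3 + s3) \<le> 7 / 10"
  "(R1 + s1\<^sup>2 * \<rho>) * (2 / 3 * \<rho> * (norm m3 + s3) * (2 / 3 * \<rho> * radius)) \<le> 49 / 100"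
proof -
  have eq: "2 / 3 * \<rho> * radius * (R3 + s3) = 7 / 10 * (\<rho> * k * (R3 + s3))" by (simp add: radius_def)
  show "2 / 3 * \<rho> * radius * (R3 + s3) \<le> 7 / 10" unfolding eq using k1 by simp
  \<comment> \<open>7/15 is 4/9 * 21/20, which is below 49/100.\<close>
  have eq: "(R1 + s1\<^sup>2 * \<rho>) * (2 / 3 * \<rho> * (norm m3 + s3) * (2 / 3 * \<rho> * radius))
      = 7 / 15 * (\<rho>\<^sup>2 * k * (norm m3 + s3) * (R1 + s1\<^sup>2 * \<rho>))" by (simp add: radius_def power2_eq_square)
  show "(R1 + s1\<^sup>2 * \<rho>) * (2 / 3 * \<rho> * (norm m3 + s3) * (2 / 3 * \<rho> * radius)) \<le> 49 / 100"
    unfolding eq by (rule order_trans[OF mult_left_mono[OF k2]]) simp_all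
qed

section \<open>The contraction on the ball of radius two thirds of \<rho>\<close>

context
  fixes c :: 'b
  assumes c: "norm c \<le> radius"
begin

lemma contraction_domain:
  assumes w: "norm w \<le> 2 / 3 * \<rho>"
  shows "norm (c * w) \<le> 2 / 3 * \<rho> * radius" "norm (c * w) < 1 / R3" "norm (h3 (c * w)) \<le> norm m3 + s3"
    "norm (arg c w) \<le> 2 / 3 * \<rho> * (norm m3 + s3) * (2 / 3 * \<rho> * radius)" "norm (arg c w) < 1 / R1"
    "invertible_elem (h1 (arg c w))" "norm (\<Psi> c w) < 2 / 3 * \<rho>"
proof -
  note a = arg_bounds[OF c w radius_bounds(1)]
  show "norm (c * w) \<le> 2 / 3 * \<rho> * radius" "norm (h3 (c * w)) \<le> norm m3 + s3"
    "norm (arg c w) \<le> 2 / 3 * \<rho> * (norm m3 + s3) * (2 / 3 * \<rho> * radius)" using a by simp_all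
  show "norm (c * w) < 1 / R3" using a(2) R_pos by (simp add: pos_less_divide_eq mult.commute)
  have "(R1 + s1\<^sup>2 * \<rho>) * norm (arg c w)
      \<le> (R1 + s1\<^sup>2 * \<rho>) * (2 / 3 * \<rho> * (norm m3 + s3) * (2 / 3 * \<rho> * radius))"
    using a(4) R_pos \<rho> by (intro mult_left_mono) auto
  then have v: "(R1 + s1\<^sup>2 * \<rho>) * norm (arg c w) \<le> 49 / 100" using radius_bounds(2) by linarith
  then show "invertible_elem (h1 (arg c w))" "norm (\<Psi> c w) < 2 / 3 * \<rho>"
    using h1_inv_two_thirds[OF v] by (simp_all add: \<Psi>_def)
  have "(R1 + s1\<^sup>2 * \<rho>) * norm (arg c w) \<le> (7 / 10)\<^sup>2" using v by (simp add: power2_eq_square)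
  from h1_inv(1)[OF this] show "norm (arg c w) < 1 / R1"
    using R_pos by (simp add: pos_less_divide_eq mult.commute)
qed

text \<open>Change the three factors of \<open>arg\<close> one at a time. Each outer factor
  contributes hb X, the middle one at most 5/6 hb X by \<open>quotient_bound2\<close>, together
  17/6; the Lipschitz bound for the inverse of \<open>h1\<close> does the rest.\<close>

lemma \<Psi>_contraction:
  assumes x: "norm x \<le> 2 / 3 * \<rho>" and y: "norm y \<le> 2 / 3 * \<rho>"
  shows "norm (\<Psi> c x - \<Psi> c y) \<le> 19 / 20 * norm (x - y)"
proof -
  note dx = contraction_domain[OF x] and dy = contraction_domain[OF y]
  define X where "X = 2 / 3 * \<rho> * radius"
  define hb where "hb = norm m3 + s3"
  define B where "B = 2 / 3 * \<rho> * hb * X"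
  have X0: "0 \<le> X" using \<rho> k by (simp add: X_def radius_def)
  have hb0: "0 \<le> hb" using s_nonneg by (simp add: hb_def)
  obtain G where G: "0 \<le> G" "G * B \<le> 49 / 100"
    "norm (inv_elem (h1 (arg c x)) - inv_elem (h1 (arg c y))) \<le> 4 / 9 * \<rho> * G * norm (arg c x - arg c y)"
    using h1_inv_lipschitz[OF _ dx(4) dy(4)] radius_bounds(2) unfolding B_def hb_def X_def by metis
  have XR: "s3 * X + R3 * X \<le> 7 / 10" using radius_bounds(1) by (simp add: X_def algebra_simps)
  have nn: "0 \<le> s3 * X" "0 \<le> R3 * X" using X0 s_nonneg R_pos by auto
  define L3 where "L3 = s3\<^sup>2 / (1 - R3 * X)\<^sup>2"
  have "L3 * X\<^sup>2 = (s3 * X)\<^sup>2 / (1 - R3 * X)\<^sup>2" by (simp add: L3_def power_mult_distrib)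
  then have LX: "L3 * X\<^sup>2 \<le> 5 / 6 * (s3 * X)" using quotient_bound2[OF nn XR] by simp
  have L30: "0 \<le> L3" by (simp add: L3_def)
  have "R3 * X < 1" using XR nn by linarith
  then have l3: "norm (h3 (c * x) - h3 (c * y)) \<le> L3 * norm (c * x - c * y)"
    using b3 dx(1) dy(1) unfolding transform_bounds_def L3_def X_def by blast
  have cd: "norm (c * x - c * y) \<le> radius * norm (x - y)"
    using norm_mult_le[OF c order_refl, of "x - y"] by (simp add: right_diff_distrib)
  have l3': "norm (h3 (c * x) - h3 (c * y)) \<le> L3 * (radius * norm (x - y))"
    using l3 mult_left_mono[OF cd L30] by linarith
  have "arg c x - arg c y = (x - y) * h3 (c * x) * (c * x) + y * (h3 (c * x) - h3 (c * y)) * (c * x)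
      + y * h3 (c * y) * (c * x - c * y)"
    by (simp add: arg_def algebra_simps)
  also have "norm \<dots> \<le> norm (x - y) * hb * X + (2 / 3 * \<rho>) * (L3 * (radius * norm (x - y))) * X
      + (2 / 3 * \<rho>) * hb * (radius * norm (x - y))"
    unfolding hb_def X_def
    by (intro order_trans[OF norm_triangle_ineq] add_mono norm_mult_le order_refl dx dy y l3' cd)
  also have "\<dots> = (2 * hb * X + L3 * X\<^sup>2) * norm (x - y)"
    by (simp add: X_def power2_eq_square algebra_simps)
  also have "\<dots> \<le> (17 / 6 * (hb * X)) * norm (x - y)"
  proof (rule mult_right_mono)
    have "s3 * X \<le> hb * X" using X0 by (intro mult_right_mono) (simp_all add: hb_def)
    then show "2 * hb * X + L3 * X\<^sup>2 \<le> 17 / 6 * (hb * X)" using LX by linarith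
  qed simp
  finally have "4 / 9 * \<rho> * G * norm (arg c x - arg c y) \<le> 4 / 9 * \<rho> * G * ((17 / 6 * (hb * X)) * norm (x - y))"
    using G(1) \<rho> by (intro mult_left_mono) auto
  \<comment> \<open>As B = 2/3 \<rho> hb X, the product 4/9 * 17/6 becomes 17/9, and 17/9 * 49/100 <
    19/20.\<close>
  also have "\<dots> = 17 / 9 * (G * B) * norm (x - y)" by (simp add: B_def)
  also have "\<dots> \<le> 19 / 20 * norm (x - y)" using G(2) by (intro mult_right_mono) auto
  finally show ?thesis using G(3) by (simp add: \<Psi>_def)
qed

lemma \<Psi>_fixed_point: "\<exists>!w. w \<in> cball 0 (2 / 3 * \<rho>) \<and> \<Psi> c w = w"
proof -
  have "\<exists>!w\<in>cball 0 (2 / 3 * \<rho>). \<Psi> c w = w"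
  proof (rule Banach_fix[where c = "19 / 20"])
    show "complete (cball (0::'b) (2 / 3 * \<rho>))" using complete_eq_closed by blast
    show "cball (0::'b) (2 / 3 * \<rho>) \<noteq> {}" using \<rho> by auto
    show "\<Psi> c ` cball 0 (2 / 3 * \<rho>) \<subseteq> cball 0 (2 / 3 * \<rho>)"
    proof (rule image_subsetI)
      fix x assume "x \<in> cball (0::'b) (2 / 3 * \<rho>)"
      then have "norm x \<le> 2 / 3 * \<rho>" by simp
      from less_imp_le[OF contraction_domain(7)[OF this]] show "\<Psi> c x \<in> cball 0 (2 / 3 * \<rho>)" by simp
    qed
    show "dist (\<Psi> c x) (\<Psi> c y) \<le> 19 / 20 * dist x y"
      if "x \<in> cball 0 (2 / 3 * \<rho>)" "y \<in> cball 0 (2 / 3 * \<rho>)" for x y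
      using that \<Psi>_contraction by (simp add: dist_norm)
  qed auto
  then show ?thesis by blast
qed

end

definition fixed_point :: "'b \<Rightarrow> 'b" where "fixed_point c = (THE w. w \<in> cball 0 (2 / 3 * \<rho>) \<and> \<Psi> c w = w)"

lemma fixed_point:
  assumes "norm c \<le> radius"
  shows "norm (fixed_point c) \<le> 2 / 3 * \<rho>" "\<Psi> c (fixed_point c) = fixed_point c" "norm (fixed_point c) < 2 / 3 * \<rho>"
    "\<And>w. norm w \<le> 2 / 3 * \<rho> \<Longrightarrow> \<Psi> c w = w \<Longrightarrow> w = fixed_point c"
proof -
  note ex = \<Psi>_fixed_point[OF assms]
  have t: "fixed_point c \<in> cball 0 (2 / 3 * \<rho>) \<and> \<Psi> c (fixed_point c) = fixed_point c" unfolding fixed_point_def by (rule theI'[OF ex])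
  then show 1: "norm (fixed_point c) \<le> 2 / 3 * \<rho>" "\<Psi> c (fixed_point c) = fixed_point c" by auto
  show "norm (fixed_point c) < 2 / 3 * \<rho>" using contraction_domain(7)[OF assms 1(1)] 1(2) by simp
  show "w = fixed_point c" if "norm w \<le> 2 / 3 * \<rho>" "\<Psi> c w = w" for w using ex t that by auto
qed

lemma complex_diff2_\<Psi>:
  assumes "norm c \<le> radius" "norm w \<le> 2 / 3 * \<rho>"
  shows "complex_diff2 (\<lambda>p. \<Psi> (fst p) (snd p)) (c, w)"
proof -
  note d = contraction_domain[OF assms]
  have h3: "complex_diff h3 (fst (c, w) * snd (c, w))" using d(2) b3 unfolding transform_bounds_def by simp
  have "complex_diff2 (\<lambda>p. arg (fst p) (snd p)) (c, w)"
    unfolding arg_def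
    by (intro complex_diff2_mult complex_diff2_fst complex_diff2_snd
        complex_diff2_compose[where f = "\<lambda>p. fst p * snd p" and g = h3 and p = "(c, w)", OF _ h3])
  moreover have "complex_diff h1 (arg (fst (c, w)) (snd (c, w)))" using d(5) b1 unfolding transform_bounds_def by simp
  ultimately have "complex_diff2 (\<lambda>p. h1 (arg (fst p) (snd p))) (c, w)" by (rule complex_diff2_compose)
  moreover have "complex_diff inv_elem (h1 (arg (fst (c, w)) (snd (c, w))))" using complex_diff_inv_elem[OF d(6)] by simp
  ultimately show ?thesis unfolding \<Psi>_def by (rule complex_diff2_compose)
qed

lemma complex_diff_fp:
  assumes c0: "norm c0 < radius"
  shows "complex_diff fixed_point c0"
proof -
  have c0': "norm c0 \<le> radius" using c0 by simp
  have cont: "isCont fixed_point c0"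
    unfolding continuous_at_eps_delta dist_norm
  proof (intro allI impI)
    fix e :: real assume e: "e > 0"
    have "isCont (\<lambda>p. \<Psi> (fst p) (snd p)) (c0, fixed_point c0)"
      using complex_diff2_\<Psi>[OF c0' fixed_point(1)[OF c0']] has_derivative_continuous unfolding complex_diff2_def by blast
    then have "isCont (\<lambda>c. (\<lambda>p. \<Psi> (fst p) (snd p)) (c, fixed_point c0)) c0"
      by (intro isCont_o2[where g = "\<lambda>p. \<Psi> (fst p) (snd p)" and f = "\<lambda>c. (c, fixed_point c0)"] continuous_intros)
    \<comment> \<open>The tolerance e / 20 is (1 - 19/20) e, which closes the estimate after the
      contraction term is absorbed.\<close>
    then obtain d where d: "d > 0" "\<And>c. norm (c - c0) < d \<Longrightarrow> norm (\<Psi> c (fixed_point c0) - \<Psi> c0 (fixed_point c0)) < e / 20"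
      using e unfolding continuous_at_eps_delta dist_norm
      by (auto dest!: spec[of _ "e / 20"])
    show "\<exists>d>0. \<forall>c. norm (c - c0) < d \<longrightarrow> norm (fixed_point c - fixed_point c0) < e"
    proof (intro exI[of _ "min d (radius - norm c0)"] conjI allI impI)
      show "0 < min d (radius - norm c0)" using d(1) c0 by simp
      fix c assume c: "norm (c - c0) < min d (radius - norm c0)"
      have ck: "norm c \<le> radius" using c norm_triangle_ineq[of "c - c0" c0] by simp
      have "norm (\<Psi> c (fixed_point c) - \<Psi> c (fixed_point c0)) \<le> 19 / 20 * norm (fixed_point c - fixed_point c0)"
        by (rule \<Psi>_contraction[OF ck fixed_point(1)[OF ck] fixed_point(1)[OF c0']])
      moreover have "fixed_point c - fixed_point c0 = (\<Psi> c (fixed_point c) - \<Psi> c (fixed_point c0)) + (\<Psi> c (fixed_point c0) - \<Psi> c0 (fixed_point c0))"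
        by (simp add: fixed_point(2)[OF ck] fixed_point(2)[OF c0'])
      then have "norm (fixed_point c - fixed_point c0) \<le> norm (\<Psi> c (fixed_point c) - \<Psi> c (fixed_point c0)) + norm (\<Psi> c (fixed_point c0) - \<Psi> c0 (fixed_point c0))"
        by (metis norm_triangle_ineq)
      moreover have "norm (\<Psi> c (fixed_point c0) - \<Psi> c0 (fixed_point c0)) < e / 20" using c d(2) by simp
      ultimately show "norm (fixed_point c - fixed_point c0) < e" by linarith
    qed
  qed
  show ?thesis
  proof (rule fixed_point_complex_diff[where \<Psi> = "\<lambda>p. \<Psi> (fst p) (snd p)" and q = "19 / 20"
        and e = "2 / 3 * \<rho> - norm (fixed_point c0)" and e' = "radius - norm c0"])
    show "complex_diff2 (\<lambda>p. \<Psi> (fst p) (snd p)) (c0, fixed_point c0)" by (rule complex_diff2_\<Psi>[OF c0' fixed_point(1)[OF c0']])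
    show "0 < 2 / 3 * \<rho> - norm (fixed_point c0)" using fixed_point(3)[OF c0'] by simp
    show "0 < radius - norm c0" using c0 by simp
    fix w assume "norm (w - fixed_point c0) < 2 / 3 * \<rho> - norm (fixed_point c0)"
    then have "norm w \<le> 2 / 3 * \<rho>" using norm_triangle_ineq[of "w - fixed_point c0" "fixed_point c0"] by simp
    from \<Psi>_contraction[OF c0' this fixed_point(1)[OF c0']]
    show "norm (\<Psi> (fst (c0, w)) (snd (c0, w)) - \<Psi> (fst (c0, fixed_point c0)) (snd (c0, fixed_point c0))) \<le> 19 / 20 * norm (w - fixed_point c0)"
      by simp
  next
    fix c assume "norm (c - c0) < radius - norm c0"
    then have "norm c \<le> radius" using norm_triangle_ineq[of "c - c0" c0] by simp
    from fixed_point(2)[OF this] show "\<Psi> (fst (c, fixed_point c)) (snd (c, fixed_point c)) = fixed_point c" by simp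
  qed (use cont in simp_all)
qed

text \<open>The candidate for the transform of \<mu>2: in w H3(w) = c H2(c) put w = c w' and cancel
  c.\<close>

definition h2 :: "'b \<Rightarrow> 'b" where "h2 c = fixed_point c * h3 (c * fixed_point c)"

lemma complex_diff_h2:
  assumes "norm c < radius"
  shows "complex_diff h2 c"
proof -
  have c': "norm c \<le> radius" using assms by simp
  have h3: "complex_diff h3 (c * fixed_point c)"
    using contraction_domain(2)[OF c' fixed_point(1)[OF c']] b3 unfolding transform_bounds_def by simp
  note f = complex_diff_fp[OF assms]
  show ?thesis unfolding h2_def
    by (rule complex_diff_mult[OF f complex_diff_compose[where f = "\<lambda>c. c * fixed_point c", OF complex_diff_mult[OF complex_diff_ident f] h3]])
qed

section \<open>Convergence of all orbits\<close>

lemma iteration_bound: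
  assumes c: "norm c \<le> k" and w: "norm w < \<rho>"
  shows "norm (\<Psi> c w) < \<rho>"
proof -
  define s where "s = norm w / \<rho>"
  have s: "0 \<le> s" "s < 1" "norm w \<le> s * \<rho>" using w \<rho> by (simp_all add: s_def)
  have "norm (\<Psi> c w) \<le> \<rho> / (2 - s\<^sup>2)" by (rule \<Psi>_bound(4)[OF c s(3,1,2)])
  also have "\<dots> < \<rho>" using s \<rho> by (simp add: divide_simps abs_square_less_1)
  finally show ?thesis .
qed

text \<open>The relative norms of the iterates are dominated by the iteration \<open>s \<mapsto> 1 / (2 - s\<^sup>2)\<close>, whose
  attracting fixed point is \<open>(sqrt 5 - 1) / 2 < 2 / 3\<close>.\<close>

lemma iteration_enters:
  assumes c: "norm c \<le> k" and w: "norm w < \<rho>"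
  shows "\<exists>n. norm ((\<Psi> c ^^ n) w) \<le> 2 / 3 * \<rho>"
proof (rule ccontr)
  assume "\<not> ?thesis"
  then have out: "norm ((\<Psi> c ^^ n) w) > 2 / 3 * \<rho>" for n by (simp add: not_le)
  define s where "s n = norm ((\<Psi> c ^^ n) w) / \<rho>" for n
  have lt: "norm ((\<Psi> c ^^ n) w) < \<rho>" for n
    by (induction n) (simp_all add: w iteration_bound[OF c])
  have s: "2 / 3 < s n" "s n < 1" for n using out[of n] lt[of n] \<rho> by (simp_all add: s_def divide_simps)
  have step: "15 / 14 * (1 - s n) \<le> 1 - s (Suc n)" for n
  proof -
    have "norm ((\<Psi> c ^^ n) w) \<le> s n * \<rho>" using \<rho> by (simp add: s_def)
    then have "norm ((\<Psi> c ^^ Suc n) w) \<le> \<rho> / (2 - (s n)\<^sup>2)"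
      using \<Psi>_bound(4)[OF c, of "(\<Psi> c ^^ n) w" "s n"] s[of n] by simp
    then have "s (Suc n) \<le> \<rho> / (2 - (s n)\<^sup>2) / \<rho>"
      unfolding s_def[of "Suc n"] using \<rho> by (intro divide_right_mono) auto
    also have "\<dots> = 1 / (2 - (s n)\<^sup>2)" using \<rho> by simp
    also have "\<dots> \<le> 1 - 15 / 14 * (1 - s n)" by (rule scalar_iteration[OF s])
    finally show ?thesis by linarith
  qed
  \<comment> \<open>Outside the smaller ball the gap 1 - s stays below 1/3, which is incompatible
    with geometric growth.\<close>
  have grow: "(15 / 14) ^ n * (1 - s 0) \<le> 1 - s n" for n
  proof (induction n)
    case (Suc n)
    have "(15 / 14) ^ Suc n * (1 - s 0) = 15 / 14 * ((15 / 14) ^ n * (1 - s 0))" by simp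
    also have "\<dots> \<le> 15 / 14 * (1 - s n)" using Suc by (intro mult_left_mono) auto
    finally show ?case using step[of n] by linarith
  qed simp
  have "1 < (15 / 14 :: real)" by simp
  then obtain n where "1 / (1 - s 0) < (15 / 14 :: real) ^ n" using real_arch_pow by blast
  then have "1 < (15 / 14) ^ n * (1 - s 0)" using s(2)[of 0] by (simp add: divide_simps)
  then show False using grow[of n] s(1)[of n] by linarith
qed

lemma iteration_converges:
  assumes c: "norm c \<le> k" and w: "norm w < \<rho>"
  shows "(\<lambda>n. (\<Psi> c ^^ n) w) \<longlonglongrightarrow> fixed_point c"
proof -
  have c': "norm c \<le> radius" using c k by (simp add: radius_def)
  obtain N where N: "norm ((\<Psi> c ^^ N) w) \<le> 2 / 3 * \<rho>" using iteration_enters[OF assms] by blast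
  have ball: "norm ((\<Psi> c ^^ (n + N)) w) \<le> 2 / 3 * \<rho>" for n
  proof (induction n)
    case (Suc n)
    from less_imp_le[OF contraction_domain(7)[OF c' Suc]] show ?case by simp
  qed (use N in simp)
  have e: "norm ((\<Psi> c ^^ (n + N)) w - fixed_point c) \<le> (19 / 20) ^ n * norm ((\<Psi> c ^^ N) w - fixed_point c)" for n
  proof (induction n)
    case (Suc n)
    have "norm ((\<Psi> c ^^ (Suc n + N)) w - fixed_point c) = norm (\<Psi> c ((\<Psi> c ^^ (n + N)) w) - \<Psi> c (fixed_point c))"
      by (simp add: fixed_point(2)[OF c'])
    also have "\<dots> \<le> 19 / 20 * norm ((\<Psi> c ^^ (n + N)) w - fixed_point c)"
      by (rule \<Psi>_contraction[OF c' ball fixed_point(1)[OF c']])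
    also have "\<dots> \<le> 19 / 20 * ((19 / 20) ^ n * norm ((\<Psi> c ^^ N) w - fixed_point c))"
      using Suc by (intro mult_left_mono) auto
    finally show ?case by simp
  qed simp
  have z: "(\<lambda>n. (19 / 20) ^ n * norm ((\<Psi> c ^^ N) w - fixed_point c)) \<longlonglongrightarrow> 0"
    by (intro tendsto_mult_left_zero LIMSEQ_realpow_zero) auto
  have "(\<lambda>n. (\<Psi> c ^^ (n + N)) w - fixed_point c) \<longlonglongrightarrow> 0"
    by (rule Lim_null_comparison[OF eventuallyI[OF e] z])
  then have "(\<lambda>n. (\<Psi> c ^^ (n + N)) w) \<longlonglongrightarrow> fixed_point c" by (simp add: LIM_zero_iff)
  then show ?thesis by (rule LIMSEQ_offset)
qed

end


section \<open>The main theorem\<close>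

lemma (in op_var) transform_bounds_h: "transform_bounds h (E a) R \<sigma>"
  unfolding transform_bounds_def
  using R_pos \<sigma>_nonneg norm_h_minus h_lipschitz complex_diff_h by blast

lemma nc_eval_alt_word:
  assumes "unital_inclusion \<iota>"
  shows "nc_eval \<iota> a (alt_word nc_const nc_X bs) = alt_word \<iota> a bs"
  by (induction bs) (simp_all add: nc_eval_simps[OF assms])

lemma distribution_alt_word:
  assumes "distribution_of \<iota> E a \<mu>"
  shows "\<mu> (alt_word nc_const nc_X bs) = E (alt_word \<iota> a bs)"
  using assms nc_eval_alt_word unfolding distribution_of_def by metis

lemma distribution_op_space: "distribution_of \<iota> E a \<mu> \<Longrightarrow> op_space \<iota> E"
  unfolding distribution_of_def op_space_def by blast

lemma distribution_op_var:
  assumes "distribution_of \<iota> E a \<mu>" "bounded_by R \<mu>"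
  shows "op_var \<iota> E a R"
proof -
  interpret op_space \<iota> E by (rule distribution_op_space[OF assms(1)])
  show ?thesis
  proof
    show "star a = a" using assms(1) by (simp add: distribution_of_def)
    show "0 < R" using assms(2) by (simp add: bounded_by_def)
    show "norm (E (alt_word \<iota> a bs)) \<le> R ^ (length bs + 1) * prod_list (map norm bs)" for bs
      using assms(2) distribution_alt_word[OF assms(1)] unfolding bounded_by_def by metis
  qed
qed

lemma distribution_mean: "distribution_of \<iota> E a \<mu> \<Longrightarrow> \<mu> nc_X = E a"
  by (simp add: distribution_of_def nc_eval_simps)

lemma (in op_var) distribution_std_dev:
  assumes "distribution_of \<iota> E a \<mu>"
  shows "std_dev \<mu> = \<sigma>"
proof -
  have "\<mu> (nc_X\<^sup>2) = E (a * a)"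
    using assms by (simp add: distribution_of_def power2_eq_square nc_eval_simps)
  moreover have "E (star (center a) * center a) = E (a * a) - E a * E a"
    unfolding E_center_square by (simp add: a_star flip: E_star)
  ultimately show ?thesis
    by (simp add: std_dev_def \<sigma>_def l2_norm_def distribution_mean[OF assms] power2_eq_square)
qed

text \<open>Supplies the moment relation required by \<open>H_extensionI\<close> for
  \<open>h2\<close>, starting from the moments of a2 alone. The realizations of \<mu>1 and \<mu>3
  are unrelated to that of the free pair; only moments are transferred.\<close>

lemma free_fixed_point:
  assumes v1: "op_var \<iota>1 E1 x1 R1" and v3: "op_var \<iota>3 E3 x3 R3" and sp: "op_space \<iota> E"
    and free: "free_over \<iota> E a1 a2"
    and eq1: "\<And>bs. E (alt_word \<iota> a1 bs) = E1 (alt_word \<iota>1 x1 bs)"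
    and eq3: "\<And>bs. E (alt_word \<iota> (a1 * a2) bs) = E3 (alt_word \<iota>3 x3 bs)"
    and sub: "subordination (op_var.h \<iota>1 E1 x1) (op_var.h \<iota>3 E3 x3) m1 m3 R1 s1 R3 s3 \<rho> k"
  shows "\<exists>d>0. \<forall>c. norm c < d \<longrightarrow> c \<in> half_planes \<longrightarrow>
    moment_gen \<iota> E a2 c = subordination.h2 (op_var.h \<iota>1 E1 x1) (op_var.h \<iota>3 E3 x3) \<rho> c
      + moment_gen \<iota> E a2 c * c * subordination.h2 (op_var.h \<iota>1 E1 x1) (op_var.h \<iota>3 E3 x3) \<rho> c"
proof -
  interpret v1: op_var \<iota>1 E1 x1 R1 by (rule v1)
  interpret v3: op_var \<iota>3 E3 x3 R3 by (rule v3)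
  interpret op_space \<iota> E by (rule sp)
  interpret S: subordination v1.h v3.h m1 m3 R1 s1 R3 s3 \<rho> k by (rule sub)
  \<comment> \<open>One constant dominates all norms and parameters, so that every smallness
    condition becomes a bound on A^3 \<open>norm c\<close>.\<close>
  define A where "A = 1 + norm a1 + norm a2 + norm x1 + norm x3 + R1 + R3 + s1\<^sup>2 * \<rho> + \<rho>"
  have nn: "0 \<le> s1\<^sup>2 * \<rho>" using S.\<rho> by simp
  have A1: "1 \<le> A" and A: "norm a1 \<le> A" "norm a2 \<le> A" "norm x1 \<le> A" "norm x3 \<le> A" "R1 \<le> A" "R3 \<le> A"
      "R1 + s1\<^sup>2 * \<rho> \<le> A" "\<rho> \<le> A"
    using nn S.R_pos S.\<rho> norm_ge_zero[of a1] norm_ge_zero[of a2] norm_ge_zero[of x1] norm_ge_zero[of x3]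
    unfolding A_def by linarith+
  \<comment> \<open>320 = 32 * 2 * 5: with \<delta> = A n and P = 4 A the condition of
    \<open>free_subordination\<close> reads 32 (A n) (A + 1) (5 A) <= 1, and A + 1 <= 2 A.\<close>
  define d where "d = min S.radius (1 / (320 * A ^ 3))"
  have d: "d > 0" using A1 S.k by (simp add: d_def S.radius_def)
  show ?thesis
  proof (intro exI[of _ d] conjI allI impI d)
    fix c :: 'a assume c: "norm c < d" and hp: "c \<in> half_planes"
    define n where "n = norm c"
    have n0: "0 \<le> n" by (simp add: n_def)
    have ck: "norm c \<le> S.radius" using c by (simp add: d_def)
    have A3: "320 * (A ^ 3 * n) < 1"
      using c A1 by (simp add: d_def n_def pos_less_divide_eq mult_ac)
    have "A ^ 1 * n \<le> A ^ 3 * n" "A ^ 2 * n \<le> A ^ 3 * n"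
      using A1 n0 by (intro mult_right_mono power_increasing; simp)+
    then have small: "320 * (A * n) < 1" "320 * (A * A * n) < 1" "320 * (A * A * A * n) < 1"
      using A3 by (simp_all add: power2_eq_square power3_eq_cube)
    have nc: "norm c = n" by (simp add: n_def)
    let ?M = "moment_gen \<iota> E a2 c"
    have a2c: "norm (a2 * \<iota> c) \<le> 1 / 2"
      using norm_mult_le[OF A(2) order_refl, of "\<iota> c"] small(1) by (simp add: norm_\<iota> nc)
    have nM: "norm ?M \<le> 2 * A" using norm_moment_gen[OF a2c] A(2) by simp
    have "norm (- (?M * c)) \<le> 1 / 2"
      using norm_mult_le[OF nM order_refl, of c] small(1) by (simp add: nc)
    from norm_inv_le_2[OF this] have inv: "invertible_elem (1 + ?M * c)" "norm (inv_elem (1 + ?M * c)) \<le> 2"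
      by simp_all
    \<comment> \<open>The only solution of M = p + M c p, hence the value that \<open>h2\<close> has
      to take at c.\<close>
    define p where "p = inv_elem (1 + ?M * c) * ?M"
    have np: "norm p \<le> 4 * A" using norm_mult_le[OF inv(2) nM] by (simp add: p_def)
    have "(1 + ?M * c) * p = ?M" unfolding p_def by (simp add: inv_elem_right[OF inv(1)] flip: mult.assoc)
    then have Mp: "?M = p + ?M * c * p" by (simp add: ring_distribs)
    define r where "r = 2 / 3 * \<rho>"
    have r: "0 < r" "r \<le> A" using S.\<rho> A(8) by (simp_all add: r_def)
    define B where "B = 4 * A * (n * r)"
    have B: "(R1 + s1\<^sup>2 * \<rho>) * B \<le> 49 / 100"
    proof -
      have "(R1 + s1\<^sup>2 * \<rho>) * B \<le> A * (4 * A * (n * A))"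
        unfolding B_def using A A1 n0 r nn S.R_pos by (intro mult_mono mult_nonneg_nonneg) auto
      also have "\<dots> = 4 * (A * A * A * n)" by simp
      finally show ?thesis using small(3) by linarith
    qed
    have nB: "norm (p * (c * w)) \<le> B" if "norm w \<le> r" for w
      unfolding B_def by (intro norm_mult_le np that) (simp add: nc)
    have c0: "0 \<le> R1 + s1\<^sup>2 * \<rho>" using S.R_pos nn by simp
    have le: "(R1 + s1\<^sup>2 * \<rho>) * norm (p * (c * w)) \<le> 49 / 100" if "norm w \<le> r" for w
      using mult_left_mono[OF nB[OF that] c0] B by linarith
    note inv7 = S.h1_inv_two_thirds[OF le, folded r_def]
    \<comment> \<open>With p frozen, the argument of the transform is linear in w, and smallness of
      c makes the map a contraction. Its fixed point w' is inverse to H1(p c w').\<close>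
    have "\<exists>!w\<in>cball 0 r. inv_elem (v1.h (p * (c * w))) = w"
    proof (rule Banach_fix[where c = "1 / 2"])
      show "complete (cball (0::'a) r)" using complete_eq_closed by blast
      show "cball (0::'a) r \<noteq> {}" using r by auto
      show "(\<lambda>w. inv_elem (v1.h (p * (c * w)))) ` cball 0 r \<subseteq> cball 0 r"
        using inv7(2) by auto
      fix x y :: 'a assume "x \<in> cball 0 r" "y \<in> cball 0 r"
      then have xy: "norm x \<le> r" "norm y \<le> r" by auto
      obtain G where G: "0 \<le> G" "G * B \<le> 49 / 100"
        "norm (inv_elem (v1.h (p * (c * x))) - inv_elem (v1.h (p * (c * y))))
          \<le> 4 / 9 * \<rho> * G * norm (p * (c * x) - p * (c * y))"
        using S.h1_inv_lipschitz[OF B nB[OF xy(1)] nB[OF xy(2)]] by blast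
      have "norm (p * (c * (x - y))) \<le> 4 * A * (n * norm (x - y))"
        by (intro norm_mult_le np) (simp_all add: nc)
      then have "norm (p * (c * x) - p * (c * y)) \<le> 4 * A * (n * norm (x - y))"
        by (simp add: right_diff_distrib)
      then have "4 / 9 * \<rho> * G * norm (p * (c * x) - p * (c * y)) \<le> 4 / 9 * \<rho> * G * (4 * A * (n * norm (x - y)))"
        using G(1) S.\<rho> by (intro mult_left_mono) auto
      also have "\<dots> = 2 / 3 * (G * B) * norm (x - y)" by (simp add: B_def r_def)
      also have "\<dots> \<le> 1 / 2 * norm (x - y)" using G(2) by (intro mult_right_mono) auto
      finally show "dist (inv_elem (v1.h (p * (c * x)))) (inv_elem (v1.h (p * (c * y)))) \<le> 1 / 2 * dist x y"
        using G(3) by (simp add: dist_norm)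
    qed auto
    then obtain w' where w': "norm w' \<le> r" "inv_elem (v1.h (p * (c * w'))) = w'" by auto
    have "w' * v1.h (p * (c * w')) = 1" using inv_elem_left[OF inv7(1)[OF w'(1)]] w'(2) by simp
    then have wh: "(c * w') * v1.h (p * (c * w')) = c" by (simp add: mult.assoc)
    have nw: "norm (c * w') \<le> A * n"
      using norm_mult_le[OF order_refl order_trans[OF w'(1) r(2)], of c] by (simp add: nc mult.commute)
    have nu: "norm (p * (c * w')) \<le> 4 * A * (A * n)" by (intro norm_mult_le np nw)
    have bound: "x * norm (p * (c * w')) < 1 / 2" if "x \<le> A" "0 \<le> x" for x
    proof -
      have "x * norm (p * (c * w')) \<le> A * (4 * A * (A * n))"
        using that A1 nu by (intro mult_mono) auto
      also have "\<dots> = 4 * (A * A * A * n)" by simp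
      finally show ?thesis using small(3) by linarith
    qed
    have bound3: "x * norm (c * w') < 1 / 2" if "x \<le> A * A" "0 \<le> x" for x
    proof -
      have "x * norm (c * w') \<le> (A * A) * (A * n)"
        using that A1 nw by (intro mult_mono) auto
      also have "\<dots> = A * A * A * n" by simp
      finally show ?thesis using small(3) by linarith
    qed
    have AA: "A \<le> A * A" using A1 by simp
    have M1: "moment_gen \<iota> E a1 (p * (c * w')) = v1.h (p * (c * w'))
        + moment_gen \<iota> E a1 (p * (c * w')) * (p * (c * w')) * v1.h (p * (c * w'))"
    proof -
      \<comment> \<open>Both elements have the same moments, and both moment series converge at this
        small argument.\<close>
      have "moment_gen \<iota> E a1 (p * (c * w')) = moment_gen \<iota>1 E1 x1 (p * (c * w'))"
        using bound[OF A(1)] bound[OF A(3)] by (intro moment_gen_eq[OF v1.op_space_axioms eq1]) auto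
      then show ?thesis using v1.moment_gen_h[of "p * (c * w')"] bound[OF A(3)] bound[OF A(5)] S.R_pos by simp
    qed
    have naa: "norm (a1 * a2) \<le> A * A" by (intro norm_mult_le A)
    have M3: "moment_gen \<iota> E (a1 * a2) (c * w') = v3.h (c * w')
        + moment_gen \<iota> E (a1 * a2) (c * w') * (c * w') * v3.h (c * w')"
    proof -
      have x3: "norm x3 \<le> A * A" "R3 \<le> A * A" using A AA by linarith+
      have "moment_gen \<iota> E (a1 * a2) (c * w') = moment_gen \<iota>3 E3 x3 (c * w')"
        using bound3[OF naa] bound3[OF x3(1)] by (intro moment_gen_eq[OF v3.op_space_axioms eq3]) auto
      then show ?thesis using v3.moment_gen_h[of "c * w'"] bound3[OF x3(1)] bound3[OF x3(2)] S.R_pos by simp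
    qed
    have "(c * w') * v3.h (c * w') = c * p"
    proof (rule free_subordination[OF free A(1,2) np _ nw _ Mp M1 wh M3])
      show "norm c \<le> A * n" using A1 n0 mult_right_mono[of 1 A n] by (simp add: nc)
      have "32 * (A * n) * (A + 1) * (A + 4 * A) = 160 * (A * A * n) * (A + 1)" by (simp add: algebra_simps)
      also have "\<dots> \<le> 160 * (A * A * n) * (2 * A)" using A1 n0 by (intro mult_left_mono) auto
      also have "\<dots> = 320 * (A * A * A * n)" by simp
      finally show "32 * (A * n) * (A + 1) * (A + 4 * A) \<le> 1" using small(3) by linarith
    qed
    then have e: "c * (w' * v3.h (c * w')) = c * p" by (simp add: mult.assoc)
    have "invertible_elem c" using hp signed_half_plane_invertible unfolding half_planes_iff by blast
    from mult_left_cancel_inv[OF inv_elem_left[OF this] e] have p: "w' * v3.h (c * w') = p" .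
    \<comment> \<open>Once w' H3(c w') = p, the element \<open>S.arg c w'\<close> equals p c w', so
      w' also solves the original equation.\<close>
    have "S.\<Psi> c w' = w'" unfolding S.\<Psi>_def S.arg_def p by (rule w'(2))
    then have "w' = S.fixed_point c" using S.fixed_point(4)[OF ck] w'(1) by (simp add: r_def)
    then have "S.h2 c = p" using p by (simp add: S.h2_def)
    then show "?M = S.h2 c + ?M * c * S.h2 c" using Mp by simp
  qed
qed

text \<open>Membership in the sets \<open>H_domain\<close> ensures that \<open>H_transform\<close>
  takes the value of the analytic extension. Invertibility of w3 makes \<open>F_transform\<close> at
  its inverse refer to \<open>H_transform\<close> at w3 itself.\<close>

theorem theorem1p6:
  fixes \<mu>1 \<mu>2 \<mu>3 :: "'b::cstar_algebra nc_poly \<Rightarrow> 'b"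
    and R1 R2 R3 :: real
    and \<iota>1 :: "'b \<Rightarrow> 'a1::cstar_algebra" and E1 :: "'a1 \<Rightarrow> 'b" and x1 :: 'a1
    and \<iota>3 :: "'b \<Rightarrow> 'a3::cstar_algebra" and E3 :: "'a3 \<Rightarrow> 'b" and x3 :: 'a3
    and \<iota> :: "'b \<Rightarrow> 'a::cstar_algebra" and E :: "'a \<Rightarrow> 'b" and a1 a2 :: 'a
    and K :: real and H1 H3 :: "'b \<Rightarrow> 'b"
  assumes "distribution \<mu>1" and "bounded_by R1 \<mu>1"
    and "distribution \<mu>2" and "bounded_by R2 \<mu>2"
    and "distribution \<mu>3" and "bounded_by R3 \<mu>3"
    and "distribution_of \<iota>3 E3 x3 \<mu>3"
    and "mult_convolution \<iota> E a1 a2 \<mu>1 \<mu>2 \<mu>3"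
    and "distribution_of \<iota>1 E1 x1 \<mu>1" and "cstar_positive x1"
    and "strictly_positive (\<mu>1 nc_X)"
    and K_def: "K = K_const R1 R3 \<mu>1 \<mu>3"
    and H1_def: "H1 = H_transform \<iota>1 E1 x1"
    and H3_def: "H3 = H_transform \<iota>3 E3 x3"
  shows "\<forall>b. invertible_elem b \<and> norm (inv_elem b) \<le> 1 / K \<longrightarrow>
    (\<forall>w \<in> Delta \<mu>1 (inv_elem b).
        norm w < 1 / R3 \<and> w \<in> H_domain \<iota>3 E3 x3
      \<and> norm (T_arg H3 (inv_elem b) w) < 1 / R1
      \<and> T_arg H3 (inv_elem b) w \<in> H_domain \<iota>1 E1 x1
      \<and> invertible_elem (H1 (T_arg H3 (inv_elem b) w))
      \<and> T_map H1 H3 (inv_elem b) w \<in> Delta \<mu>1 (inv_elem b))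
    \<and> (\<exists>w3. (\<forall>w \<in> Delta \<mu>1 (inv_elem b).
              (\<lambda>n. (T_map H1 H3 (inv_elem b) ^^ n) w) \<longlonglongrightarrow> w3)
          \<and> invertible_elem w3 \<and> w3 \<in> H_domain \<iota>3 E3 x3
          \<and> inv_elem b \<in> H_domain \<iota> E a2
          \<and> F_transform \<iota> E a2 b = b * w3 * F_transform \<iota>3 E3 x3 (inv_elem w3))"
proof -
  note bd1 = assms(2) and bd3 = assms(6) and dist3 = assms(7) and conv = assms(8) and dist1 = assms(9)
    and pos = assms(11)
  have da1: "distribution_of \<iota> E a1 \<mu>1" and da2: "distribution_of \<iota> E a2 \<mu>2" and free: "free_over \<iota> E a1 a2"
    and m3: "\<And>bs. \<mu>3 (alt_word nc_const nc_X bs) = E (alt_word \<iota> (a1 * a2) bs)"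
    using conv unfolding mult_convolution_def by blast+
  interpret v1: op_var \<iota>1 E1 x1 R1 by (rule distribution_op_var[OF dist1 bd1])
  interpret v3: op_var \<iota>3 E3 x3 R3 by (rule distribution_op_var[OF dist3 bd3])
  interpret op_space \<iota> E by (rule distribution_op_space[OF da1])
  define \<rho> where "\<rho> = 2 / mean_inf \<mu>1"
  have mean1: "\<mu>1 nc_X = E1 x1" and mean3: "\<mu>3 nc_X = E3 x3"
    using distribution_mean dist1 dist3 by blast+
  have sd: "std_dev \<mu>1 = v1.\<sigma>" "std_dev \<mu>3 = v3.\<sigma>"
    using v1.distribution_std_dev[OF dist1] v3.distribution_std_dev[OF dist3] by auto
  have inf0: "0 < mean_inf \<mu>1" and ninv: "norm (inv_elem (E1 x1)) \<le> 1 / mean_inf \<mu>1"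
    using strictly_positive_bound[OF pos] by (simp_all add: mean_inf_def mean1)
  have \<rho>: "0 < \<rho>" using inf0 by (simp add: \<rho>_def)
  \<comment> \<open>With \<rho> = \<open>2 / mean_inf \<mu>1\<close>, the summand 2
    \<open>v1.\<sigma>\<^sup>2 / mean_inf \<mu>1\<close> of the constant is
    \<open>v1.\<sigma>\<^sup>2 * \<rho>\<close>.\<close>
  define Ka where "Ka = \<rho> * (v3.\<sigma> + norm (E3 x3)) * (R1 + v1.\<sigma>\<^sup>2 * \<rho>)"
  define Kb where "Kb = R3 + v3.\<sigma>"
  have K: "K = \<rho> * max Ka Kb"
    unfolding K_def K_const_def sd mean_norm_def mean3 Ka_def Kb_def \<rho>_def by (simp add: mult_ac)
  have Kb: "0 < Kb" using v3.R_pos v3.\<sigma>_nonneg by (simp add: Kb_def)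
  have K0: "0 < K" unfolding K using \<rho> Kb by (simp add: less_max_iff_disj)
  interpret S: subordination v1.h v3.h "E1 x1" "E3 x3" R1 v1.\<sigma> R3 v3.\<sigma> \<rho> "1 / K"
  proof
    show "transform_bounds v1.h (E1 x1) R1 v1.\<sigma>" by (rule v1.transform_bounds_h)
    show "transform_bounds v3.h (E3 x3) R3 v3.\<sigma>" by (rule v3.transform_bounds_h)
    show "invertible_elem (E1 x1)" using pos by (simp add: strictly_positive_def mean1)
    show "norm (inv_elem (E1 x1)) \<le> \<rho> / 2" using ninv by (simp add: \<rho>_def)
    show "0 < \<rho>" "0 < 1 / K" using \<rho> K0 by auto
    have b: "\<rho> * Kb \<le> K" "\<rho> * Ka \<le> K" unfolding K using \<rho> by simp_all
    have e: "\<rho> * (1 / K) * (R3 + v3.\<sigma>) = \<rho> * Kb / K"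
      "\<rho>\<^sup>2 * (1 / K) * (norm (E3 x3) + v3.\<sigma>) * (R1 + v1.\<sigma>\<^sup>2 * \<rho>) = \<rho> * Ka / K"
      by (simp_all add: Ka_def Kb_def power2_eq_square add.commute mult_ac)
    show "\<rho> * (1 / K) * (R3 + v3.\<sigma>) \<le> 1"
      "\<rho>\<^sup>2 * (1 / K) * (norm (E3 x3) + v3.\<sigma>) * (R1 + v1.\<sigma>\<^sup>2 * \<rho>) \<le> 1"
      unfolding e using K0 b by simp_all
  qed
  \<comment> \<open>The strict inequality puts an inverse of norm exactly 1 / K inside the open ball
    of analyticity of \<open>h2\<close>.\<close>
  have kk: "1 / K < S.radius" "0 < S.radius" using K0 by (simp_all add: S.radius_def field_simps)
  have "\<exists>d>0. \<forall>c. norm c < d \<longrightarrow> c \<in> half_planes \<longrightarrow>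
      moment_gen \<iota> E a2 c = S.h2 c + moment_gen \<iota> E a2 c * c * S.h2 c"
  proof (rule free_fixed_point[OF v1.op_var_axioms v3.op_var_axioms op_space_axioms free _ _ S.subordination_axioms])
    show "E (alt_word \<iota> a1 bs) = E1 (alt_word \<iota>1 x1 bs)" for bs
      using distribution_alt_word[OF da1] distribution_alt_word[OF dist1] by metis
    show "E (alt_word \<iota> (a1 * a2) bs) = E3 (alt_word \<iota>3 x3 bs)" for bs
      using distribution_alt_word[OF dist3] m3 by metis
  qed
  then obtain d where d: "d > 0" "\<And>c. norm c < d \<Longrightarrow> c \<in> half_planes \<Longrightarrow>
      moment_gen \<iota> E a2 c = S.h2 c + moment_gen \<iota> E a2 c * c * S.h2 c" by blast
  have "star a2 = a2" using da2 by (simp add: distribution_of_def)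
  then have ext2: "H_extension \<iota> E a2 S.radius S.h2"
    by (rule H_extensionI[OF _ kk(2) S.complex_diff_h2 d(2,1)])
  show ?thesis
  proof (intro allI impI, elim conjE)
    fix b :: 'b assume ib: "invertible_elem b" and nb: "norm (inv_elem b) \<le> 1 / K"
    define c where "c = inv_elem b"
    have nc: "norm c \<le> 1 / K" using nb by (simp add: c_def)
    have nc': "norm c < S.radius" using nc kk by simp
    have ic: "invertible_elem c" and invc: "inv_elem c = b"
      using ib by (simp_all add: c_def invertible_inv_elem inv_elem_inv_elem)
    have bc: "b * c = 1" "c * b = 1" using ib by (simp_all add: c_def inv_elem_left inv_elem_right)
    have Delta: "Delta \<mu>1 c = {c * w' |w'. norm w' < \<rho>}" by (simp add: Delta_def \<rho>_def)
    \<comment> \<open>In the coordinate w' the inverse of c cancels the left factor c of w, so w' ->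
      c w' conjugates \<open>\<Psi>\<close> to the map T.\<close>
    have main: "norm (c * w') < 1 / R3" "H3 (c * w') = v3.h (c * w')" "T_arg H3 c (c * w') = S.arg c w'"
      "norm (S.arg c w') < 1 / R1" "invertible_elem (v1.h (S.arg c w'))" "T_map H1 H3 c (c * w') = c * S.\<Psi> c w'"
      if w': "norm w' < \<rho>" for w'
    proof -
      define s where "s = norm w' / \<rho>"
      have s: "norm w' \<le> s * \<rho>" "0 \<le> s" "s < 1" using w' \<rho> by (simp_all add: s_def)
      note B = S.\<Psi>_bound[OF nc s]
      show "norm (c * w') < 1 / R3" "norm (S.arg c w') < 1 / R1" "invertible_elem (v1.h (S.arg c w'))"
        using B by simp_all
      show h3: "H3 (c * w') = v3.h (c * w')" unfolding H3_def by (rule v3.H_transform_h(2)[OF B(1)])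
      show arg: "T_arg H3 c (c * w') = S.arg c w'"
        unfolding T_arg_def h3 invc S.arg_def by (simp add: bc(1) flip: mult.assoc)
      have "H1 (S.arg c w') = v1.h (S.arg c w')" unfolding H1_def by (rule v1.H_transform_h(2)[OF B(2)])
      then show "T_map H1 H3 c (c * w') = c * S.\<Psi> c w'" unfolding T_map_def arg S.\<Psi>_def by simp
    qed
    have lt: "norm ((S.\<Psi> c ^^ n) w') < \<rho>" if "norm w' < \<rho>" for w' n
      by (induction n) (simp_all add: that S.iteration_bound[OF nc])
    have iter: "(T_map H1 H3 c ^^ n) (c * w') = c * (S.\<Psi> c ^^ n) w'" if "norm w' < \<rho>" for w' n
      by (induction n) (simp_all add: main(6) lt that)
    define w3 where "w3 = c * S.fixed_point c"
    note fixed_point = S.fixed_point[OF less_imp_le[OF nc']]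
    have fpd: "norm (S.fixed_point c) < \<rho>" using fixed_point(3) \<rho> by simp
    \<comment> \<open>The fixed point is a value of \<open>\<Psi>\<close>, that is, an
      inverse.\<close>
    have "invertible_elem (S.\<Psi> c (S.fixed_point c))"
      unfolding S.\<Psi>_def by (rule invertible_inv_elem[OF main(5)[OF fpd]])
    then have iw3: "invertible_elem w3" unfolding w3_def fixed_point(2) by (rule invertible_elem_mult[OF ic])
    have dom3: "w3 \<in> H_domain \<iota>3 E3 x3" and h3w: "H_transform \<iota>3 E3 x3 w3 = v3.h w3"
      unfolding w3_def using v3.H_transform_h[OF main(1)[OF fpd]] by auto
    have dom2: "c \<in> H_domain \<iota> E a2" and h2c: "H_transform \<iota> E a2 c = S.h2 c"
      using H_transform_eq[OF ext2 nc'] by auto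
    \<comment> \<open>F of \<mu>3 at \<open>inv_elem w3\<close> is
      \<open>inv_elem w3 - v3.h w3\<close>. Since b c = 1, the second term becomes w' H3(c w') at
      the fixed point, which is \<open>S.h2 c\<close>.\<close>
    have "b * w3 * F_transform \<iota>3 E3 x3 (inv_elem w3) = b * (w3 * inv_elem w3) - b * c * S.fixed_point c * v3.h w3"
      unfolding F_transform_def inv_elem_inv_elem[OF iw3] h3w
      by (simp add: right_diff_distrib mult.assoc w3_def)
    also have "\<dots> = b - S.h2 c" unfolding inv_elem_right[OF iw3] by (simp add: bc S.h2_def w3_def)
    also have "\<dots> = F_transform \<iota> E a2 b" by (simp add: F_transform_def h2c flip: c_def)
    finally have F: "F_transform \<iota> E a2 b = b * w3 * F_transform \<iota>3 E3 x3 (inv_elem w3)" by simp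
    have lims: "(\<lambda>n. (T_map H1 H3 c ^^ n) w) \<longlonglongrightarrow> w3" if wD: "w \<in> Delta \<mu>1 c" for w
    proof -
      obtain w' where w': "w = c * w'" "norm w' < \<rho>" using wD unfolding Delta by blast
      show ?thesis unfolding w'(1) iter[OF w'(2)] w3_def
        by (intro tendsto_mult tendsto_const S.iteration_converges[OF nc w'(2)])
    qed
    have steps: "norm w < 1 / R3 \<and> w \<in> H_domain \<iota>3 E3 x3 \<and> norm (T_arg H3 c w) < 1 / R1
      \<and> T_arg H3 c w \<in> H_domain \<iota>1 E1 x1 \<and> invertible_elem (H1 (T_arg H3 c w))
      \<and> T_map H1 H3 c w \<in> Delta \<mu>1 c" if wD: "w \<in> Delta \<mu>1 c" for w
    proof -
      obtain w' where w': "w = c * w'" "norm w' < \<rho>" using wD unfolding Delta by blast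
      note m = main[OF w'(2)]
      have "T_map H1 H3 c w \<in> Delta \<mu>1 c"
        unfolding w'(1) m(6) Delta using S.iteration_bound[OF nc w'(2)] by blast
      then show ?thesis
        using m v3.H_transform_h(1)[OF m(1)] v1.H_transform_h[OF m(4)] by (simp add: w'(1) H1_def)
    qed
    show "(\<forall>w \<in> Delta \<mu>1 (inv_elem b).
        norm w < 1 / R3 \<and> w \<in> H_domain \<iota>3 E3 x3
      \<and> norm (T_arg H3 (inv_elem b) w) < 1 / R1
      \<and> T_arg H3 (inv_elem b) w \<in> H_domain \<iota>1 E1 x1
      \<and> invertible_elem (H1 (T_arg H3 (inv_elem b) w))
      \<and> T_map H1 H3 (inv_elem b) w \<in> Delta \<mu>1 (inv_elem b))
    \<and> (\<exists>w3. (\<forall>w \<in> Delta \<mu>1 (inv_elem b).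
              (\<lambda>n. (T_map H1 H3 (inv_elem b) ^^ n) w) \<longlonglongrightarrow> w3)
          \<and> invertible_elem w3 \<and> w3 \<in> H_domain \<iota>3 E3 x3
          \<and> inv_elem b \<in> H_domain \<iota> E a2
          \<and> F_transform \<iota> E a2 b = b * w3 * F_transform \<iota>3 E3 x3 (inv_elem w3))"
      using steps lims iw3 dom3 dom2 F unfolding c_def[symmetric] by blast
  qed
qed

end
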